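(* Let $\Omega\subset\mathbb{R}^n$ be a bounded nonempty open set. If $f_1,f_2\in W^{1,p(\cdot)}(\Omega)$ are bounded and $(f_1-f_2)_+\in W^{1,p(\cdot)}_0(\Omega)$, then $Hf_1\le Hf_2$ in $\Omega$.
   Context: Standing assumptions: $p:\mathbb{R}^n\to[1,\infty]$ is measurable, $1<p^-:=\operatorname{ess\,inf}_{\mathbb{R}^n}p\le p^+:=\operatorname{ess\,sup}_{\mathbb{R}^n}p<\infty$, and $p$ is log-H\"older continuous: there is $L>0$ with $|p(x)-p(y)|\le L/\log(e+1/|x-y|)$ for all $x,y\in\mathbb{R}^n$. Here $g_+=\max\{g,0\}$. For an open set $\Omega$, $L^{p(\cdot)}(\Omega)$ is the space of measurable $u:\Omega\to\mathbb{R}$ with finite norm $\|u\|_{L^{p(\cdot)}(\Omega)}=\inf\{\lambda>0:\int_\Omega|u(x)/\lambda|^{p(x)}\,dx\le1\}$; $W^{1,p(\cdot)}(\Omega)$ consists of $u\in L^{p(\cdot)}(\Omega)$ with distributional gradient $\nabla u\in L^{p(\cdot)}(\Omega)$, with norm $\|u\|_{L^{p(\cdot)}(\Omega)}+\|\nabla u\|_{L^{p(\cdot)}(\Omega)}$. $W^{1,p(\cdot)}_0(\Omega)$ is the closure in $W^{1,p(\cdot)}(\Omega)$ of the $W^{1,p(\cdot)}(\mathbb{R}^n)$-functions with compact support in $\Omega$. For bounded $f\in W^{1,p(\cdot)}(\Omega)$, $Hf$ is the unique continuous function $u$ in $\Omega$ with $u-f\in W^{1,p(\cdot)}_0(\Omega)$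 minimizing $\int_\Omega|\nabla v|^{p(x)}\,dx$ among all $v\in W^{1,p(\cdot)}(\Omega)$ with $v-f\in W^{1,p(\cdot)}_0(\Omega)$. *)

theory Defs
  imports "HOL-Probability.Essential_Supremum"
begin

text \<open>
  Euclidean space is an arbitrary type \<open>'a::euclidean_space\<close>, so that \<open>n = DIM('a)\<close>. A function on
  an open set \<open>\<Omega>\<close> is represented by a total function whose values outside \<open>\<Omega>\<close> are
  irrelevant, and elements of function spaces are functions, not classes modulo equality
  almost everywhere.
\<close>

section \<open>Exponents\<close>

definition essinf :: "'a measure \<Rightarrow> ('a \<Rightarrow> ereal) \<Rightarrow> ereal"
  where "essinf M f = - esssup M (\<lambda>x. - f x)"

text \<open>For \<open>x = y\<close> the bound below reads \<open>0 \<le> L\<close>, because \<open>1 / 0 = 0\<close>.\<close>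

definition log_Hoelder :: "('a::metric_space \<Rightarrow> real) \<Rightarrow> bool"
  where "log_Hoelder p \<longleftrightarrow>
    (\<exists>L>0. \<forall>x y. \<bar>p x - p y\<bar> \<le> L / ln (exp 1 + 1 / dist x y))"

text \<open>
  The value \<open>\<infinity>\<close> need not be admitted for an exponent: log-Hoelder continuity on the
  whole space together with \<open>p\<^sup>+ < \<infinity>\<close> excludes it at every point.
\<close>

definition admissible_exponent :: "('a::euclidean_space \<Rightarrow> real) \<Rightarrow> bool"
  where "admissible_exponent p \<longleftrightarrow>
    p \<in> borel_measurable lebesgue \<and> (\<forall>x. 1 \<le> p x) \<and>
    1 < essinf lebesgue (\<lambda>x. ereal (p x)) \<and>
    esssup lebesgue (\<lambda>x. ereal (p x)) < \<infinity> \<and>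
    log_Hoelder p"

section \<open>Variable exponent Lebesgue spaces\<close>

definition modular ::
    "('a::euclidean_space \<Rightarrow> real) \<Rightarrow> 'a set \<Rightarrow> ('a \<Rightarrow> 'b::real_normed_vector) \<Rightarrow> ennreal"
  where "modular p \<Omega> u = (\<integral>\<^sup>+x. ennreal (norm (u x) powr p x) \<partial>lebesgue_on \<Omega>)"

text \<open>The infimum is taken in \<open>[0, \<infinity>]\<close>, so it is \<open>\<infinity>\<close> if no \<open>l\<close> qualifies.\<close>

definition Luxemburg_norm ::
    "('a::euclidean_space \<Rightarrow> real) \<Rightarrow> 'a set \<Rightarrow> ('a \<Rightarrow> 'b::real_normed_vector) \<Rightarrow> ennreal"
  where "Luxemburg_norm p \<Omega> u =
    Inf (ennreal ` {l. 0 < l \<and> modular p \<Omega> (\<lambda>x. u x /\<^sub>R l) \<le> 1})"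

definition Lp_var ::
    "('a::euclidean_space \<Rightarrow> real) \<Rightarrow> 'a set \<Rightarrow> ('a \<Rightarrow> 'b::real_normed_vector) set"
  where "Lp_var p \<Omega> = {u \<in> borel_measurable (lebesgue_on \<Omega>). Luxemburg_norm p \<Omega> u < \<infinity>}"

section \<open>Distributional gradients\<close>

primrec C_k :: "nat \<Rightarrow> ('a::euclidean_space \<Rightarrow> real) \<Rightarrow> bool" where
  "C_k 0 \<phi> \<longleftrightarrow> continuous_on UNIV \<phi>"
| "C_k (Suc k) \<phi> \<longleftrightarrow> (\<forall>x. \<phi> differentiable (at x)) \<and>
     (\<forall>b\<in>Basis. C_k k (\<lambda>x. frechet_derivative \<phi> (at x) b))"

definition compact_support_in :: "('a::euclidean_space \<Rightarrow> real) \<Rightarrow> 'a set \<Rightarrow> bool"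
  where "compact_support_in \<phi> \<Omega> \<longleftrightarrow>
    compact (closure {x. \<phi> x \<noteq> 0}) \<and> closure {x. \<phi> x \<noteq> 0} \<subseteq> \<Omega>"

definition test_functions :: "'a::euclidean_space set \<Rightarrow> ('a \<Rightarrow> real) set"
  where "test_functions \<Omega> = {\<phi>. (\<forall>k. C_k k \<phi>) \<and> compact_support_in \<phi> \<Omega>}"

definition locally_integrable ::
    "'a::euclidean_space set \<Rightarrow> ('a \<Rightarrow> 'b::euclidean_space) \<Rightarrow> bool"
  where "locally_integrable \<Omega> u \<longleftrightarrow>
    (\<forall>K. compact K \<longrightarrow> K \<subseteq> \<Omega> \<longrightarrow> u absolutely_integrable_on K)"

definition is_weak_gradient ::
    "'a::euclidean_space set \<Rightarrow> ('a \<Rightarrow> real) \<Rightarrow> ('a \<Rightarrow> 'a) \<Rightarrow> bool"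
  where "is_weak_gradient \<Omega> u G \<longleftrightarrow>
    locally_integrable \<Omega> u \<and> locally_integrable \<Omega> G \<and>
    (\<forall>\<phi>\<in>test_functions \<Omega>. \<forall>b\<in>Basis.
       (\<integral>x. u x * frechet_derivative \<phi> (at x) b \<partial>lebesgue_on \<Omega>) =
       - (\<integral>x. (G x \<bullet> b) * \<phi> x \<partial>lebesgue_on \<Omega>))"

text \<open>
  On an open set the weak gradient is unique up to equality almost everywhere, and it is only
  used below in ways that do not depend on the representative.
\<close>

definition weak_gradient :: "'a::euclidean_space set \<Rightarrow> ('a \<Rightarrow> real) \<Rightarrow> 'a \<Rightarrow> 'a"
  where "weak_gradient \<Omega> u = (SOME G. is_weak_gradient \<Omega> u G)"

section \<open>Variable exponent Sobolev spaces\<close>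

definition Sobolev ::
    "('a::euclidean_space \<Rightarrow> real) \<Rightarrow> 'a set \<Rightarrow> ('a \<Rightarrow> real) set"
  where "Sobolev p \<Omega> =
    {u \<in> Lp_var p \<Omega>. (\<exists>G. is_weak_gradient \<Omega> u G) \<and> weak_gradient \<Omega> u \<in> Lp_var p \<Omega>}"

definition Sobolev_norm ::
    "('a::euclidean_space \<Rightarrow> real) \<Rightarrow> 'a set \<Rightarrow> ('a \<Rightarrow> real) \<Rightarrow> ennreal"
  where "Sobolev_norm p \<Omega> u =
    Luxemburg_norm p \<Omega> u + Luxemburg_norm p \<Omega> (weak_gradient \<Omega> u)"

text \<open>
  The closure with respect to the Sobolev norm on \<open>\<Omega>\<close>. An approximating function whose
  essential support is a compact subset of \<open>\<Omega>\<close> may be set to \<open>0\<close> off that support, so it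
  does no harm that the support of \<open>v\<close> is the pointwise one.
\<close>

definition Sobolev0 ::
    "('a::euclidean_space \<Rightarrow> real) \<Rightarrow> 'a set \<Rightarrow> ('a \<Rightarrow> real) set"
  where "Sobolev0 p \<Omega> = {u \<in> Sobolev p \<Omega>. \<forall>\<epsilon>>0. \<exists>v \<in> Sobolev p UNIV.
    compact_support_in v \<Omega> \<and> Sobolev_norm p \<Omega> (\<lambda>x. u x - v x) < ennreal \<epsilon>}"

section \<open>The Dirichlet problem\<close>

definition essentially_bounded_on :: "'a::euclidean_space set \<Rightarrow> ('a \<Rightarrow> real) \<Rightarrow> bool"
  where "essentially_bounded_on \<Omega> f \<longleftrightarrow> (\<exists>M. AE x in lebesgue_on \<Omega>. \<bar>f x\<bar> \<le> M)"

definition Dirichlet_energy ::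
    "('a::euclidean_space \<Rightarrow> real) \<Rightarrow> 'a set \<Rightarrow> ('a \<Rightarrow> real) \<Rightarrow> ennreal"
  where "Dirichlet_energy p \<Omega> v = modular p \<Omega> (weak_gradient \<Omega> v)"

text \<open>
  \<open>is_H p \<Omega> f u\<close> expresses \<open>u = H f\<close> on \<open>\<Omega>\<close>. The operator \<open>H\<close> is given by its graph since its
  values are determined on \<open>\<Omega>\<close> only; that \<open>H f\<close> is unique there is not part of the
  definition.
\<close>

definition is_H ::
    "('a::euclidean_space \<Rightarrow> real) \<Rightarrow> 'a set \<Rightarrow> ('a \<Rightarrow> real) \<Rightarrow> ('a \<Rightarrow> real) \<Rightarrow> bool"
  where "is_H p \<Omega> f u \<longleftrightarrow>
    continuous_on \<Omega> u \<and> u \<in> Sobolev p \<Omega> \<and> (\<lambda>x. u x - f x) \<in> Sobolev0 p \<Omega> \<and>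
    (\<forall>v \<in> Sobolev p \<Omega>. (\<lambda>x. v x - f x) \<in> Sobolev0 p \<Omega> \<longrightarrow>
       Dirichlet_energy p \<Omega> u \<le> Dirichlet_energy p \<Omega> v)"

end

(*
  Write u1, u2 for the two minimizers and v for the positive part of u1 - u2. Since v is
  dominated by the positive part of (u1 - f1) - (u2 - f2) + (f1 - f2)_+, which has zero boundary
  values, so has v, and u1 - v/2 and u2 + v/2 are admissible competitors. On {u1 > u2} both have
  the gradient (grad u1 + grad u2)/2, and elsewhere they keep the gradients of u1 and u2, so
  minimality and strict convexity of t^p(x) force grad v = 0. A function with zero boundary
  values and zero gradient, extended by 0, is invariant under translations and has bounded
  support, so v = 0.

  The calculus of weak gradients avoids mollification. By duality with test functions, the
  difference quotients of an integrable function converge in L^1 to its weak derivative, and the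
  chain rule for the positive part is read off from the one-sided difference quotients.
*)
theory Submission
  imports Defs
begin

section \<open>Smooth functions\<close>

text \<open>The competitors take half of v because the full step would exchange u1 and u2 on {u1 >
  u2}: that shows only that both have the same energy there and leaves uniqueness of minimizers to
  be argued. The half step puts the midpoint of the two gradients into both competitors, and strict
  convexity gives equality of the gradients at once. Zero boundary values are defined by closure in
  a Luxemburg norm, which does not split pointwise. As 1 \<le> p \<le> P, smallness of the norm and
  smallness of the modular are equivalent, so convergence is measured by modulars: they are
  integrals and satisfy a triangle inequality up to a factor depending on P. Approximants with rate
  2^-n converge also almost everywhere, which is needed for the positive part because its gradient
  contains the indicator function of {u > 0}. The comparison is first obtained almost everywhere.
  Continuity of u1 and u2 makes {u1 > u2} open, and an open null set is empty.\<close>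

lemma C_k_SucI:
  assumes "\<And>x. (f has_derivative f' x) (at x)" "\<And>b. b \<in> Basis \<Longrightarrow> C_k k (\<lambda>x. f' x b)"
  shows "C_k (Suc k) f"
proof -
  have "frechet_derivative f (at x) = f' x" for x
    using frechet_derivative_at[OF assms(1)] by simp
  then show ?thesis
    using assms by (auto simp: differentiable_def)
qed

lemma C_k_SucD:
  assumes "C_k (Suc k) f"
  shows "(f has_derivative frechet_derivative f (at x)) (at x)"
    and "b \<in> Basis \<Longrightarrow> C_k k (\<lambda>x. frechet_derivative f (at x) b)"
  using assms by (auto simp: frechet_derivative_works)

lemma C_k_continuous: "C_k k f \<Longrightarrow> continuous_on UNIV f"
  by (cases k) (auto intro!: continuous_at_imp_continuous_on differentiable_imp_continuous_within)

declare C_k.simps(2) [simp del]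

lemma C_k_Suc_imp: "C_k (Suc k) f \<Longrightarrow> C_k k f"
proof (induction k arbitrary: f)
  case 0
  then show ?case using C_k_continuous C_k.simps(1) by blast
next
  case (Suc k)
  show ?case
    using C_k_SucD[OF Suc.prems] Suc.IH by (intro C_k_SucI) blast+
qed

lemma C_k_const: "C_k k (\<lambda>x. c)"
proof (induction k arbitrary: c)
  case (Suc k)
  show ?case by (rule C_k_SucI[of _ "\<lambda>x h. 0"]) (auto simp: Suc)
qed simp

lemma C_k_inner_right: "C_k k (\<lambda>x. x \<bullet> c)"
proof (cases k)
  case 0
  then show ?thesis by (auto intro!: continuous_intros)
next
  case (Suc k)
  show ?thesis unfolding Suc
    by (rule C_k_SucI[of _ "\<lambda>x h. h \<bullet> c"]) (auto intro!: derivative_eq_intros C_k_const)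
qed

lemma C_k_add:
  assumes "C_k k f" "C_k k g"
  shows "C_k k (\<lambda>x. f x + g x)"
  using assms
proof (induction k arbitrary: f g)
  case (Suc k)
  show ?case
    by (rule C_k_SucI[of _ "\<lambda>x h. frechet_derivative f (at x) h + frechet_derivative g (at x) h"])
      (use C_k_SucD[OF Suc.prems(1)] C_k_SucD[OF Suc.prems(2)] Suc.IH in
        \<open>auto intro!: has_derivative_add\<close>)
qed (auto intro: continuous_intros)

lemma C_k_mult:
  assumes "C_k k f" "C_k k g"
  shows "C_k k (\<lambda>x. f x * g x)"
  using assms
proof (induction k arbitrary: f g)
  case (Suc k)
  show ?case
    by (rule C_k_SucI[of _ "\<lambda>x h. f x * frechet_derivative g (at x) h + frechet_derivative f (at x) h * g x"])
      (use C_k_SucD[OF Suc.prems(1)] C_k_SucD[OF Suc.prems(2)] Suc.IH C_k_Suc_imp[OF Suc.prems(1)]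
        C_k_Suc_imp[OF Suc.prems(2)] in \<open>auto intro!: has_derivative_mult C_k_add\<close>)
qed (auto intro: continuous_intros)

lemma C_k_diff:
  assumes "C_k k f" "C_k k g"
  shows "C_k k (\<lambda>x. f x - g x)"
  using C_k_add[OF assms(1) C_k_mult[OF C_k_const[of k "-1"] assms(2)]] by simp

lemma C_k_sum:
  assumes "\<And>i. i \<in> I \<Longrightarrow> C_k k (f i)"
  shows "C_k k (\<lambda>x. \<Sum>i\<in>I. f i x)"
  using assms
  by (induction I rule: infinite_finite_induct) (auto intro: C_k_const C_k_add)

text \<open>The outer function is scalar, so the chain rule yields a product: the derivative of
  \<open>h\<close> at \<open>f x\<close> times a partial derivative of \<open>f\<close>. Both
  functions are generalized in the induction, whose hypothesis is applied to the derivative of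
  \<open>h\<close>.\<close>

lemma C_k_compose:
  fixes h :: "real \<Rightarrow> real"
  assumes "C_k k h" "C_k k f"
  shows "C_k k (\<lambda>x. h (f x))"
  using assms
proof (induction k arbitrary: h f)
  case 0
  then show ?case by (auto intro: continuous_on_compose2[of UNIV h])
next
  case (Suc k)
  have *: "((\<lambda>x. h (f x)) has_derivative
      (\<lambda>b. frechet_derivative h (at (f x)) 1 * frechet_derivative f (at x) b)) (at x)" for x
  proof -
    \<comment> \<open>A linear map on the reals is multiplication by its value at 1.\<close>
    have "frechet_derivative h (at y) t = frechet_derivative h (at y) 1 * t" for y t
      using linear_cmul[OF has_derivative_linear[OF C_k_SucD(1)[OF Suc.prems(1), of y]], of t 1]
      by simp
    then have "(\<lambda>b. frechet_derivative h (at (f x)) (frechet_derivative f (at x) b)) =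
        (\<lambda>b. frechet_derivative h (at (f x)) 1 * frechet_derivative f (at x) b)"
      by (intro ext)
    then show ?thesis
      using has_derivative_compose[OF C_k_SucD(1)[OF Suc.prems(2), of x] C_k_SucD(1)[OF Suc.prems(1)]]
      by (simp only:)
  qed
  have "C_k k (\<lambda>x. frechet_derivative h (at (f x)) 1)"
    by (rule Suc.IH[OF C_k_SucD(2)[OF Suc.prems(1)] C_k_Suc_imp[OF Suc.prems(2)]]) simp
  then show ?case
    by (intro C_k_SucI[OF *] C_k_mult C_k_SucD(2)[OF Suc.prems(2)])
qed

lemma C_k_translate:
  assumes "C_k k f"
  shows "C_k k (\<lambda>x. f (x + a))"
  using assms
proof (induction k arbitrary: f)
  case 0
  then show ?case by (auto intro!: continuous_on_compose2[of UNIV f] continuous_intros)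
next
  case (Suc k)
  have *: "((\<lambda>x. f (x + a)) has_derivative frechet_derivative f (at (x + a))) (at x)" for x
    by (rule has_derivative_compose[of "\<lambda>x. x + a" "\<lambda>x. x" x UNIV f, OF _ C_k_SucD(1)[OF Suc.prems]])
      (auto intro!: derivative_eq_intros)
  show ?case
    by (rule C_k_SucI[OF *]) (use C_k_SucD[OF Suc.prems] Suc.IH in auto)
qed

text \<open>The factor \<open>(1 / t) ^ m\<close> makes the family closed under differentiation, up to linear
  combinations.\<close>

definition exp_flat :: "nat \<Rightarrow> real \<Rightarrow> real"
  where "exp_flat m t = (if t \<le> 0 then 0 else (1 / t) ^ m * exp (- (1 / t)))"

text \<open>Substituting s = 1 / t turns the right-hand limit into that of s ^ m / exp s at
  infinity; on the left the function is zero.\<close>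

lemma exp_flat_tendsto_0: "(exp_flat m \<longlongrightarrow> 0) (at 0)"
proof -
  have "((\<lambda>s::real. s ^ m / exp s) \<longlongrightarrow> 0) at_top"
    by (rule tendsto_power_div_exp_0)
  then have "((\<lambda>t::real. (inverse t) ^ m / exp (inverse t)) \<longlongrightarrow> 0) (at_right 0)"
    by (rule filterlim_compose[OF _ filterlim_inverse_at_top_right])
  then have r: "(exp_flat m \<longlongrightarrow> 0) (at_right 0)"
    by (rule Lim_transform_eventually)
      (auto simp: eventually_at_filter exp_flat_def exp_minus field_simps)
  have l: "(exp_flat m \<longlongrightarrow> 0) (at_left 0)"
    by (rule tendsto_eventually) (auto simp: eventually_at_filter exp_flat_def)
  show ?thesis
    using l r by (simp add: filterlim_split_at)
qed

lemma exp_flat_has_derivative: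
  "(exp_flat m has_real_derivative (exp_flat (m + 2) t - m * exp_flat (m + 1) t)) (at t)"
proof -
  consider "t < 0" | "t = 0" | "t > 0" by linarith
  then show ?thesis
  proof cases
    case 1
    have "((\<lambda>_. 0) has_real_derivative 0) (at t)" by simp
    then have "(exp_flat m has_real_derivative 0) (at t)"
      by (rule has_field_derivative_transform_within[where d = "-t"])
        (use 1 in \<open>auto simp: exp_flat_def dist_real_def\<close>)
    then show ?thesis using 1 by (simp add: exp_flat_def)
  next
    case 2
    \<comment> \<open>At the origin the difference quotient of \<open>exp_flat m\<close> is
      \<open>exp_flat (Suc m)\<close> itself.\<close>
    have "((\<lambda>h. exp_flat (Suc m) h) \<longlongrightarrow> 0) (at 0)" by (rule exp_flat_tendsto_0)
    then have "((\<lambda>h. (exp_flat m (0 + h) - exp_flat m 0) / h) \<longlongrightarrow> 0) (at 0)"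
      by (rule Lim_transform_eventually) (auto simp: eventually_at_filter exp_flat_def field_simps)
    then show ?thesis using 2 by (simp add: DERIV_def exp_flat_def)
  next
    case 3
    have "((\<lambda>t. (1 / t) ^ m * exp (- (1 / t))) has_real_derivative
        (exp_flat (m + 2) t - m * exp_flat (m + 1) t)) (at t)"
    proof -
      have 1: "((\<lambda>t. 1 / t) has_real_derivative - ((1 / t)\<^sup>2)) (at t)"
        using 3 by (auto intro!: derivative_eq_intros simp: power2_eq_square field_simps)
      have 2: "((\<lambda>t. (1 / t) ^ m) has_real_derivative - (m * (1 / t) ^ (m + 1))) (at t)"
        using DERIV_power[OF 1, of m] by (cases m) (simp_all add: algebra_simps power2_eq_square)
      have "((\<lambda>t. exp (- (1 / t))) has_real_derivative exp (- (1 / t)) * (1 / t)\<^sup>2) (at t)"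
        using DERIV_chain2[OF DERIV_exp DERIV_minus[OF 1]] by simp
      from DERIV_mult[OF 2 this] show ?thesis
        by (rule DERIV_cong) (use 3 in \<open>simp add: exp_flat_def algebra_simps power2_eq_square\<close>)
    qed
    then show ?thesis
      by (rule has_field_derivative_transform_within[where d = t])
        (use 3 in \<open>auto simp: exp_flat_def dist_real_def\<close>)
  qed
qed

lemma C_k_exp_flat: "C_k k (exp_flat m)"
proof (induction k arbitrary: m)
  case 0
  show ?case
    using DERIV_isCont[OF exp_flat_has_derivative] by (auto intro!: continuous_at_imp_continuous_on)
next
  case (Suc k)
  show ?case
    by (rule C_k_SucI[OF exp_flat_has_derivative[unfolded has_field_derivative_def]])
      (auto intro!: C_k_diff C_k_mult C_k_const Suc)
qed

lemma exp_flat_0_mono: "s \<le> t \<Longrightarrow> exp_flat 0 s \<le> exp_flat 0 t"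
  by (auto simp: exp_flat_def frac_le)

lemma exp_flat_0_pos_iff: "exp_flat 0 t > 0 \<longleftrightarrow> t > 0"
  by (auto simp: exp_flat_def)

text \<open>Two nested copies of \<open>exp_flat 0\<close> replace the usual quotient, so closure
  under composition and multiplication by constants suffices. With c = \<open>exp_flat 0 1\<close>,
  the inner argument \<open>c - exp_flat 0 t\<close> equals c for t \<le> 0 and is at most 0 for t
  \<ge> 1, where the outer function vanishes.\<close>

lemma smooth_step:
  obtains h :: "real \<Rightarrow> real"
  where "\<And>k. C_k k h" "\<And>t. 0 \<le> h t" "\<And>t. h t \<le> 1" "\<And>t. t \<le> 0 \<Longrightarrow> h t = 0" "\<And>t. 1 \<le> t \<Longrightarrow> h t = 1"
proof
  define c where "c = exp_flat 0 1"
  have c: "c > 0" by (simp add: c_def exp_flat_def)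
  let ?h = "\<lambda>t. 1 - (1 / exp_flat 0 c) * exp_flat 0 (c - exp_flat 0 t)"
  have 0: "exp_flat 0 c > 0" using c by (simp add: exp_flat_0_pos_iff)
  have nn: "0 \<le> exp_flat 0 t" for t by (simp add: exp_flat_def)
  show "C_k k ?h" for k
    by (intro C_k_diff[OF C_k_const C_k_mult[OF C_k_const C_k_compose[OF C_k_exp_flat]]]
        C_k_diff[OF C_k_const C_k_exp_flat])
  show "0 \<le> ?h t" for t
    using exp_flat_0_mono[of "c - exp_flat 0 t" c] nn[of t] 0 by simp
  show "?h t \<le> 1" for t
    using nn 0 by simp
  show "?h t = 0" if "t \<le> 0" for t
    using that 0 by (simp add: exp_flat_def)
  show "?h t = 1" if "1 \<le> t" for t
    using exp_flat_0_mono[OF that] by (simp add: c_def exp_flat_def)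
qed

section \<open>Test functions\<close>

lemma test_functionsD:
  assumes "\<phi> \<in> test_functions \<Omega>"
  shows "C_k k \<phi>" "compact (closure {x. \<phi> x \<noteq> 0})" "closure {x. \<phi> x \<noteq> 0} \<subseteq> \<Omega>"
  using assms by (auto simp: test_functions_def compact_support_in_def)

lemma test_functions_support:
  assumes "\<phi> \<in> test_functions \<Omega>" "x \<notin> \<Omega>"
  shows "\<phi> x = 0"
  using closure_subset[of "{x. \<phi> x \<noteq> 0}"] test_functionsD(3)[OF assms(1)] assms(2) by blast

lemma test_functionsI:
  assumes "\<And>k. C_k k \<phi>" "compact K" "K \<subseteq> \<Omega>" "\<And>x. x \<notin> K \<Longrightarrow> \<phi> x = 0"
  shows "\<phi> \<in> test_functions \<Omega>"
proof -
  have "closure {x. \<phi> x \<noteq> 0} \<subseteq> K"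
    using assms by (intro closure_minimal) (auto intro: compact_imp_closed)
  then show ?thesis
    using assms(1-3) unfolding test_functions_def compact_support_in_def
    by (auto simp: compact_eq_bounded_closed intro: bounded_subset)
qed

text \<open>Finitely many smooth bumps supported in \<open>U\<close> have a sum which is positive on
  \<open>K\<close>. Dividing it by its minimum there and applying a smooth step gives the value 1 on
  \<open>K\<close> and keeps the support in finitely many closed balls.\<close>

lemma smooth_Urysohn:
  fixes K U :: "'a::euclidean_space set"
  assumes "compact K" "open U" "K \<subseteq> U"
  obtains \<eta> where "\<eta> \<in> test_functions U" "\<And>x. 0 \<le> \<eta> x" "\<And>x. \<eta> x \<le> 1" "\<And>x. x \<in> K \<Longrightarrow> \<eta> x = 1"
proof -
  have "\<exists>r>0. cball x r \<subseteq> U" if "x \<in> K" for x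
    using assms that open_contains_cball by blast
  then obtain r where r: "\<And>x. x \<in> K \<Longrightarrow> r x > 0" "\<And>x. x \<in> K \<Longrightarrow> cball x (r x) \<subseteq> U"
    by metis
  \<comment> \<open>For \<open>x0\<close> in \<open>K\<close> this bump is positive exactly on the
    open ball of radius \<open>r x0\<close>. The squared distance is used because it is a
    polynomial.\<close>
  define b where "b = (\<lambda>x0 x. exp_flat 0 ((r x0)\<^sup>2 - (x - x0) \<bullet> (x - x0)))"
  have b_pos: "b x0 x > 0 \<longleftrightarrow> (dist x0 x)\<^sup>2 < (r x0)\<^sup>2" for x0 x
    by (simp add: b_def exp_flat_0_pos_iff dist_norm dot_square_norm norm_minus_commute)
  have b_nn: "b x0 x \<ge> 0" for x0 x
    by (simp add: b_def exp_flat_def)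
  have C: "C_k k (b x0)" for k x0
  proof -
    have "C_k k (\<lambda>x. (r x0)\<^sup>2 - (\<Sum>i\<in>Basis. (x \<bullet> i - x0 \<bullet> i) * (x \<bullet> i - x0 \<bullet> i)))"
      by (intro C_k_diff C_k_mult C_k_const C_k_sum C_k_inner_right)
    moreover have "(\<lambda>x. \<Sum>i\<in>Basis. (x \<bullet> i - x0 \<bullet> i) * (x \<bullet> i - x0 \<bullet> i)) = (\<lambda>x. (x - x0) \<bullet> (x - x0))"
      by (subst (2) euclidean_inner) (simp add: inner_diff_left)
    ultimately have "C_k k (\<lambda>x. (r x0)\<^sup>2 - (x - x0) \<bullet> (x - x0))"
      by metis
    then show ?thesis
      unfolding b_def by (rule C_k_compose[OF C_k_exp_flat])
  qed
  have "K \<subseteq> (\<Union>x\<in>K. ball x (r x))" using r by auto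
  then obtain F where F: "finite F" "F \<subseteq> K" "K \<subseteq> (\<Union>x\<in>F. ball x (r x))"
    by (rule compactE_image[OF assms(1), of K "\<lambda>x. ball x (r x)", rotated]) auto
  define s where "s = (\<lambda>x. \<Sum>x0\<in>F. b x0 x)"
  have s_C: "C_k k s" for k unfolding s_def by (intro C_k_sum C)
  have s_pos: "s x > 0" if "x \<in> K" for x
  proof -
    obtain x0 where x0: "x0 \<in> F" "x \<in> ball x0 (r x0)" using F(3) \<open>x \<in> K\<close> by blast
    then have "b x0 x > 0" unfolding b_pos by (auto intro!: power_strict_mono)
    then show ?thesis unfolding s_def using x0 F b_nn by (intro sum_pos2) auto
  qed
  \<comment> \<open>By compactness the sum has a positive minimum on \<open>K\<close>; the value 1
    serves when \<open>K\<close> is empty.\<close>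
  obtain c where c: "c > 0" "\<And>x. x \<in> K \<Longrightarrow> c \<le> s x"
  proof (cases "K = {}")
    case False
    then obtain y where "y \<in> K" "\<And>x. x \<in> K \<Longrightarrow> s y \<le> s x"
      using continuous_attains_inf[OF assms(1) False, of s] C_k_continuous[OF s_C]
      by (meson continuous_on_subset subset_UNIV)
    then show ?thesis using s_pos that by blast
  qed (auto intro: that[of 1])
  obtain h :: "real \<Rightarrow> real" where h: "\<And>k. C_k k h" "\<And>t. 0 \<le> h t" "\<And>t. h t \<le> 1"
    "\<And>t. t \<le> 0 \<Longrightarrow> h t = 0" "\<And>t. 1 \<le> t \<Longrightarrow> h t = 1" using smooth_step by blast
  show ?thesis
  proof
    let ?\<eta> = "\<lambda>x. h ((1 / c) * s x)"
    show "?\<eta> \<in> test_functions U"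
    proof (rule test_functionsI)
      show "C_k k ?\<eta>" for k by (intro C_k_compose[OF h(1)] C_k_mult C_k_const s_C)
      show "compact (\<Union>x\<in>F. cball x (r x))" using F by (intro compact_UN) auto
      show "(\<Union>x\<in>F. cball x (r x)) \<subseteq> U" using F r by blast
      fix x assume x: "x \<notin> (\<Union>x\<in>F. cball x (r x))"
      have "b x0 x = 0" if "x0 \<in> F" for x0
      proof -
        have "r x0 < dist x0 x" "r x0 > 0" using x that F r by auto
        then have "(r x0)\<^sup>2 \<le> (dist x0 x)\<^sup>2" by (intro power_mono) auto
        then have "\<not> b x0 x > 0" unfolding b_pos by simp
        then show ?thesis using b_nn[of x0 x] by linarith
      qed
      then show "?\<eta> x = 0" using h(4) by (simp add: s_def)
    qed
    show "?\<eta> x = 1" if "x \<in> K" for x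
      using c(2)[OF that] c(1) by (intro h(5)) simp
  qed (use h in auto)
qed

lemma eq_0_off_closure: "x \<notin> closure {x. f x \<noteq> 0} \<Longrightarrow> f x = 0"
  using closure_subset[of "{x. f x \<noteq> 0}"] by auto

lemma test_functions_mult:
  assumes "\<phi> \<in> test_functions \<Omega>" "\<And>k. C_k k \<psi>"
  shows "(\<lambda>x. \<phi> x * \<psi> x) \<in> test_functions \<Omega>"
proof (rule test_functionsI[OF _ test_functionsD(2,3)[OF assms(1)]])
  show "C_k k (\<lambda>x. \<phi> x * \<psi> x)" for k
    by (rule C_k_mult[OF test_functionsD(1)[OF assms(1)] assms(2)])
  show "\<phi> x * \<psi> x = 0" if "x \<notin> closure {x. \<phi> x \<noteq> 0}" for x
    using eq_0_off_closure[OF that] by simp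
qed

lemma test_functions_diff:
  assumes "\<phi> \<in> test_functions \<Omega>" "\<psi> \<in> test_functions \<Omega>"
  shows "(\<lambda>x. \<phi> x - \<psi> x) \<in> test_functions \<Omega>"
proof (rule test_functionsI)
  show "C_k k (\<lambda>x. \<phi> x - \<psi> x)" for k
    by (intro C_k_diff test_functionsD(1)[OF assms(1)] test_functionsD(1)[OF assms(2)])
  show "compact (closure {x. \<phi> x \<noteq> 0} \<union> closure {x. \<psi> x \<noteq> 0})"
    by (intro compact_Un test_functionsD(2)[OF assms(1)] test_functionsD(2)[OF assms(2)])
  show "closure {x. \<phi> x \<noteq> 0} \<union> closure {x. \<psi> x \<noteq> 0} \<subseteq> \<Omega>"
    using test_functionsD(3)[OF assms(1)] test_functionsD(3)[OF assms(2)] by blast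
  fix x assume "x \<notin> closure {x. \<phi> x \<noteq> 0} \<union> closure {x. \<psi> x \<noteq> 0}"
  then show "\<phi> x - \<psi> x = 0"
    using eq_0_off_closure[of x \<phi>] eq_0_off_closure[of x \<psi>] by simp
qed

lemma test_functions_mono: "\<phi> \<in> test_functions S \<Longrightarrow> S \<subseteq> T \<Longrightarrow> \<phi> \<in> test_functions T"
  by (auto simp: test_functions_def compact_support_in_def)

lemma test_functions_translate:
  assumes "\<phi> \<in> test_functions UNIV"
  shows "(\<lambda>x. \<phi> (x + a)) \<in> test_functions UNIV"
proof (rule test_functionsI)
  show "C_k k (\<lambda>x. \<phi> (x + a))" for k
    by (rule C_k_translate[OF test_functionsD(1)[OF assms]])
  show "compact ((\<lambda>x. x - a) ` closure {x. \<phi> x \<noteq> 0})"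
    by (intro compact_continuous_image continuous_intros test_functionsD(2)[OF assms])
  show "\<phi> (x + a) = 0" if "x \<notin> (\<lambda>x. x - a) ` closure {x. \<phi> x \<noteq> 0}" for x
  proof -
    have "x + a \<notin> closure {x. \<phi> x \<noteq> 0}"
      using that by (metis add_diff_cancel_right' image_eqI)
    then show ?thesis by (rule eq_0_off_closure)
  qed
qed auto

lemma test_functions_has_derivative:
  assumes "\<phi> \<in> test_functions \<Omega>"
  shows "(\<phi> has_derivative frechet_derivative \<phi> (at x)) (at x)"
  by (rule C_k_SucD(1)[OF test_functionsD(1)[OF assms, of "Suc 0"]])

lemma frechet_derivative_eq_0_off_closure:
  fixes f :: "'a::real_normed_vector \<Rightarrow> 'b::real_normed_vector"
  assumes "x \<notin> closure {x. f x \<noteq> 0}"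
  shows "frechet_derivative f (at x) b = 0"
proof -
  have "((\<lambda>_. 0) has_derivative (\<lambda>_. 0)) (at x)" by simp
  then have "(f has_derivative (\<lambda>_. 0)) (at x)"
    by (rule has_derivative_transform_within_open[of _ _ _ _ "- closure {x. f x \<noteq> 0}"])
      (use assms closure_subset[of "{x. f x \<noteq> 0}"] in auto)
  then show ?thesis using frechet_derivative_at by metis
qed

lemma test_functions_derivative:
  assumes "\<phi> \<in> test_functions \<Omega>" "b \<in> Basis"
  shows "(\<lambda>x. frechet_derivative \<phi> (at x) b) \<in> test_functions \<Omega>"
  by (rule test_functionsI[OF C_k_SucD(2) test_functionsD(2,3)[OF assms(1)]])
    (auto intro: test_functionsD(1)[OF assms(1)] assms(2) frechet_derivative_eq_0_off_closure)

lemma test_functions_bounded: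
  assumes "\<phi> \<in> test_functions \<Omega>"
  obtains B where "B > 0" "\<And>x. \<bar>\<phi> x\<bar> \<le> B"
proof -
  have "compact (\<phi> ` closure {x. \<phi> x \<noteq> 0})"
    using C_k_continuous[OF test_functionsD(1)[OF assms]] test_functionsD(2)[OF assms]
    by (intro compact_continuous_image) (auto intro: continuous_on_subset)
  then obtain B where B: "B > 0" "\<And>x. x \<in> closure {x. \<phi> x \<noteq> 0} \<Longrightarrow> \<bar>\<phi> x\<bar> \<le> B"
    using compact_imp_bounded bounded_pos by (metis imageI real_norm_def)
  have "\<bar>\<phi> x\<bar> \<le> B" for x
    by (cases "\<phi> x = 0") (use B closure_subset[of "{x. \<phi> x \<noteq> 0}"] in auto)
  then show thesis using B(1) that by blast
qed

lemma test_functions_measurable: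
  assumes "\<phi> \<in> test_functions \<Omega>"
  shows "\<phi> \<in> borel_measurable borel" "\<phi> \<in> borel_measurable lebesgue"
proof -
  show "\<phi> \<in> borel_measurable borel"
    by (rule borel_measurable_continuous_onI[OF C_k_continuous[OF test_functionsD(1)[OF assms]]])
  then show "\<phi> \<in> borel_measurable lebesgue" by (simp add: measurable_completion)
qed

lemma integrable_mult_test_function:
  assumes "integrable lebesgue f" "\<phi> \<in> test_functions \<Omega>"
  shows "integrable lebesgue (\<lambda>x. f x * \<phi> x :: real)"
proof -
  obtain B where B: "B > 0" "\<And>x. \<bar>\<phi> x\<bar> \<le> B"
    using test_functions_bounded[OF assms(2)] by blast
  show ?thesis
  proof (rule Bochner_Integration.integrable_bound)
    show "integrable lebesgue (\<lambda>x. B * f x)" using assms(1) by simp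
    show "(\<lambda>x. f x * \<phi> x) \<in> borel_measurable lebesgue"
      using assms(1) test_functions_measurable(2)[OF assms(2)] by measurable
    show "AE x in lebesgue. norm (f x * \<phi> x) \<le> norm (B * f x)"
    proof (intro AE_I2)
      fix x
      show "norm (f x * \<phi> x) \<le> norm (B * f x)"
        using mult_left_mono[OF B(2)[of x], of "\<bar>f x\<bar>"] B(1) by (simp add: abs_mult mult.commute)
    qed
  qed
qed

section \<open>Integrals over the whole space\<close>

lemma measurable_lebesgue_translate: "(\<lambda>x. x + a) \<in> lebesgue \<rightarrow>\<^sub>M (lebesgue :: 'a::euclidean_space measure)"
  and distr_lebesgue_translate: "distr lebesgue lebesgue (\<lambda>x. x + a) = (lebesgue :: 'a::euclidean_space measure)"
proof -
  have *: "(\<lambda>x. a + (\<Sum>j\<in>Basis. (1 * (x \<bullet> j)) *\<^sub>R j)) = (\<lambda>x. x + a)"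
    by (auto simp: euclidean_representation add.commute)
  show "(\<lambda>x. x + a) \<in> lebesgue \<rightarrow>\<^sub>M (lebesgue :: 'a measure)"
    using lebesgue_affine_measurable[of "\<lambda>_. 1" a] unfolding * by simp
  show "distr lebesgue lebesgue (\<lambda>x. x + a) = (lebesgue :: 'a measure)"
    using lebesgue_affine_euclidean[of "\<lambda>_. 1" a] unfolding * by (simp add: density_1)
qed

lemma integrable_lebesgue_translate:
  fixes f :: "'a::euclidean_space \<Rightarrow> 'b::{banach, second_countable_topology}"
  assumes "integrable lebesgue f"
  shows "integrable lebesgue (\<lambda>x. f (x + a))"
  using integrable_distr[OF measurable_lebesgue_translate, of a f] assms
  by (simp add: distr_lebesgue_translate)

lemma integral_lebesgue_translate:
  fixes f :: "'a::euclidean_space \<Rightarrow> 'b::{banach, second_countable_topology}"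
  assumes "f \<in> borel_measurable lebesgue"
  shows "(\<integral>x. f (x + a) \<partial>lebesgue) = (\<integral>x. f x \<partial>lebesgue)"
  using integral_distr[OF measurable_lebesgue_translate assms, of a]
  by (simp add: distr_lebesgue_translate)

text \<open>Up to a null set, \<open>P\<close> is a countable union of compact sets. The integrals
  over \<open>P\<close> minus the finite partial unions tend to 0 by dominated convergence.\<close>

lemma compact_subset_small_integral:
  fixes w :: "'a::euclidean_space \<Rightarrow> real"
  assumes w: "integrable lebesgue w" and P: "P \<in> sets lebesgue" and "\<epsilon> > 0"
  obtains K where "compact K" "K \<subseteq> P" "(\<integral>x. indicator (P - K) x * \<bar>w x\<bar> \<partial>lebesgue) < \<epsilon>"
proof -
  obtain C T where C: "fsigma C" "T \<in> null_sets lebesgue" "C \<union> T = P"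
    using lebesgue_set_almost_fsigma[OF P] by metis
  then obtain F :: "nat \<Rightarrow> 'a set" where F: "\<And>n. compact (F n)" "C = \<Union> (range F)"
    using fsigma_Union_compact[of C] by (metis mem_Collect_eq range_subsetD)
  define K where "K = (\<lambda>n. \<Union>i\<le>n. F i)"
  have K: "compact (K n)" "K n \<subseteq> P" for n
    using F C(3) by (auto simp: K_def intro!: compact_UN)
  have Kl: "K n \<in> sets lebesgue" for n
    using K(1) lmeasurable_compact by blast
  have [measurable]: "w \<in> borel_measurable lebesgue" using w by simp
  have "(\<lambda>n. \<integral>x. indicator (P - K n) x * \<bar>w x\<bar> \<partial>lebesgue) \<longlonglongrightarrow> (\<integral>x. 0 \<partial>(lebesgue :: 'a measure))"
  proof (rule integral_dominated_convergence[where w = "\<lambda>x. \<bar>w x\<bar>"])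
    show "(\<lambda>x. indicator (P - K n) x * \<bar>w x\<bar>) \<in> borel_measurable lebesgue" for n
      using P Kl[of n] by measurable
    have "AE x in lebesgue. x \<notin> T"
      using C(2) by (rule AE_not_in)
    then show "AE x in lebesgue. (\<lambda>n. indicator (P - K n) x * \<bar>w x\<bar>) \<longlonglongrightarrow> 0"
    proof eventually_elim
      fix x assume x: "x \<notin> T"
      show "(\<lambda>n. indicator (P - K n) x * \<bar>w x\<bar>) \<longlonglongrightarrow> 0"
      proof (cases "x \<in> P")
        case True
        then obtain m where "x \<in> F m" using x C(3) F(2) by auto
        then have "indicator (P - K n) x * \<bar>w x\<bar> = 0" if "n \<ge> m" for n
          using that by (auto simp: K_def indicator_def)
        then show ?thesis
          by (intro tendsto_eventually eventually_sequentiallyI)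
      qed (simp add: indicator_def)
    qed
    show "AE x in lebesgue. norm (indicator (P - K n) x * \<bar>w x\<bar>) \<le> \<bar>w x\<bar>" for n
      by (auto simp: indicator_def)
  qed (use w in auto)
  then have "\<forall>\<^sub>F n in sequentially. (\<integral>x. indicator (P - K n) x * \<bar>w x\<bar> \<partial>lebesgue) < \<epsilon>"
    using \<open>\<epsilon> > 0\<close> by (intro order_tendstoD(2)[of _ "0::real"]) auto
  from eventually_happens'[OF sequentially_bot this]
  obtain n where "(\<integral>x. indicator (P - K n) x * \<bar>w x\<bar> \<partial>lebesgue) < \<epsilon>"
    by blast
  with K show thesis by (intro that)
qed

lemma integral_abs_add_le:
  fixes f g :: "'a \<Rightarrow> real"
  assumes "integrable M f" "integrable M g"
  shows "(\<integral>x. \<bar>f x + g x\<bar> \<partial>M) \<le> (\<integral>x. \<bar>f x\<bar> \<partial>M) + (\<integral>x. \<bar>g x\<bar> \<partial>M)"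
  by (subst Bochner_Integration.integral_add[symmetric])
    (auto intro!: integral_mono integrable_abs Bochner_Integration.integrable_add assms)

text \<open>Continuity of translations in L^1, by induction over integrable functions. For an
  indicator function, compact sets from inside and open sets from outside make the effect of a small
  shift visible; sums follow from the triangle inequality and limits from an e / 3 argument.\<close>

lemma tendsto_translation_L1:
  fixes f :: "'a::euclidean_space \<Rightarrow> real"
  assumes "integrable lebesgue f"
  shows "((\<lambda>h. \<integral>x. \<bar>f (x + h) - f x\<bar> \<partial>lebesgue) \<longlongrightarrow> 0) (at 0)"
  using assms
proof (induction f rule: integrable_induct)
  case (base A c)
  show ?case
  proof (rule tendstoI)
    fix e :: real assume "e > 0"
    \<comment> \<open>There are four error sets of measure below \<epsilon>, so the total is at most
      4 |c| \<epsilon>, which is less than e.\<close>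
    define \<epsilon> where "\<epsilon> = e / (5 * (\<bar>c\<bar> + 1))"
    have \<epsilon>: "\<epsilon> > 0" using \<open>e > 0\<close> by (simp add: \<epsilon>_def)
    have A_int: "integrable lebesgue (indicator A :: 'a \<Rightarrow> real)"
      using base by (simp add: integrable_indicator_iff)
    obtain K where K: "compact K" "K \<subseteq> A" "(\<integral>x. indicator (A - K) x * \<bar>indicator A x\<bar> \<partial>lebesgue) < \<epsilon>"
      using compact_subset_small_integral[OF A_int base(1) \<epsilon>] by blast
    obtain U where U: "open U" "A \<subseteq> U" "U - A \<in> lmeasurable" "emeasure lebesgue (U - A) < ennreal \<epsilon>"
      using sets_lebesgue_outer_open[OF base(1) \<epsilon>] by blast
    have KA: "A - K \<in> lmeasurable"
      using base K(1) lmeasurable_compact by (intro fmeasurable.Diff) (auto simp: fmeasurable_def)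
    have "(\<lambda>x. indicator (A - K) x * \<bar>indicator A x :: real\<bar>) = indicator (A - K)"
      by (auto simp: indicator_def)
    then have m1: "measure lebesgue (A - K) < \<epsilon>"
      using K(3) by simp
    have m2: "measure lebesgue (U - A) < \<epsilon>"
      using U(3,4) \<epsilon> by (simp add: emeasure_eq_measure2 ennreal_less_iff)
    obtain d where d: "d > 0" "\<And>x y. x \<in> K \<Longrightarrow> y \<in> - U \<Longrightarrow> d \<le> dist x y"
      using separate_compact_closed[OF K(1), of "- U"] U(1,2) K(2) by blast
    have small: "(\<integral>x. \<bar>indicator A (x + h) *\<^sub>R c - indicator A x *\<^sub>R c\<bar> \<partial>lebesgue) < e" if "norm h < d" for h
    proof -
      let ?R = "\<lambda>x. \<bar>c\<bar> * (indicator (A - K) x + indicator (A - K) (x + h) + indicator (U - A) x + indicator (U - A) (x + h))"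
      have i: "integrable lebesgue (indicator (A - K) :: 'a \<Rightarrow> real)" "integrable lebesgue (indicator (U - A) :: 'a \<Rightarrow> real)"
        using KA U(3) by (auto simp: lmeasurable_iff_integrable)
      note i' = integrable_lebesgue_translate[OF i(1), of h] integrable_lebesgue_translate[OF i(2), of h]
      have "(\<integral>x. \<bar>indicator A (x + h) *\<^sub>R c - indicator A x *\<^sub>R c\<bar> \<partial>lebesgue) \<le> (\<integral>x. ?R x \<partial>lebesgue)"
      proof (rule integral_mono)
        show "integrable lebesgue (\<lambda>x. \<bar>indicator A (x + h) *\<^sub>R c - indicator A x *\<^sub>R c\<bar>)"
          using A_int integrable_lebesgue_translate[OF A_int, of h] by simp
        show "integrable lebesgue ?R" using i i' by simp
        fix x
        \<comment> \<open>If exactly one of \<open>x\<close> and \<open>x + h\<close> belongs to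
          \<open>A\<close>, that one lies in \<open>A - K\<close>, or it lies in \<open>K\<close>
          and the other one lies in \<open>U - A\<close>.\<close>
        have "x + h \<in> U" if "x \<in> K"
          using d(2)[OF that, of "x + h"] \<open>norm h < d\<close> by (auto simp: dist_norm)
        moreover have "x \<in> U" if "x + h \<in> K"
          using d(2)[OF that, of x] \<open>norm h < d\<close> by (auto simp: dist_norm)
        ultimately show "\<bar>indicator A (x + h) *\<^sub>R c - indicator A x *\<^sub>R c\<bar> \<le> ?R x"
          by (auto simp: indicator_def)
      qed
      also have "\<dots> = \<bar>c\<bar> * (2 * measure lebesgue (A - K) + 2 * measure lebesgue (U - A))"
        using i i' integral_lebesgue_translate[OF borel_measurable_integrable[OF i(1)], of h]
          integral_lebesgue_translate[OF borel_measurable_integrable[OF i(2)], of h] by simp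
      also have "\<dots> \<le> \<bar>c\<bar> * (4 * \<epsilon>)"
        using m1 m2 by (intro mult_left_mono) auto
      also have "\<dots> < e"
        using \<open>e > 0\<close> by (simp add: \<epsilon>_def field_simps)
          (smt (verit, best) mult_nonneg_nonneg)
      finally show ?thesis .
    qed
    show "\<forall>\<^sub>F h in at 0. dist (\<integral>x. \<bar>indicator A (x + h) *\<^sub>R c - indicator A x *\<^sub>R c\<bar> \<partial>lebesgue) 0 < e"
      unfolding eventually_at using d(1) small
      by (intro exI[of _ d]) (auto simp: dist_real_def)
  qed
next
  case (add f g)
  have "((\<lambda>h. (\<integral>x. \<bar>f (x + h) - f x\<bar> \<partial>lebesgue) + (\<integral>x. \<bar>g (x + h) - g x\<bar> \<partial>lebesgue)) \<longlongrightarrow> 0) (at 0)"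
    using tendsto_add[OF add.IH] by simp
  then show ?case
  proof (rule Lim_null_comparison[rotated], intro always_eventually allI)
    fix h
    have "(\<integral>x. \<bar>(f (x + h) - f x) + (g (x + h) - g x)\<bar> \<partial>lebesgue) \<le>
        (\<integral>x. \<bar>f (x + h) - f x\<bar> \<partial>lebesgue) + (\<integral>x. \<bar>g (x + h) - g x\<bar> \<partial>lebesgue)"
      using add.hyps by (intro integral_abs_add_le Bochner_Integration.integrable_diff integrable_lebesgue_translate)
    then show "norm (\<integral>x. \<bar>f (x + h) + g (x + h) - (f x + g x)\<bar> \<partial>lebesgue) \<le>
        (\<integral>x. \<bar>f (x + h) - f x\<bar> \<partial>lebesgue) + (\<integral>x. \<bar>g (x + h) - g x\<bar> \<partial>lebesgue)"
      by (simp add: algebra_simps)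
  qed
next
  case (lim f s)
  show ?case
  proof (rule tendstoI)
    fix e :: real assume "e > 0"
    have "(\<lambda>i. \<integral>x. \<bar>s i x - f x\<bar> \<partial>lebesgue) \<longlonglongrightarrow> (\<integral>x. 0 \<partial>(lebesgue :: 'a measure))"
    \<comment> \<open>The approximating functions are bounded by 2 |f|, so their distance to
      \<open>f\<close> is bounded by 3 |f|.\<close>
    proof (rule integral_dominated_convergence[where w = "\<lambda>x. 3 * \<bar>f x\<bar>"])
      show "AE x in lebesgue. (\<lambda>i. \<bar>s i x - f x\<bar>) \<longlonglongrightarrow> 0"
        using lim.hyps(2) by (auto intro!: tendsto_rabs_zero LIM_zero)
      have "norm \<bar>s i x - f x\<bar> \<le> 3 * \<bar>f x\<bar>" for i x
        using lim.hyps(3)[of x i] by simp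
      then show "AE x in lebesgue. norm \<bar>s i x - f x\<bar> \<le> 3 * \<bar>f x\<bar>" for i by simp
    qed (use lim.hyps in auto)
    then have "\<forall>\<^sub>F i in sequentially. (\<integral>x. \<bar>s i x - f x\<bar> \<partial>lebesgue) < e / 3"
      using \<open>e > 0\<close> by (intro order_tendstoD(2)[of _ "0::real"]) auto
    from eventually_happens'[OF sequentially_bot this]
    obtain i where i: "(\<integral>x. \<bar>s i x - f x\<bar> \<partial>lebesgue) < e / 3"
      by blast
    have "\<forall>\<^sub>F h in at 0. (\<integral>x. \<bar>s i (x + h) - s i x\<bar> \<partial>lebesgue) < e / 3"
      using \<open>e > 0\<close> lim.IH[of i] by (intro order_tendstoD(2)[of _ "0::real"]) auto
    then show "\<forall>\<^sub>F h in at 0. dist (\<integral>x. \<bar>f (x + h) - f x\<bar> \<partial>lebesgue) 0 < e"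
    proof eventually_elim
      case (elim h)
      \<comment> \<open>The error \<open>r\<close> and its translate have the same L^1 norm, so each
        of them costs less than e / 3.\<close>
      define r where "r = (\<lambda>x. s i x - f x)"
      have r: "integrable lebesgue r" unfolding r_def using lim.hyps by auto
      have s: "integrable lebesgue (\<lambda>x. s i (x + h) - s i x)"
        by (intro Bochner_Integration.integrable_diff integrable_lebesgue_translate lim.hyps(1))
      have "(\<integral>x. \<bar>f (x + h) - f x\<bar> \<partial>lebesgue) =
          (\<integral>x. \<bar>(s i (x + h) - s i x) + (r x + - r (x + h))\<bar> \<partial>lebesgue)"
        unfolding r_def by (rule arg_cong[where f = "\<lambda>F. \<integral>x. F x \<partial>lebesgue"]) (rule ext, linarith)
      also have "\<dots> \<le> (\<integral>x. \<bar>s i (x + h) - s i x\<bar> \<partial>lebesgue) + (\<integral>x. \<bar>r x + - r (x + h)\<bar> \<partial>lebesgue)"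
        using r s integrable_lebesgue_translate[OF r] by (intro integral_abs_add_le) auto
      also have "(\<integral>x. \<bar>r x + - r (x + h)\<bar> \<partial>lebesgue) \<le> (\<integral>x. \<bar>r x\<bar> \<partial>lebesgue) + (\<integral>x. \<bar>- r (x + h)\<bar> \<partial>lebesgue)"
        using r integrable_lebesgue_translate[OF r] by (intro integral_abs_add_le) auto
      also have "(\<integral>x. \<bar>- r (x + h)\<bar> \<partial>lebesgue) = (\<integral>x. \<bar>r x\<bar> \<partial>lebesgue)"
        using integral_lebesgue_translate[of "\<lambda>x. \<bar>r x\<bar>" h] r by simp
      finally show ?case
        using elim i unfolding r_def by (simp add: dist_real_def)
    qed
  qed
qed

text \<open>Duality for the L^1 norm: a test function can imitate the sign of \<open>w\<close>,
  being 1 on a compact part of {w > 0} and -1 on a compact part of {w < 0}, where the remaining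
  parts carry little of the integral of |w|.\<close>

lemma integral_abs_le_by_test_functions:
  fixes w :: "'a::euclidean_space \<Rightarrow> real"
  assumes w: "integrable lebesgue w"
    and le: "\<And>\<phi>. \<phi> \<in> test_functions UNIV \<Longrightarrow> (\<And>x. \<bar>\<phi> x\<bar> \<le> 1) \<Longrightarrow> (\<integral>x. w x * \<phi> x \<partial>lebesgue) \<le> C"
  shows "(\<integral>x. \<bar>w x\<bar> \<partial>lebesgue) \<le> C"
proof (rule field_le_epsilon)
  fix e :: real assume "e > 0"
  define P where "P = {x. w x > 0}"
  define N where "N = {x. w x < 0}"
  have [measurable]: "w \<in> borel_measurable lebesgue" using w by simp
  have PN: "P \<in> sets lebesgue" "N \<in> sets lebesgue"
    using borel_measurable_less[of "\<lambda>_. 0" lebesgue w] borel_measurable_less[of w lebesgue "\<lambda>_. 0"]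
    by (simp_all add: P_def N_def)
  obtain K1 where K1: "compact K1" "K1 \<subseteq> P" "(\<integral>x. indicator (P - K1) x * \<bar>w x\<bar> \<partial>lebesgue) < e / 4"
    using compact_subset_small_integral[OF w PN(1), of "e / 4"] \<open>e > 0\<close> by auto
  obtain K2 where K2: "compact K2" "K2 \<subseteq> N" "(\<integral>x. indicator (N - K2) x * \<bar>w x\<bar> \<partial>lebesgue) < e / 4"
    using compact_subset_small_integral[OF w PN(2), of "e / 4"] \<open>e > 0\<close> by auto
  have "K1 \<inter> K2 = {}"
  proof -
    have "P \<inter> N = {}" by (auto simp: P_def N_def)
    then show ?thesis using K1(2) K2(2) by blast
  qed
  \<comment> \<open>Disjoint neighbourhoods keep each cutoff function from disturbing the value of
    the other on its compact set.\<close>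
  then obtain U1 U2 where U: "open U1" "open U2" "K1 \<subseteq> U1" "K2 \<subseteq> U2" "U1 \<inter> U2 = {}"
    using separation_normal[OF compact_imp_closed compact_imp_closed, OF K1(1) K2(1)] by metis
  obtain \<eta>1 where \<eta>1: "\<eta>1 \<in> test_functions U1" "\<And>x. 0 \<le> \<eta>1 x" "\<And>x. \<eta>1 x \<le> 1" "\<And>x. x \<in> K1 \<Longrightarrow> \<eta>1 x = 1"
    using smooth_Urysohn[OF K1(1) U(1,3)] by metis
  obtain \<eta>2 where \<eta>2: "\<eta>2 \<in> test_functions U2" "\<And>x. 0 \<le> \<eta>2 x" "\<And>x. \<eta>2 x \<le> 1" "\<And>x. x \<in> K2 \<Longrightarrow> \<eta>2 x = 1"
    using smooth_Urysohn[OF K2(1) U(2,4)] by metis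
  let ?\<phi> = "\<lambda>x. \<eta>1 x - \<eta>2 x"
  have \<phi>: "?\<phi> \<in> test_functions UNIV"
    using test_functions_diff[OF test_functions_mono[OF \<eta>1(1)] test_functions_mono[OF \<eta>2(1)]] by auto
  have \<phi>_le: "\<bar>?\<phi> x\<bar> \<le> 1" for x
    using \<eta>1(2,3)[of x] \<eta>2(2,3)[of x] by linarith
  have K1v: "?\<phi> x = 1" if "x \<in> K1" for x
    using \<eta>1(4)[OF that] test_functions_support[OF \<eta>2(1), of x] U that by auto
  have K2v: "?\<phi> x = - 1" if "x \<in> K2" for x
    using \<eta>2(4)[OF that] test_functions_support[OF \<eta>1(1), of x] U that by auto
  have K: "K1 \<in> sets lebesgue" "K2 \<in> sets lebesgue"
    using K1(1) K2(1) lmeasurable_compact by blast+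
  have i: "integrable lebesgue (\<lambda>x. indicator (P - K1) x * \<bar>w x\<bar>)" "integrable lebesgue (\<lambda>x. indicator (N - K2) x * \<bar>w x\<bar>)"
    using PN K w by (auto intro!: integrable_mult_indicator[where 'b = real, simplified])
  have "(\<integral>x. \<bar>w x\<bar> \<partial>lebesgue) \<le> (\<integral>x. w x * ?\<phi> x + 2 * (indicator (P - K1) x * \<bar>w x\<bar>) + 2 * (indicator (N - K2) x * \<bar>w x\<bar>) \<partial>lebesgue)"
  proof (rule integral_mono)
    fix x
    \<comment> \<open>Off \<open>K1\<close> and \<open>K2\<close> the sign of the test function is
      not controlled. Replacing |w| by the product then costs at most 2 |w|, whence the factor 2 and
      the tolerance e / 4.\<close>
    have *: "- \<bar>w x\<bar> \<le> w x * ?\<phi> x"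
      using mult_left_mono[OF \<phi>_le[of x], of "\<bar>w x\<bar>"] by (simp add: abs_mult[symmetric])
    consider "x \<in> K1" | "x \<in> K2" | "x \<in> P - K1" | "x \<in> N - K2" | "w x = 0"
      unfolding P_def N_def by fastforce
    then show "\<bar>w x\<bar> \<le> w x * ?\<phi> x + 2 * (indicator (P - K1) x * \<bar>w x\<bar>) + 2 * (indicator (N - K2) x * \<bar>w x\<bar>)"
    proof cases
      case 1
      then show ?thesis using K1v[OF 1] K1(2) by (auto simp: P_def indicator_def)
    next
      case 2
      then show ?thesis using K2v[OF 2] K2(2) by (auto simp: N_def indicator_def)
    qed (use * in \<open>auto simp: indicator_def\<close>)
  qed (use w i integrable_mult_test_function[OF w \<phi>] in auto)
  also have "\<dots> = (\<integral>x. w x * ?\<phi> x \<partial>lebesgue) + 2 * (\<integral>x. indicator (P - K1) x * \<bar>w x\<bar> \<partial>lebesgue) + 2 * (\<integral>x. indicator (N - K2) x * \<bar>w x\<bar> \<partial>lebesgue)"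
    using i integrable_mult_test_function[OF w \<phi>] by simp
  also have "\<dots> \<le> C + e"
    using le[OF \<phi> \<phi>_le] K1(3) K2(3) by linarith
  finally show "(\<integral>x. \<bar>w x\<bar> \<partial>lebesgue) \<le> C + e" .
qed

lemma AE_eq_0_by_test_functions:
  fixes w :: "'a::euclidean_space \<Rightarrow> real"
  assumes w: "integrable lebesgue w"
    and "\<And>\<phi>. \<phi> \<in> test_functions UNIV \<Longrightarrow> (\<integral>x. w x * \<phi> x \<partial>lebesgue) = 0"
  shows "AE x in lebesgue. w x = 0"
proof -
  have "(\<integral>x. \<bar>w x\<bar> \<partial>lebesgue) \<le> 0"
    by (rule integral_abs_le_by_test_functions[OF w]) (simp add: assms)
  then have "(\<integral>x. \<bar>w x\<bar> \<partial>lebesgue) = 0"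
    by (intro antisym) simp_all
  then show ?thesis
    using integral_nonneg_eq_0_iff_AE[of lebesgue "\<lambda>x. \<bar>w x\<bar>"] w by simp
qed

section \<open>Weak partial derivatives of integrable functions\<close>

text \<open>A single direction, on the whole space and with integrable functions: this is the
  setting where translations act and difference quotients can be compared in L^1. Weak gradients on
  \<Omega> are brought into it by cutoff functions.\<close>

definition weak_partial :: "'a::euclidean_space \<Rightarrow> ('a \<Rightarrow> real) \<Rightarrow> ('a \<Rightarrow> real) \<Rightarrow> bool"
  where "weak_partial b u g \<longleftrightarrow> integrable lebesgue u \<and> integrable lebesgue g \<and>
    (\<forall>\<phi>\<in>test_functions UNIV.
      (\<integral>x. u x * frechet_derivative \<phi> (at x) b \<partial>lebesgue) = - (\<integral>x. g x * \<phi> x \<partial>lebesgue))"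

lemma weak_partialD:
  assumes "weak_partial b u g"
  shows "integrable lebesgue u" "integrable lebesgue g"
    "\<phi> \<in> test_functions UNIV \<Longrightarrow>
      (\<integral>x. u x * frechet_derivative \<phi> (at x) b \<partial>lebesgue) = - (\<integral>x. g x * \<phi> x \<partial>lebesgue)"
  using assms by (auto simp: weak_partial_def)

lemma weak_partial_unique:
  assumes "weak_partial b u g" "weak_partial b u h"
  shows "AE x in lebesgue. g x = h x"
proof -
  have "AE x in lebesgue. g x - h x = 0"
  proof (rule AE_eq_0_by_test_functions)
    fix \<phi> :: "'a \<Rightarrow> real" assume \<phi>: "\<phi> \<in> test_functions UNIV"
    show "(\<integral>x. (g x - h x) * \<phi> x \<partial>lebesgue) = 0"
      using weak_partialD(3)[OF assms(1) \<phi>] weak_partialD(3)[OF assms(2) \<phi>]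
        integrable_mult_test_function[OF weak_partialD(2)[OF assms(1)] \<phi>]
        integrable_mult_test_function[OF weak_partialD(2)[OF assms(2)] \<phi>]
      by (simp add: left_diff_distrib)
  qed (use weak_partialD(2)[OF assms(1)] weak_partialD(2)[OF assms(2)] in simp)
  then show ?thesis by simp
qed

section \<open>Difference quotients along a line and weak derivatives\<close>

lemma test_function_line_derivative:
  assumes "\<phi> \<in> test_functions \<Omega>"
  shows "((\<lambda>t. \<phi> (x + t *\<^sub>R b)) has_real_derivative frechet_derivative \<phi> (at (x + t *\<^sub>R b)) b) (at t)"
proof -
  have "((\<lambda>t. \<phi> (x + t *\<^sub>R b)) has_derivative
      (\<lambda>s. frechet_derivative \<phi> (at (x + t *\<^sub>R b)) (s *\<^sub>R b))) (at t)"
    by (rule has_derivative_compose[OF _ test_functions_has_derivative[OF assms]])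
      (auto intro!: derivative_eq_intros)
  then show ?thesis
    using linear_cmul[OF has_derivative_linear[OF test_functions_has_derivative[OF assms]]]
    by (simp add: has_field_derivative_def mult.commute[of _ "frechet_derivative \<phi> (at (x + t *\<^sub>R b)) b"])
qed

text \<open>The difference quotient falls on the smooth factor. By the mean value inequality it is
  bounded by the supremum of the directional derivative, so |u| times this constant
  dominates.\<close>

lemma tendsto_integral_difference_quotient:
  assumes u: "integrable lebesgue u" and \<phi>: "\<phi> \<in> test_functions UNIV" and b: "b \<in> Basis"
  shows "((\<lambda>t. \<integral>x. u x * ((\<phi> (x + t *\<^sub>R b) - \<phi> x) / t) \<partial>lebesgue) \<longlongrightarrow>
    (\<integral>x. u x * frechet_derivative \<phi> (at x) b \<partial>lebesgue)) (at 0)"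
  unfolding tendsto_at_iff_sequentially o_def
proof (intro allI impI)
  fix X :: "nat \<Rightarrow> real" assume X: "\<forall>i. X i \<in> UNIV - {0}" "X \<longlonglongrightarrow> 0"
  obtain B where B: "B > 0" "\<And>x. \<bar>frechet_derivative \<phi> (at x) b\<bar> \<le> B"
    using test_functions_bounded[OF test_functions_derivative[OF \<phi> b]] by metis
  have [measurable]: "u \<in> borel_measurable lebesgue" using u by simp
  note [measurable] = test_functions_measurable(2)[OF \<phi>]
  show "(\<lambda>n. \<integral>x. u x * ((\<phi> (x + X n *\<^sub>R b) - \<phi> x) / X n) \<partial>lebesgue) \<longlonglongrightarrow>
    (\<integral>x. u x * frechet_derivative \<phi> (at x) b \<partial>lebesgue)"
  proof (rule integral_dominated_convergence[where w = "\<lambda>x. B * \<bar>u x\<bar>"])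
    show "(\<lambda>x. u x * frechet_derivative \<phi> (at x) b) \<in> borel_measurable lebesgue"
      using integrable_mult_test_function[OF u test_functions_derivative[OF \<phi> b]] by simp
    show "(\<lambda>x. u x * ((\<phi> (x + X n *\<^sub>R b) - \<phi> x) / X n)) \<in> borel_measurable lebesgue" for n
      using test_functions_measurable(2)[OF test_functions_translate[OF \<phi>, of "X n *\<^sub>R b"]] by measurable
    show "AE x in lebesgue. (\<lambda>n. u x * ((\<phi> (x + X n *\<^sub>R b) - \<phi> x) / X n)) \<longlonglongrightarrow> u x * frechet_derivative \<phi> (at x) b"
    proof (intro AE_I2 tendsto_mult tendsto_const)
      fix x
      have "((\<lambda>t. (\<phi> (x + t *\<^sub>R b) - \<phi> x) / t) \<longlongrightarrow> frechet_derivative \<phi> (at x) b) (at 0)"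
        using test_function_line_derivative[OF \<phi>, of x b 0] by (simp add: DERIV_def)
      then show "(\<lambda>n. (\<phi> (x + X n *\<^sub>R b) - \<phi> x) / X n) \<longlonglongrightarrow> frechet_derivative \<phi> (at x) b"
        using X unfolding tendsto_at_iff_sequentially o_def by blast
    qed
    show "AE x in lebesgue. norm (u x * ((\<phi> (x + X n *\<^sub>R b) - \<phi> x) / X n)) \<le> B * \<bar>u x\<bar>" for n
    proof (intro AE_I2)
      fix x
      have "\<bar>\<phi> (x + X n *\<^sub>R b) - \<phi> (x + 0 *\<^sub>R b)\<bar> \<le> B * \<bar>X n - 0\<bar>"
        by (rule field_differentiable_bound[where S = UNIV and f' = "\<lambda>t. frechet_derivative \<phi> (at (x + t *\<^sub>R b)) b", unfolded real_norm_def])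
          (use B(2) test_function_line_derivative[OF \<phi>] in auto)
      then have "\<bar>(\<phi> (x + X n *\<^sub>R b) - \<phi> x) / X n\<bar> \<le> B"
        using X(1) by (simp add: field_simps)
      then show "norm (u x * ((\<phi> (x + X n *\<^sub>R b) - \<phi> x) / X n)) \<le> B * \<bar>u x\<bar>"
        unfolding real_norm_def abs_mult by (metis abs_ge_zero mult.commute mult_left_mono)
    qed
  qed (use u in auto)
qed

text \<open>After pairing with a test function bounded by 1, translation invariance moves the shift
  onto the test function. The pairing then depends differentiably on the shift, with derivative
  given by \<open>g\<close>, and the mean value theorem replaces the difference of \<open>u\<close>
  by t times \<open>g\<close> shifted by some s with |s| \<le> |t|. The free bound \<open>S\<close>
  serves both small shifts of a general \<open>g\<close> and the case \<open>g = 0\<close>.\<close>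

lemma weak_partial_difference_bound:
  assumes ug: "weak_partial b u g" and b: "b \<in> Basis"
    and S: "\<And>s. \<bar>s\<bar> \<le> \<bar>t\<bar> \<Longrightarrow> (\<integral>x. \<bar>g (x + s *\<^sub>R b) - g x\<bar> \<partial>lebesgue) \<le> S"
  shows "(\<integral>x. \<bar>u (x + t *\<^sub>R b) - u x - t * g x\<bar> \<partial>lebesgue) \<le> \<bar>t\<bar> * S"
proof (rule integral_abs_le_by_test_functions)
  note u = weak_partialD(1)[OF ug] and g = weak_partialD(2)[OF ug]
  note ut = integrable_lebesgue_translate[OF u, of "t *\<^sub>R b"]
  show "integrable lebesgue (\<lambda>x. u (x + t *\<^sub>R b) - u x - t * g x)"
    using u g ut by simp
  fix \<phi> :: "'a \<Rightarrow> real" assume \<phi>: "\<phi> \<in> test_functions UNIV" and le1: "\<And>x. \<bar>\<phi> x\<bar> \<le> 1"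
  define \<Phi> where "\<Phi> = (\<lambda>s. \<integral>x. u x * \<phi> (x + s *\<^sub>R b) \<partial>lebesgue)"
  define \<Psi> where "\<Psi> = (\<lambda>s. \<integral>x. g x * \<phi> (x + s *\<^sub>R b) \<partial>lebesgue)"
  note \<phi>s = test_functions_translate[OF \<phi>]
  have deriv: "(\<Phi> has_real_derivative - \<Psi> s) (at s)" for s
  proof -
    have "((\<lambda>t. \<integral>x. u x * ((\<phi> (x + t *\<^sub>R b + s *\<^sub>R b) - \<phi> (x + s *\<^sub>R b)) / t) \<partial>lebesgue) \<longlongrightarrow>
      (\<integral>x. u x * frechet_derivative (\<lambda>x. \<phi> (x + s *\<^sub>R b)) (at x) b \<partial>lebesgue)) (at 0)"
      by (rule tendsto_integral_difference_quotient[OF u \<phi>s b])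
    also have "(\<integral>x. u x * frechet_derivative (\<lambda>x. \<phi> (x + s *\<^sub>R b)) (at x) b \<partial>lebesgue) = - \<Psi> s"
      unfolding \<Psi>_def by (rule weak_partialD(3)[OF ug \<phi>s])
    also have "(\<lambda>t. \<integral>x. u x * ((\<phi> (x + t *\<^sub>R b + s *\<^sub>R b) - \<phi> (x + s *\<^sub>R b)) / t) \<partial>lebesgue)
        = (\<lambda>t. (\<Phi> (s + t) - \<Phi> s) / t)"
    proof
      fix t
      have "(\<integral>x. u x * ((\<phi> (x + t *\<^sub>R b + s *\<^sub>R b) - \<phi> (x + s *\<^sub>R b)) / t) \<partial>lebesgue)
        = (\<integral>x. (u x * \<phi> (x + (s + t) *\<^sub>R b) - u x * \<phi> (x + s *\<^sub>R b)) / t \<partial>lebesgue)"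
        by (simp add: algebra_simps scaleR_add_left)
      also have "\<dots> = (\<Phi> (s + t) - \<Phi> s) / t"
        using integrable_mult_test_function[OF u \<phi>s] by (simp add: \<Phi>_def)
      finally show "(\<integral>x. u x * ((\<phi> (x + t *\<^sub>R b + s *\<^sub>R b) - \<phi> (x + s *\<^sub>R b)) / t) \<partial>lebesgue) = (\<Phi> (s + t) - \<Phi> s) / t" .
    qed
    finally show ?thesis by (simp add: DERIV_def)
  qed
  \<comment> \<open>Parametrizing the segment from 0 to -t by the unit interval treats both signs of
    t at once.\<close>
  have "\<exists>s. \<bar>s\<bar> \<le> \<bar>t\<bar> \<and> \<Phi> (- t) - \<Phi> 0 = t * \<Psi> (- s)"
  proof -
    have "((\<lambda>r. \<Phi> (- (r * t))) has_real_derivative \<Psi> (- (r * t)) * t) (at r)" for r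
    proof -
      have "((\<lambda>r. - (r * t)) has_real_derivative - t) (at r)"
        by (auto intro!: derivative_eq_intros)
      from DERIV_chain2[of \<Phi> "- \<Psi> (- (r * t))" "\<lambda>r. - (r * t)", OF deriv this]
      show ?thesis by simp
    qed
    then obtain z where z: "0 < z" "z < 1" "\<Phi> (- (1 * t)) - \<Phi> (- (0 * t)) = (1 - 0) * (\<Psi> (- (z * t)) * t)"
      using MVT2[of 0 1 "\<lambda>r. \<Phi> (- (r * t))" "\<lambda>r. \<Psi> (- (r * t)) * t"] by auto
    then have "\<bar>z * t\<bar> \<le> \<bar>t\<bar>"
      by (simp add: abs_mult mult_left_le_one_le)
    then show ?thesis
      using z(3) by (intro exI[of _ "z * t"]) (simp add: mult.commute)
  qed
  then obtain s where s: "\<bar>s\<bar> \<le> \<bar>t\<bar>" "\<Phi> (- t) - \<Phi> 0 = t * \<Psi> (- s)" by blast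
  \<comment> \<open>Translation invariance moves a shift from \<open>f\<close> to the test function
    with the opposite sign.\<close>
  have shift: "(\<integral>x. f (x + r *\<^sub>R b) * \<phi> x \<partial>lebesgue) = (\<integral>x. f x * \<phi> (x + (- r) *\<^sub>R b) \<partial>lebesgue)"
    if "integrable lebesgue f" for f and r :: real
    using integral_lebesgue_translate[of "\<lambda>x. f x * \<phi> (x + (- r) *\<^sub>R b)" "r *\<^sub>R b"]
      integrable_mult_test_function[OF that \<phi>s[of "(- r) *\<^sub>R b"]] by simp
  note gs = integrable_lebesgue_translate[OF g, of "s *\<^sub>R b"]
  have "(\<integral>x. (u (x + t *\<^sub>R b) - u x - t * g x) * \<phi> x \<partial>lebesgue)
      = (\<integral>x. u (x + t *\<^sub>R b) * \<phi> x - u x * \<phi> x - t * (g x * \<phi> x) \<partial>lebesgue)"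
    by (simp add: algebra_simps)
  also have "\<dots> = (\<integral>x. u (x + t *\<^sub>R b) * \<phi> x \<partial>lebesgue) - (\<integral>x. u x * \<phi> x \<partial>lebesgue) - t * (\<integral>x. g x * \<phi> x \<partial>lebesgue)"
    using integrable_mult_test_function[OF u \<phi>] integrable_mult_test_function[OF g \<phi>]
      integrable_mult_test_function[OF ut \<phi>] by simp
  also have "\<dots> = t * ((\<integral>x. g (x + s *\<^sub>R b) * \<phi> x \<partial>lebesgue) - (\<integral>x. g x * \<phi> x \<partial>lebesgue))"
    using s(2) shift[OF u, of t] shift[OF g, of s] by (simp add: \<Phi>_def \<Psi>_def algebra_simps)
  also have "(\<integral>x. g (x + s *\<^sub>R b) * \<phi> x \<partial>lebesgue) - (\<integral>x. g x * \<phi> x \<partial>lebesgue)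
      = (\<integral>x. (g (x + s *\<^sub>R b) - g x) * \<phi> x \<partial>lebesgue)"
    using integrable_mult_test_function[OF g \<phi>] integrable_mult_test_function[OF gs \<phi>]
    by (simp add: left_diff_distrib)
  also have "t * (\<integral>x. (g (x + s *\<^sub>R b) - g x) * \<phi> x \<partial>lebesgue) \<le> \<bar>t\<bar> * S"
  proof -
    have "\<bar>\<integral>x. (g (x + s *\<^sub>R b) - g x) * \<phi> x \<partial>lebesgue\<bar> \<le> (\<integral>x. \<bar>(g (x + s *\<^sub>R b) - g x) * \<phi> x\<bar> \<partial>lebesgue)"
      by (rule integral_abs_bound)
    also have "\<dots> \<le> (\<integral>x. \<bar>g (x + s *\<^sub>R b) - g x\<bar> \<partial>lebesgue)"
    proof (rule integral_mono)
      show "integrable lebesgue (\<lambda>x. \<bar>(g (x + s *\<^sub>R b) - g x) * \<phi> x\<bar>)"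
        using g gs by (intro integrable_abs integrable_mult_test_function[OF _ \<phi>]) simp
      show "\<bar>(g (x + s *\<^sub>R b) - g x) * \<phi> x\<bar> \<le> \<bar>g (x + s *\<^sub>R b) - g x\<bar>" for x
        using le1[of x] by (simp add: abs_mult mult_left_le)
    qed (use g gs in simp)
    also have "\<dots> \<le> S" by (rule S[OF s(1)])
    finally have "\<bar>t\<bar> * \<bar>\<integral>x. (g (x + s *\<^sub>R b) - g x) * \<phi> x \<partial>lebesgue\<bar> \<le> \<bar>t\<bar> * S"
      by (rule mult_left_mono) simp
    then show ?thesis unfolding abs_mult[symmetric] by linarith
  qed
  finally show "(\<integral>x. (u (x + t *\<^sub>R b) - u x - t * g x) * \<phi> x \<partial>lebesgue) \<le> \<bar>t\<bar> * S" .
qed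

lemma tendsto_weak_partial_difference_quotient:
  assumes ug: "weak_partial b u g" and b: "b \<in> Basis"
  shows "((\<lambda>t. \<integral>x. \<bar>(u (x + t *\<^sub>R b) - u x) / t - g x\<bar> \<partial>lebesgue) \<longlongrightarrow> 0) (at 0)"
proof (rule tendstoI)
  fix e :: real assume "e > 0"
  have "\<forall>\<^sub>F h in at 0. (\<integral>x. \<bar>g (x + h) - g x\<bar> \<partial>lebesgue) < e / 2"
    using tendsto_translation_L1[OF weak_partialD(2)[OF ug]] \<open>e > 0\<close>
    by (intro order_tendstoD(2)[of _ "0::real"]) auto
  then obtain d where d: "d > 0" "\<And>h. h \<noteq> 0 \<Longrightarrow> norm h < d \<Longrightarrow> (\<integral>x. \<bar>g (x + h) - g x\<bar> \<partial>lebesgue) < e / 2"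
    unfolding eventually_at by (auto simp: dist_norm)
  show "\<forall>\<^sub>F t in at 0. dist (\<integral>x. \<bar>(u (x + t *\<^sub>R b) - u x) / t - g x\<bar> \<partial>lebesgue) 0 < e"
    unfolding eventually_at
  proof (intro exI[of _ d] conjI ballI impI)
    fix t :: real assume t: "t \<noteq> 0 \<and> dist t 0 < d"
    have "(\<integral>x. \<bar>u (x + t *\<^sub>R b) - u x - t * g x\<bar> \<partial>lebesgue) \<le> \<bar>t\<bar> * (e / 2)"
    proof (rule weak_partial_difference_bound[OF ug b])
      fix s assume s: "\<bar>s\<bar> \<le> \<bar>t\<bar>"
      show "(\<integral>x. \<bar>g (x + s *\<^sub>R b) - g x\<bar> \<partial>lebesgue) \<le> e / 2"
      \<comment> \<open>The filter at 0 omits the shift 0, for which the integrand vanishes.\<close>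
      proof (cases "s = 0")
        case False
        then show ?thesis using d(2)[of "s *\<^sub>R b"] s t b by fastforce
      qed (use \<open>e > 0\<close> in simp)
    qed
    also have "(\<integral>x. \<bar>u (x + t *\<^sub>R b) - u x - t * g x\<bar> \<partial>lebesgue)
        = (\<integral>x. \<bar>t\<bar> * \<bar>(u (x + t *\<^sub>R b) - u x) / t - g x\<bar> \<partial>lebesgue)"
    proof -
      have "\<bar>u (x + t *\<^sub>R b) - u x - t * g x\<bar> = \<bar>t\<bar> * \<bar>(u (x + t *\<^sub>R b) - u x) / t - g x\<bar>" for x
        using t by (subst abs_mult[symmetric], subst right_diff_distrib) simp
      then show ?thesis by simp
    qed
    finally have "(\<integral>x. \<bar>(u (x + t *\<^sub>R b) - u x) / t - g x\<bar> \<partial>lebesgue) \<le> e / 2"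
      using t by simp
    then show "dist (\<integral>x. \<bar>(u (x + t *\<^sub>R b) - u x) / t - g x\<bar> \<partial>lebesgue) 0 < e"
      using \<open>e > 0\<close> by (simp add: dist_real_def)
  qed (use d in auto)
qed

section \<open>The positive part of a weakly differentiable function\<close>

lemma tendsto_pos_part_quotient:
  fixes a c :: real
  assumes "a \<noteq> 0"
  shows "((\<lambda>t. (max (a + t * c) 0 - max a 0) / t) \<longlongrightarrow> (if a > 0 then c else 0)) (at 0)"
proof -
  have lim: "((\<lambda>t. a + t * c) \<longlongrightarrow> a) (at 0)"
    by (rule tendsto_eq_intros refl | simp)+
  show ?thesis
  proof (cases "a > 0")
    case True
    show ?thesis
      using order_tendstoD(1)[OF lim True] True
      by (intro tendsto_eventually) (auto simp: eventually_at_filter elim: eventually_mono)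
  next
    case False
    then have "a < 0" using assms by simp
    then show ?thesis
      using order_tendstoD(2)[OF lim \<open>a < 0\<close>]
      by (intro tendsto_eventually) (auto simp: eventually_at_filter elim: eventually_mono)
  qed
qed

text \<open>The difference quotient \<open>F n\<close> of the positive part is compared with
  \<open>E n\<close>, in which \<open>u\<close> at the shifted point is replaced by its
  linearization \<open>u x + X n * g x\<close>. As the positive part is 1-Lipschitz, the error is at
  most |\<open>Q n\<close>|, which tends to 0 in L^1, whereas \<open>E n\<close> converges pointwise
  and is dominated by |g|. The limit \<open>D\<close> is left open because at the kink it depends on
  the sign of the steps.\<close>

lemma weak_partial_pos_part_limit:
  assumes ug: "weak_partial b u g" and b: "b \<in> Basis"
    and X: "\<And>n. X n \<noteq> 0" "X \<longlonglongrightarrow> 0"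
    and lim: "\<And>a c. (\<lambda>n. (max (a + X n * c) 0 - max a 0) / X n) \<longlonglongrightarrow> D a c"
  shows "weak_partial b (\<lambda>x. max (u x) 0) (\<lambda>x. D (u x) (g x))"
proof -
  note u = weak_partialD(1)[OF ug] and g = weak_partialD(2)[OF ug]
  note [measurable] = borel_measurable_integrable[OF u] borel_measurable_integrable[OF g]
  define E where "E = (\<lambda>n x. (max (u x + X n * g x) 0 - max (u x) 0) / X n)"
  have E_meas [measurable]: "E n \<in> borel_measurable lebesgue" for n
    unfolding E_def by measurable
  have E_lim: "(\<lambda>n. E n x) \<longlonglongrightarrow> D (u x) (g x)" for x
    unfolding E_def by (rule lim)
  have E_le: "\<bar>E n x\<bar> \<le> \<bar>g x\<bar>" for n x
  proof -
    have "\<bar>max (u x + X n * g x) 0 - max (u x) 0\<bar> \<le> \<bar>X n\<bar> * \<bar>g x\<bar>"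
      unfolding abs_mult[symmetric] by linarith
    then show ?thesis
      using X(1)[of n] by (simp add: E_def abs_mult field_simps)
  qed
  have E_int: "integrable lebesgue (E n)" for n
    by (rule Bochner_Integration.integrable_bound[OF g]) (use E_le in auto)
  have D_meas [measurable]: "(\<lambda>x. D (u x) (g x)) \<in> borel_measurable lebesgue"
    by (rule borel_measurable_LIMSEQ_real[OF E_lim E_meas])
  have "\<bar>D (u x) (g x)\<bar> \<le> \<bar>g x\<bar>" for x
    by (rule LIMSEQ_le_const2[OF tendsto_rabs[OF E_lim]]) (use E_le in auto)
  then have h: "integrable lebesgue (\<lambda>x. D (u x) (g x))"
    by (intro Bochner_Integration.integrable_bound[OF g]) auto
  have up: "integrable lebesgue (\<lambda>x. max (u x) 0)" using u by simp
  have "(\<integral>x. max (u x) 0 * frechet_derivative \<phi> (at x) b \<partial>lebesgue) = - (\<integral>x. D (u x) (g x) * \<phi> x \<partial>lebesgue)"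
    if \<phi>: "\<phi> \<in> test_functions UNIV" for \<phi>
  proof -
    note [measurable] = test_functions_measurable(2)[OF \<phi>]
    obtain B where B: "B > 0" "\<And>x. \<bar>\<phi> x\<bar> \<le> B" using test_functions_bounded[OF \<phi>] by blast
    define F where "F = (\<lambda>n x. (max (u (x + X n *\<^sub>R b)) 0 - max (u x) 0) / X n)"
    define Q where "Q = (\<lambda>n x. (u (x + X n *\<^sub>R b) - u x) / X n - g x)"
    note ut = integrable_lebesgue_translate[OF u] and upt = integrable_lebesgue_translate[OF up]
    have F_int: "integrable lebesgue (F n)" for n
      unfolding F_def using up upt[of "X n *\<^sub>R b"] by simp
    have Q_int: "integrable lebesgue (Q n)" for n
      unfolding Q_def using u g ut[of "X n *\<^sub>R b"] by simp
    have FE: "\<bar>F n x - E n x\<bar> \<le> \<bar>Q n x\<bar>" for n x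
    proof -
      have "\<bar>max (u (x + X n *\<^sub>R b)) 0 - max (u x + X n * g x) 0\<bar> \<le> \<bar>u (x + X n *\<^sub>R b) - u x - X n * g x\<bar>"
        by linarith
      moreover have "Q n x = (u (x + X n *\<^sub>R b) - u x - X n * g x) / X n"
        using X(1)[of n] by (simp add: Q_def diff_divide_distrib)
      moreover have "F n x - E n x = (max (u (x + X n *\<^sub>R b)) 0 - max (u x + X n * g x) 0) / X n"
        by (simp add: F_def E_def diff_divide_distrib)
      ultimately show ?thesis by (simp add: divide_right_mono)
    qed
    have "(\<lambda>n. \<integral>x. \<bar>Q n x\<bar> \<partial>lebesgue) \<longlonglongrightarrow> 0"
      using tendsto_weak_partial_difference_quotient[OF ug b] X
      unfolding tendsto_at_iff_sequentially Q_def o_def by auto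
    then have "(\<lambda>n. B * (\<integral>x. \<bar>Q n x\<bar> \<partial>lebesgue)) \<longlonglongrightarrow> 0"
      using tendsto_mult_right_zero by blast
    then have "(\<lambda>n. \<integral>x. (F n x - E n x) * \<phi> x \<partial>lebesgue) \<longlonglongrightarrow> 0"
    proof (rule Lim_null_comparison[rotated], intro always_eventually allI)
      fix n
      have "\<bar>\<integral>x. (F n x - E n x) * \<phi> x \<partial>lebesgue\<bar> \<le> (\<integral>x. \<bar>(F n x - E n x) * \<phi> x\<bar> \<partial>lebesgue)"
        by (rule integral_abs_bound)
      also have "\<dots> \<le> (\<integral>x. B * \<bar>Q n x\<bar> \<partial>lebesgue)"
      proof (rule integral_mono)
        show "integrable lebesgue (\<lambda>x. \<bar>(F n x - E n x) * \<phi> x\<bar>)"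
          using F_int E_int by (intro integrable_abs integrable_mult_test_function[OF _ \<phi>]) simp
        show "\<bar>(F n x - E n x) * \<phi> x\<bar> \<le> B * \<bar>Q n x\<bar>" for x
          unfolding abs_mult by (subst mult.commute, rule mult_mono) (use FE B in auto)
      qed (use Q_int in simp)
      finally show "norm (\<integral>x. (F n x - E n x) * \<phi> x \<partial>lebesgue) \<le> B * (\<integral>x. \<bar>Q n x\<bar> \<partial>lebesgue)"
        by simp
    qed
    moreover have "(\<lambda>n. \<integral>x. E n x * \<phi> x \<partial>lebesgue) \<longlonglongrightarrow> (\<integral>x. D (u x) (g x) * \<phi> x \<partial>lebesgue)"
    proof (rule integral_dominated_convergence[where w = "\<lambda>x. B * \<bar>g x\<bar>"])
      show "AE x in lebesgue. norm (E n x * \<phi> x) \<le> B * \<bar>g x\<bar>" for n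
      proof (intro AE_I2)
        fix x show "norm (E n x * \<phi> x) \<le> B * \<bar>g x\<bar>"
          unfolding real_norm_def abs_mult by (subst mult.commute, rule mult_mono) (use E_le B in auto)
      qed
      show "AE x in lebesgue. (\<lambda>n. E n x * \<phi> x) \<longlonglongrightarrow> D (u x) (g x) * \<phi> x"
        by (intro AE_I2 tendsto_mult tendsto_const E_lim)
    qed (use g in \<open>simp_all\<close>)
    ultimately have "(\<lambda>n. (\<integral>x. (F n x - E n x) * \<phi> x \<partial>lebesgue) + (\<integral>x. E n x * \<phi> x \<partial>lebesgue))
        \<longlonglongrightarrow> 0 + (\<integral>x. D (u x) (g x) * \<phi> x \<partial>lebesgue)"
      by (rule tendsto_add)
    moreover have "(\<integral>x. (F n x - E n x) * \<phi> x \<partial>lebesgue) + (\<integral>x. E n x * \<phi> x \<partial>lebesgue) = (\<integral>x. F n x * \<phi> x \<partial>lebesgue)" for n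
      using integrable_mult_test_function[OF F_int \<phi>] integrable_mult_test_function[OF E_int \<phi>]
      by (simp add: left_diff_distrib)
    \<comment> \<open>Discrete integration by parts: the quotient passes to the test function, with
      the step \<open>- X n\<close>.\<close>
    moreover have "(\<integral>x. F n x * \<phi> x \<partial>lebesgue)
        = - (\<integral>x. max (u x) 0 * ((\<phi> (x + (- X n) *\<^sub>R b) - \<phi> x) / (- X n)) \<partial>lebesgue)" for n
    proof -
      let ?a = "X n *\<^sub>R b"
      note \<phi>a = test_functions_translate[OF \<phi>, of "- ?a"]
      have "(\<integral>x. max (u (x + ?a)) 0 * \<phi> x \<partial>lebesgue) = (\<integral>x. max (u x) 0 * \<phi> (x + - ?a) \<partial>lebesgue)"
        using integral_lebesgue_translate[of "\<lambda>x. max (u x) 0 * \<phi> (x + - ?a)" ?a]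
          integrable_mult_test_function[OF up \<phi>a] by simp
      moreover have "(\<integral>x. F n x * \<phi> x \<partial>lebesgue)
          = (\<integral>x. (max (u (x + ?a)) 0 * \<phi> x - max (u x) 0 * \<phi> x) / X n \<partial>lebesgue)"
        by (simp add: F_def left_diff_distrib)
      moreover have "(\<integral>x. max (u x) 0 * ((\<phi> (x + (- X n) *\<^sub>R b) - \<phi> x) / (- X n)) \<partial>lebesgue)
          = (\<integral>x. - ((max (u x) 0 * \<phi> (x + - ?a) - max (u x) 0 * \<phi> x) / X n) \<partial>lebesgue)"
        by (simp add: right_diff_distrib)
      ultimately show ?thesis
        using integrable_mult_test_function[OF up \<phi>a] integrable_mult_test_function[OF up \<phi>]
          integrable_mult_test_function[OF upt \<phi>] by auto
    qed
    ultimately have 1: "(\<lambda>n. - (\<integral>x. max (u x) 0 * ((\<phi> (x + (- X n) *\<^sub>R b) - \<phi> x) / (- X n)) \<partial>lebesgue))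
        \<longlonglongrightarrow> (\<integral>x. D (u x) (g x) * \<phi> x \<partial>lebesgue)" by simp
    have "(\<lambda>n. - X n) \<longlonglongrightarrow> 0" using tendsto_minus[OF X(2)] by simp
    then have "(\<lambda>n. \<integral>x. max (u x) 0 * ((\<phi> (x + (- X n) *\<^sub>R b) - \<phi> x) / (- X n)) \<partial>lebesgue)
        \<longlonglongrightarrow> (\<integral>x. max (u x) 0 * frechet_derivative \<phi> (at x) b \<partial>lebesgue)"
      using tendsto_integral_difference_quotient[OF up \<phi> b] X(1)
      unfolding tendsto_at_iff_sequentially o_def by (auto dest: spec[of _ "\<lambda>n. - X n"])
    from LIMSEQ_unique[OF tendsto_minus[OF this] 1] show ?thesis by simp
  qed
  with up h show ?thesis by (auto simp: weak_partial_def)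
qed

text \<open>The one-sided difference quotients of the positive part have limits which differ only on
  \<open>{u = 0}\<close>, where they are \<open>max g 0\<close> and \<open>min g 0\<close>. Both limits are weak derivatives, so
  \<open>g\<close> vanishes almost everywhere on that set.\<close>

lemma weak_partial_pos_part:
  assumes ug: "weak_partial b u g" and b: "b \<in> Basis"
  shows "AE x in lebesgue. u x = 0 \<longrightarrow> g x = 0"
    and "weak_partial b (\<lambda>x. max (u x) 0) (\<lambda>x. if u x > 0 then g x else 0)"
proof -
  define D :: "(real \<Rightarrow> real \<Rightarrow> real) \<Rightarrow> real \<Rightarrow> real \<Rightarrow> real"
    where "D = (\<lambda>m a c. if a > 0 then c else if a = 0 then m c 0 else 0)"
  have inv: "(\<lambda>n. inverse (real (Suc n))) \<longlonglongrightarrow> 0" by (rule LIMSEQ_inverse_real_of_nat)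
  have *: "(\<lambda>n. (max (a + X n * c) 0 - max a 0) / X n) \<longlonglongrightarrow> D m a c"
    if "X \<longlonglongrightarrow> 0" "\<And>n. X n \<noteq> 0" "\<And>n. max (X n * c) 0 / X n = m c 0" for X m a c
  proof (cases "a = 0")
    case True
    then show ?thesis using that(3) by (simp add: D_def)
  next
    case False
    then have eq: "D m a c = (if a > 0 then c else 0)" by (simp add: D_def)
    show ?thesis
      using tendsto_pos_part_quotient[OF False, of c] that(1,2)
      unfolding tendsto_at_iff_sequentially o_def eq by auto
  qed
  have "max (r * c) 0 / r = max c 0" if "r > 0" for r c :: real
    using that by (simp add: max_def mult_le_0_iff)
  then have p: "weak_partial b (\<lambda>x. max (u x) 0) (\<lambda>x. D max (u x) (g x))"
    using inv by (intro weak_partial_pos_part_limit[OF ug b _ inv] *) auto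
  have neg: "max (r * c) 0 / r = min c 0" if "r < 0" for r c :: real
    using that by (simp add: max_def min_def mult_le_0_iff)
  have m: "weak_partial b (\<lambda>x. max (u x) 0) (\<lambda>x. D min (u x) (g x))"
  proof (intro weak_partial_pos_part_limit[OF ug b, of "\<lambda>n. - inverse (real (Suc n))"] *)
    show "max (- inverse (real (Suc n)) * c) 0 / - inverse (real (Suc n)) = min c 0" for n c
      by (rule neg) simp
  qed (use tendsto_minus[OF inv] in auto)
  have ae: "AE x in lebesgue. D max (u x) (g x) = D min (u x) (g x)"
    by (rule weak_partial_unique[OF p m])
  then show "AE x in lebesgue. u x = 0 \<longrightarrow> g x = 0"
    by eventually_elim (auto simp: D_def max_def min_def split: if_splits)
  then have ae': "AE x in lebesgue. D max (u x) (g x) = (if u x > 0 then g x else 0)"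
    by eventually_elim (auto simp: D_def)
  note i = weak_partialD(1,2)[OF p]
  note [measurable] = borel_measurable_integrable[OF weak_partialD(1)[OF ug]] borel_measurable_integrable[OF weak_partialD(2)[OF ug]]
  have g': "integrable lebesgue (\<lambda>x. if u x > 0 then g x else 0)"
    using integrable_cong_AE[OF _ _ ae'] i(2) by simp
  have "(\<integral>x. D max (u x) (g x) * \<phi> x \<partial>lebesgue) = (\<integral>x. (if u x > 0 then g x else 0) * \<phi> x \<partial>lebesgue)"
    if \<phi>: "\<phi> \<in> test_functions UNIV" for \<phi>
    by (rule integral_cong_AE) (use ae' integrable_mult_test_function[OF i(2) \<phi>] integrable_mult_test_function[OF g' \<phi>] in auto)
  then show "weak_partial b (\<lambda>x. max (u x) 0) (\<lambda>x. if u x > 0 then g x else 0)"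
    using weak_partialD(3)[OF p] i(1) g' by (simp add: weak_partial_def)
qed

text \<open>Without derivatives, a weakly differentiable function is invariant under translations.\<close>

lemma weak_partial_0_imp_eq_0:
  assumes ug: "weak_partial b u (\<lambda>_. 0)" and b: "b \<in> Basis"
    and bd: "bounded S" "\<And>x. x \<notin> S \<Longrightarrow> u x = 0"
  shows "AE x in lebesgue. u x = 0"
proof -
  note u = weak_partialD(1)[OF ug]
  obtain R where R: "R > 0" "\<And>x. x \<in> S \<Longrightarrow> norm x \<le> R"
    using bd(1) bounded_pos by metis
  \<comment> \<open>A shift of length 3 R takes points of norm at most R to points of norm at least
    2 R, hence out of \<open>S\<close>, where \<open>u\<close> is zero.\<close>
  define t where "t = 3 * R"
  note ut = integrable_lebesgue_translate[OF u, of "t *\<^sub>R b"]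
  have "(\<integral>x. \<bar>u (x + t *\<^sub>R b) - u x - t * 0\<bar> \<partial>lebesgue) \<le> \<bar>t\<bar> * 0"
    by (rule weak_partial_difference_bound[OF ug b]) simp
  then have "(\<integral>x. \<bar>u (x + t *\<^sub>R b) - u x\<bar> \<partial>lebesgue) = 0"
    by (intro antisym) simp_all
  then have "AE x in lebesgue. \<bar>u (x + t *\<^sub>R b) - u x\<bar> = 0"
    using integral_nonneg_eq_0_iff_AE[of lebesgue "\<lambda>x. \<bar>u (x + t *\<^sub>R b) - u x\<bar>"] u ut by simp
  then show ?thesis
  proof eventually_elim
    case (elim x)
    show ?case
    proof (cases "x \<in> S")
      case True
      have "norm (t *\<^sub>R b) = 3 * R" using b R(1) by (simp add: t_def)
      then have "norm (x + t *\<^sub>R b) > R"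
        using R True norm_triangle_ineq4[of "x + t *\<^sub>R b" x] by fastforce
      then have "x + t *\<^sub>R b \<notin> S" using R(2) by force
      then show ?thesis using bd(2)[of "x + t *\<^sub>R b"] elim by simp
    qed (rule bd(2))
  qed
qed

section \<open>Weak gradients\<close>

text \<open>An open set is a countable union of compact subsets. On each of these a cutoff function
  with value 1 gives access to the results on \<open>weak_partial\<close>.\<close>

lemma AE_on_compacts_imp_AE_on_open:
  fixes \<Omega> :: "'a::euclidean_space set"
  assumes "open \<Omega>" and "\<And>K. compact K \<Longrightarrow> K \<subseteq> \<Omega> \<Longrightarrow> AE x in lebesgue. x \<in> K \<longrightarrow> P x"
  shows "AE x in lebesgue. x \<in> \<Omega> \<longrightarrow> P x"
proof -
  obtain C where C: "\<And>n::nat. compact (C n)" "\<And>n. C n \<subseteq> \<Omega>" "\<Union> (range C) = \<Omega>"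
    using open_Union_compact_subsets[OF assms(1)] by metis
  have "AE x in lebesgue. \<forall>n. x \<in> C n \<longrightarrow> P x"
    unfolding AE_all_countable using assms(2) C by blast
  then show ?thesis
    by eventually_elim (use C(3) in blast)
qed

lemma locally_integrable_iff:
  "locally_integrable \<Omega> u \<longleftrightarrow>
    (\<forall>K. compact K \<longrightarrow> K \<subseteq> \<Omega> \<longrightarrow> integrable lebesgue (\<lambda>x. indicator K x *\<^sub>R u x))"
  by (simp add: locally_integrable_def set_integrable_def)

lemma integrable_locally_integrable_mult_test_function:
  fixes u :: "'a::euclidean_space \<Rightarrow> real"
  assumes "locally_integrable \<Omega> u" "\<phi> \<in> test_functions \<Omega>"
  shows "integrable lebesgue (\<lambda>x. u x * \<phi> x)"
proof -
  let ?K = "closure {x. \<phi> x \<noteq> 0}"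
  have "integrable lebesgue (\<lambda>x. indicator ?K x *\<^sub>R u x)"
    using assms(1) test_functionsD(2,3)[OF assms(2)] unfolding locally_integrable_iff by blast
  from integrable_mult_test_function[OF this assms(2)]
  have "integrable lebesgue (\<lambda>x. indicator ?K x *\<^sub>R u x * \<phi> x)" .
  also have "(\<lambda>x. indicator ?K x *\<^sub>R u x * \<phi> x) = (\<lambda>x. u x * \<phi> x)"
  proof
    show "indicator ?K x *\<^sub>R u x * \<phi> x = u x * \<phi> x" for x
      using eq_0_off_closure[of x \<phi>] by (cases "x \<in> ?K") simp_all
  qed
  finally show ?thesis .
qed

text \<open>An increasing exhaustion by compact sets presents the function, cut off to \<Omega>, as
  a pointwise limit of integrable functions. Measurability on \<Omega> of a function and of its weak
  gradient is thus part of \<open>is_weak_gradient\<close>.\<close>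

lemma locally_integrable_measurable:
  fixes u :: "'a::euclidean_space \<Rightarrow> 'b::euclidean_space"
  assumes "open \<Omega>" "locally_integrable \<Omega> u"
  shows "u \<in> borel_measurable (lebesgue_on \<Omega>)"
proof -
  obtain C where C: "\<And>n::nat. compact (C n)" "\<And>n. C n \<subseteq> \<Omega>" "\<And>n. C n \<subseteq> interior (C (Suc n))"
      "\<Union> (range C) = \<Omega>"
    using open_Union_compact_subsets[OF assms(1)] by metis
  have mono: "C m \<subseteq> C n" if "m \<le> n" for m n
    using that by (rule lift_Suc_mono_le[rotated]) (use C(3) interior_subset in blast)
  have "(\<lambda>x. indicator \<Omega> x *\<^sub>R u x) \<in> borel_measurable lebesgue"
  proof (rule borel_measurable_LIMSEQ_metric)
    show "(\<lambda>x. indicator (C n) x *\<^sub>R u x) \<in> borel_measurable lebesgue" for n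
      using assms(2) C(1,2) unfolding locally_integrable_iff by (blast intro: borel_measurable_integrable)
    show "(\<lambda>n. indicator (C n) x *\<^sub>R u x) \<longlonglongrightarrow> indicator \<Omega> x *\<^sub>R u x" for x
    proof (cases "x \<in> \<Omega>")
      case True
      then obtain m where "x \<in> C m" using C(4) by blast
      then have "x \<in> C n" if "n \<ge> m" for n using mono[OF that] by blast
      then show ?thesis using True
        by (intro tendsto_eventually eventually_sequentiallyI[of m]) simp
    next
      case False
      then have "x \<notin> C n" for n using C(2) by blast
      then show ?thesis using False by simp
    qed
  qed
  then show ?thesis
    using assms(1) by (simp add: borel_measurable_restrict_space_iff)
qed

text \<open>The values of \<open>u\<close> outside \<Omega> are arbitrary, but the test function
  vanishes there. This allows all later integrals to be taken over the whole space.\<close>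

lemma integral_lebesgue_on_mult_test_function:
  fixes u :: "'a::euclidean_space \<Rightarrow> real"
  assumes "open \<Omega>" "\<phi> \<in> test_functions \<Omega>"
  shows "(\<integral>x. u x * \<phi> x \<partial>lebesgue_on \<Omega>) = (\<integral>x. u x * \<phi> x \<partial>lebesgue)"
proof -
  have "(\<lambda>x. indicator \<Omega> x *\<^sub>R (u x * \<phi> x)) = (\<lambda>x. u x * \<phi> x)"
    using test_functions_support[OF assms(2)] by (auto simp: indicator_def fun_eq_iff)
  then show ?thesis
    using assms(1) by (simp add: integral_restrict_space)
qed

lemma is_weak_gradientI:
  assumes "open \<Omega>" "locally_integrable \<Omega> u" "locally_integrable \<Omega> G"
    and "\<And>\<phi> b. \<phi> \<in> test_functions \<Omega> \<Longrightarrow> b \<in> Basis \<Longrightarrow>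
      (\<integral>x. u x * frechet_derivative \<phi> (at x) b \<partial>lebesgue) = - (\<integral>x. (G x \<bullet> b) * \<phi> x \<partial>lebesgue)"
  shows "is_weak_gradient \<Omega> u G"
  unfolding is_weak_gradient_def
proof (intro conjI ballI assms(2,3))
  fix \<phi> and b :: 'a assume \<phi>: "\<phi> \<in> test_functions \<Omega>" and b: "b \<in> Basis"
  show "(\<integral>x. u x * frechet_derivative \<phi> (at x) b \<partial>lebesgue_on \<Omega>) = - (\<integral>x. (G x \<bullet> b) * \<phi> x \<partial>lebesgue_on \<Omega>)"
    unfolding integral_lebesgue_on_mult_test_function[OF assms(1) \<phi>]
      integral_lebesgue_on_mult_test_function[OF assms(1) test_functions_derivative[OF \<phi> b]]
    by (rule assms(4)[OF \<phi> b])
qed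

lemma is_weak_gradientD:
  assumes "is_weak_gradient \<Omega> u G"
  shows "locally_integrable \<Omega> u" "locally_integrable \<Omega> G"
    and "open \<Omega> \<Longrightarrow> \<phi> \<in> test_functions \<Omega> \<Longrightarrow> b \<in> Basis \<Longrightarrow>
      (\<integral>x. u x * frechet_derivative \<phi> (at x) b \<partial>lebesgue) = - (\<integral>x. (G x \<bullet> b) * \<phi> x \<partial>lebesgue)"
proof -
  show "locally_integrable \<Omega> u" "locally_integrable \<Omega> G"
    using assms by (simp_all add: is_weak_gradient_def)
  assume \<Omega>: "open \<Omega>" and \<phi>: "\<phi> \<in> test_functions \<Omega>" and b: "b \<in> Basis"
  have "(\<integral>x. u x * frechet_derivative \<phi> (at x) b \<partial>lebesgue_on \<Omega>) = - (\<integral>x. (G x \<bullet> b) * \<phi> x \<partial>lebesgue_on \<Omega>)"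
    using assms \<phi> b unfolding is_weak_gradient_def by blast
  then show "(\<integral>x. u x * frechet_derivative \<phi> (at x) b \<partial>lebesgue) = - (\<integral>x. (G x \<bullet> b) * \<phi> x \<partial>lebesgue)"
    unfolding integral_lebesgue_on_mult_test_function[OF \<Omega> \<phi>]
      integral_lebesgue_on_mult_test_function[OF \<Omega> test_functions_derivative[OF \<phi> b]] .
qed

lemma locally_integrable_inner:
  assumes "locally_integrable \<Omega> G"
  shows "locally_integrable \<Omega> (\<lambda>x. G x \<bullet> b)"
  unfolding locally_integrable_iff
proof (intro allI impI)
  fix K assume "compact K" "K \<subseteq> \<Omega>"
  then have "integrable lebesgue (\<lambda>x. (indicator K x *\<^sub>R G x) \<bullet> b)"
    using assms unfolding locally_integrable_iff by (intro integrable_inner_left) blast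
  then show "integrable lebesgue (\<lambda>x. indicator K x *\<^sub>R (G x \<bullet> b))" by simp
qed

lemma locally_integrable_indicator:
  fixes G :: "'a::euclidean_space \<Rightarrow> 'b::euclidean_space"
  assumes "locally_integrable \<Omega> G" "A \<inter> \<Omega> \<in> sets lebesgue"
  shows "locally_integrable \<Omega> (\<lambda>x. if x \<in> A then G x else 0)"
  unfolding locally_integrable_iff
proof (intro allI impI)
  fix K assume K: "compact K" "K \<subseteq> \<Omega>"
  have "integrable lebesgue (\<lambda>x. indicator K x *\<^sub>R G x)"
    using assms(1) K unfolding locally_integrable_iff by blast
  from integrable_mult_indicator[OF assms(2) this]
  have "integrable lebesgue (\<lambda>x. indicator (A \<inter> \<Omega>) x *\<^sub>R (indicator K x *\<^sub>R G x))" .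
  also have "(\<lambda>x. indicator (A \<inter> \<Omega>) x *\<^sub>R (indicator K x *\<^sub>R G x)) = (\<lambda>x. indicator K x *\<^sub>R (if x \<in> A then G x else 0))"
    using K(2) by (auto simp: indicator_def fun_eq_iff)
  finally show "integrable lebesgue (\<lambda>x. indicator K x *\<^sub>R (if x \<in> A then G x else 0))" .
qed

lemma locally_integrable_add_scaleR:
  assumes "locally_integrable \<Omega> u" "locally_integrable \<Omega> v"
  shows "locally_integrable \<Omega> (\<lambda>x. u x + c *\<^sub>R v x)"
  unfolding locally_integrable_iff
proof (intro allI impI)
  fix K assume K: "compact K" "K \<subseteq> \<Omega>"
  have "integrable lebesgue (\<lambda>x. indicator K x *\<^sub>R u x + c *\<^sub>R (indicator K x *\<^sub>R v x))"
    using assms K unfolding locally_integrable_iff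
    by (intro Bochner_Integration.integrable_add integrable_scaleR_right) blast+
  then show "integrable lebesgue (\<lambda>x. indicator K x *\<^sub>R (u x + c *\<^sub>R v x))"
    by (simp add: scaleR_add_right scaleR_left_commute del: scaleR_scaleR)
qed

text \<open>The form \<open>u x + c * v x\<close> covers sums, differences (c = -1) and the half
  steps of the comparison argument in a single statement.\<close>

lemma is_weak_gradient_add_scaleR:
  assumes "open \<Omega>" "is_weak_gradient \<Omega> u G" "is_weak_gradient \<Omega> v H"
  shows "is_weak_gradient \<Omega> (\<lambda>x. u x + c * v x) (\<lambda>x. G x + c *\<^sub>R H x)"
proof (rule is_weak_gradientI[OF assms(1)])
  note u = is_weak_gradientD[OF assms(2)] and v = is_weak_gradientD[OF assms(3)]
  show "locally_integrable \<Omega> (\<lambda>x. u x + c * v x)" "locally_integrable \<Omega> (\<lambda>x. G x + c *\<^sub>R H x)"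
    using locally_integrable_add_scaleR[OF u(1) v(1), of c] locally_integrable_add_scaleR[OF u(2) v(2), of c]
    by simp_all
  fix \<phi> and b :: 'a assume \<phi>: "\<phi> \<in> test_functions \<Omega>" and b: "b \<in> Basis"
  note d = test_functions_derivative[OF \<phi> b]
  note i = integrable_locally_integrable_mult_test_function
  have "(\<integral>x. (u x + c * v x) * frechet_derivative \<phi> (at x) b \<partial>lebesgue)
      = (\<integral>x. u x * frechet_derivative \<phi> (at x) b \<partial>lebesgue) + c * (\<integral>x. v x * frechet_derivative \<phi> (at x) b \<partial>lebesgue)"
    using i[OF u(1) d] i[OF v(1) d] by (simp add: distrib_right mult.assoc)
  also have "\<dots> = - ((\<integral>x. (G x \<bullet> b) * \<phi> x \<partial>lebesgue) + c * (\<integral>x. (H x \<bullet> b) * \<phi> x \<partial>lebesgue))"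
    using u(3)[OF assms(1) \<phi> b] v(3)[OF assms(1) \<phi> b] by simp
  also have "(\<integral>x. (G x \<bullet> b) * \<phi> x \<partial>lebesgue) + c * (\<integral>x. (H x \<bullet> b) * \<phi> x \<partial>lebesgue)
      = (\<integral>x. ((G x + c *\<^sub>R H x) \<bullet> b) * \<phi> x \<partial>lebesgue)"
    using i[OF locally_integrable_inner[OF u(2)] \<phi>, of b] i[OF locally_integrable_inner[OF v(2)] \<phi>, of b]
    by (simp add: distrib_right inner_add_left mult.assoc)
  finally show "(\<integral>x. (u x + c * v x) * frechet_derivative \<phi> (at x) b \<partial>lebesgue)
      = - (\<integral>x. ((G x + c *\<^sub>R H x) \<bullet> b) * \<phi> x \<partial>lebesgue)" .
qed

lemma is_weak_gradient_mono:
  assumes "is_weak_gradient T u G" "open S" "open T" "S \<subseteq> T"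
  shows "is_weak_gradient S u G"
proof (rule is_weak_gradientI[OF assms(2)])
  note u = is_weak_gradientD[OF assms(1)]
  show "locally_integrable S u" "locally_integrable S G"
    using u(1,2) assms(4) by (auto simp: locally_integrable_def)
qed (use is_weak_gradientD(3)[OF assms(1,3)] test_functions_mono[OF _ assms(4)] in blast)

lemma frechet_derivative_mult_test_functions:
  assumes "\<eta> \<in> test_functions S" "\<phi> \<in> test_functions T"
  shows "frechet_derivative (\<lambda>x. \<eta> x * \<phi> x) (at x) b =
    \<eta> x * frechet_derivative \<phi> (at x) b + frechet_derivative \<eta> (at x) b * \<phi> x"
proof -
  have "((\<lambda>x. \<eta> x * \<phi> x) has_derivative
      (\<lambda>b. \<eta> x * frechet_derivative \<phi> (at x) b + frechet_derivative \<eta> (at x) b * \<phi> x)) (at x)"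
    by (intro has_derivative_mult test_functions_has_derivative[OF assms(1)] test_functions_has_derivative[OF assms(2)])
  from frechet_derivative_at[OF this, symmetric] show ?thesis by simp
qed

text \<open>A cutoff function bounded by 1 attains its maximum wherever it equals 1. Its derivative
  therefore vanishes there, although it need not be constant near such a point.\<close>

lemma test_function_derivative_at_max:
  assumes "\<eta> \<in> test_functions S" "\<And>y. \<eta> y \<le> \<eta> x"
  shows "frechet_derivative \<eta> (at x) b = 0"
  using differential_zero_maxmin[OF _ open_UNIV test_functions_has_derivative[OF assms(1)], of x] assms(2)
  by simp

text \<open>The product rule, obtained by testing \<open>u\<close> with \<eta> \<phi> and moving the
  term with the derivative of \<eta> to the other side. It turns a weak gradient on \<Omega> into an
  integrable weak derivative on the whole space.\<close>

lemma weak_partial_localized: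
  assumes \<Omega>: "open \<Omega>" and u: "is_weak_gradient \<Omega> u G" and \<eta>: "\<eta> \<in> test_functions \<Omega>" and b: "b \<in> Basis"
  shows "weak_partial b (\<lambda>x. u x * \<eta> x) (\<lambda>x. (G x \<bullet> b) * \<eta> x + u x * frechet_derivative \<eta> (at x) b)"
proof -
  note d\<eta> = test_functions_derivative[OF \<eta> b]
  note i = integrable_locally_integrable_mult_test_function
  note lu = is_weak_gradientD(1)[OF u] and lG = locally_integrable_inner[OF is_weak_gradientD(2)[OF u], of b]
  have "(\<integral>x. u x * \<eta> x * frechet_derivative \<phi> (at x) b \<partial>lebesgue) =
      - (\<integral>x. ((G x \<bullet> b) * \<eta> x + u x * frechet_derivative \<eta> (at x) b) * \<phi> x \<partial>lebesgue)"
    if \<phi>: "\<phi> \<in> test_functions UNIV" for \<phi>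
  proof -
    note \<eta>\<phi> = test_functions_mult[OF \<eta> test_functionsD(1)[OF \<phi>]]
    note 1 = i[OF lu test_functions_derivative[OF \<eta>\<phi> b]]
    note 2 = i[OF lu test_functions_mult[OF d\<eta> test_functionsD(1)[OF \<phi>]]]
    have "(\<integral>x. u x * \<eta> x * frechet_derivative \<phi> (at x) b \<partial>lebesgue)
        = (\<integral>x. u x * frechet_derivative (\<lambda>x. \<eta> x * \<phi> x) (at x) b - u x * (frechet_derivative \<eta> (at x) b * \<phi> x) \<partial>lebesgue)"
      by (simp add: frechet_derivative_mult_test_functions[OF \<eta> \<phi>] algebra_simps)
    also have "\<dots> = - (\<integral>x. (G x \<bullet> b) * (\<eta> x * \<phi> x) \<partial>lebesgue) - (\<integral>x. u x * (frechet_derivative \<eta> (at x) b * \<phi> x) \<partial>lebesgue)"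
      using 1 2 is_weak_gradientD(3)[OF u \<Omega> \<eta>\<phi> b] by simp
    also have "\<dots> = - (\<integral>x. (G x \<bullet> b) * (\<eta> x * \<phi> x) + u x * (frechet_derivative \<eta> (at x) b * \<phi> x) \<partial>lebesgue)"
      using i[OF lG \<eta>\<phi>] 2 by simp
    finally show ?thesis by (simp add: distrib_right mult.assoc)
  qed
  then show ?thesis
    using i[OF lu \<eta>] i[OF lG \<eta>] i[OF lu d\<eta>] by (simp add: weak_partial_def)
qed

lemma is_weak_gradient_unique:
  assumes \<Omega>: "open \<Omega>" and G: "is_weak_gradient \<Omega> u G" and H: "is_weak_gradient \<Omega> u H"
  shows "AE x in lebesgue. x \<in> \<Omega> \<longrightarrow> G x = H x"
proof (rule AE_on_compacts_imp_AE_on_open[OF \<Omega>])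
  fix K assume K: "compact K" "K \<subseteq> \<Omega>"
  obtain \<eta> where \<eta>: "\<eta> \<in> test_functions \<Omega>" "\<And>x. x \<in> K \<Longrightarrow> \<eta> x = 1"
    using smooth_Urysohn[OF K(1) \<Omega> K(2)] by metis
  \<comment> \<open>Both localized derivatives contain the same term with the derivative of \<eta>,
    which cancels; on \<open>K\<close> the factor \<eta> is 1.\<close>
  have "AE x in lebesgue. x \<in> K \<longrightarrow> G x \<bullet> b = H x \<bullet> b" if b: "b \<in> Basis" for b
    using weak_partial_unique[OF weak_partial_localized[OF \<Omega> G \<eta>(1) b] weak_partial_localized[OF \<Omega> H \<eta>(1) b]]
    by eventually_elim (use \<eta>(2) in auto)
  then have "AE x in lebesgue. \<forall>b\<in>Basis. x \<in> K \<longrightarrow> G x \<bullet> b = H x \<bullet> b"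
    by (intro AE_finite_allI) auto
  then show "AE x in lebesgue. x \<in> K \<longrightarrow> G x = H x"
    by eventually_elim (auto intro: euclidean_eqI)
qed

lemma sets_lebesgue_positive:
  fixes u :: "'a::euclidean_space \<Rightarrow> real"
  assumes "open \<Omega>" "u \<in> borel_measurable (lebesgue_on \<Omega>)"
  shows "{x. u x > 0} \<inter> \<Omega> \<in> sets lebesgue"
proof -
  have "{x \<in> space (lebesgue_on \<Omega>). 0 < u x} \<in> sets (lebesgue_on \<Omega>)"
    using assms(2) by measurable
  then have "{x. u x > 0} \<inter> \<Omega> \<in> sets (lebesgue_on \<Omega>)"
    by (simp add: Collect_conj_eq Int_commute)
  then show ?thesis
    using assms(1) by (auto simp: sets_restrict_space_iff)
qed

text \<open>Where \<eta> = 1 and \<open>u = 0\<close>, the localized function vanishes and its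
  derivative is just a component of \<open>G\<close>, since the term with the derivative of \<eta>
  carries the factor \<open>u\<close>.\<close>

lemma weak_gradient_0_on_zero_set:
  assumes \<Omega>: "open \<Omega>" and G: "is_weak_gradient \<Omega> u G"
  shows "AE x in lebesgue. x \<in> \<Omega> \<longrightarrow> u x = 0 \<longrightarrow> G x = 0"
proof (rule AE_on_compacts_imp_AE_on_open[OF \<Omega>])
  fix K assume K: "compact K" "K \<subseteq> \<Omega>"
  obtain \<eta> where \<eta>: "\<eta> \<in> test_functions \<Omega>" "\<And>x. x \<in> K \<Longrightarrow> \<eta> x = 1"
    using smooth_Urysohn[OF K(1) \<Omega> K(2)] by metis
  have "AE x in lebesgue. x \<in> K \<longrightarrow> u x = 0 \<longrightarrow> G x \<bullet> b = 0" if b: "b \<in> Basis" for b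
    using weak_partial_pos_part(1)[OF weak_partial_localized[OF \<Omega> G \<eta>(1) b] b]
    by eventually_elim (use \<eta>(2) in auto)
  then have "AE x in lebesgue. \<forall>b\<in>Basis. x \<in> K \<longrightarrow> u x = 0 \<longrightarrow> G x \<bullet> b = 0"
    by (intro AE_finite_allI) auto
  then show "AE x in lebesgue. x \<in> K \<longrightarrow> u x = 0 \<longrightarrow> G x = 0"
    by eventually_elim (auto intro: euclidean_eqI)
qed

text \<open>For a given \<phi> the cutoff \<eta> equals 1 on the support of \<phi>. There
  \<open>u\<close> and \<open>u * \<eta>\<close> have the same positive part, and the derivative of
  \<eta> vanishes, so the result for \<open>weak_partial\<close> applied to
  \<open>u * \<eta>\<close> gives the claim.\<close>

lemma is_weak_gradient_pos_part:
  assumes \<Omega>: "open \<Omega>" and G: "is_weak_gradient \<Omega> u G"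
  shows "is_weak_gradient \<Omega> (\<lambda>x. max (u x) 0) (\<lambda>x. if u x > 0 then G x else 0)"
proof (rule is_weak_gradientI[OF \<Omega>])
  have set: "{x. u x > 0} \<inter> \<Omega> \<in> sets lebesgue"
    by (rule sets_lebesgue_positive[OF \<Omega> locally_integrable_measurable[OF \<Omega> is_weak_gradientD(1)[OF G]]])
  show "locally_integrable \<Omega> (\<lambda>x. max (u x) 0)"
    using locally_integrable_indicator[OF is_weak_gradientD(1)[OF G] set]
    by (simp add: max_def not_le[symmetric] if_distrib cong: if_cong)
      (smt (verit, best) locally_integrable_def set_integrable_cong)
  show "locally_integrable \<Omega> (\<lambda>x. if u x > 0 then G x else 0)"
    using locally_integrable_indicator[OF is_weak_gradientD(2)[OF G] set] by simp
  fix \<phi> and b :: 'a assume \<phi>: "\<phi> \<in> test_functions \<Omega>" and b: "b \<in> Basis"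
  let ?K = "closure {x. \<phi> x \<noteq> 0}"
  obtain \<eta> where \<eta>: "\<eta> \<in> test_functions \<Omega>" "\<And>x. \<eta> x \<le> 1" "\<And>x. x \<in> ?K \<Longrightarrow> \<eta> x = 1"
    using smooth_Urysohn[OF test_functionsD(2)[OF \<phi>] \<Omega> test_functionsD(3)[OF \<phi>]] by metis
  have d\<eta>: "frechet_derivative \<eta> (at x) b = 0" if "x \<in> ?K" for x
    by (rule test_function_derivative_at_max[OF \<eta>(1)]) (use \<eta>(2,3) that in simp)
  note w = weak_partial_pos_part(2)[OF weak_partial_localized[OF \<Omega> G \<eta>(1) b] b]
  have "max (u x) 0 * frechet_derivative \<phi> (at x) b = max (u x * \<eta> x) 0 * frechet_derivative \<phi> (at x) b" for x
    using \<eta>(3)[of x] frechet_derivative_eq_0_off_closure[of x \<phi> b] by (cases "x \<in> ?K") simp_all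
  moreover have "((if u x > 0 then G x else 0) \<bullet> b) * \<phi> x =
      (if u x * \<eta> x > 0 then (G x \<bullet> b) * \<eta> x + u x * frechet_derivative \<eta> (at x) b else 0) * \<phi> x" for x
    using \<eta>(3)[of x] d\<eta>[of x] eq_0_off_closure[of x \<phi>] by (cases "x \<in> ?K") simp_all
  ultimately show "(\<integral>x. max (u x) 0 * frechet_derivative \<phi> (at x) b \<partial>lebesgue) =
      - (\<integral>x. ((if u x > 0 then G x else 0) \<bullet> b) * \<phi> x \<partial>lebesgue)"
    using weak_partialD(3)[OF w test_functions_mono[OF \<phi> subset_UNIV]] by (simp only:)
qed

text \<open>A test function on the whole space is multiplied by a cutoff which equals 1 on
  \<open>K\<close>, which makes it admissible on \<Omega>. The cutoff has zero derivative on
  \<open>K\<close>, and off \<open>K\<close> the factor \<open>u\<close> vanishes, so the left-hand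
  integral does not change.\<close>

lemma is_weak_gradient_extend_0:
  assumes \<Omega>: "open \<Omega>" and G: "is_weak_gradient \<Omega> u G"
    and K: "compact K" "K \<subseteq> \<Omega>" "\<And>x. x \<notin> K \<Longrightarrow> u x = 0"
  shows "is_weak_gradient UNIV u (\<lambda>x. if x \<in> K then G x else 0)"
proof (rule is_weak_gradientI[OF open_UNIV])

  have ext: "locally_integrable UNIV (\<lambda>x. if x \<in> K then F x else 0)"
    if F: "locally_integrable \<Omega> F" for F :: "'a \<Rightarrow> 'b::euclidean_space"
    unfolding locally_integrable_iff
  proof (intro allI impI)
    fix C :: "'a set" assume "compact C"
    then have "C \<in> sets lebesgue" using lmeasurable_compact by blast
    moreover have "integrable lebesgue (\<lambda>x. indicator K x *\<^sub>R F x)"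
      using F K(1,2) unfolding locally_integrable_iff by blast
    ultimately have "integrable lebesgue (\<lambda>x. indicator C x *\<^sub>R (indicator K x *\<^sub>R F x))"
      by (rule integrable_mult_indicator)
    also have "(\<lambda>x. indicator C x *\<^sub>R (indicator K x *\<^sub>R F x)) = (\<lambda>x. indicator C x *\<^sub>R (if x \<in> K then F x else 0))"
      by (auto simp: indicator_def fun_eq_iff)
    finally show "integrable lebesgue (\<lambda>x. indicator C x *\<^sub>R (if x \<in> K then F x else 0))" .
  qed
  show lG: "locally_integrable UNIV (\<lambda>x. if x \<in> K then G x else 0)"
    by (rule ext[OF is_weak_gradientD(2)[OF G]])
  have "(\<lambda>x. if x \<in> K then u x else 0) = u"
    using K(3) by auto
  then show "locally_integrable UNIV u"
    using ext[OF is_weak_gradientD(1)[OF G]] by simp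
  fix \<phi> :: "'a \<Rightarrow> real" and b :: 'a assume \<phi>: "\<phi> \<in> test_functions UNIV" and b: "b \<in> Basis"
  obtain \<eta> where \<eta>: "\<eta> \<in> test_functions \<Omega>" "\<And>x. \<eta> x \<le> 1" "\<And>x. x \<in> K \<Longrightarrow> \<eta> x = 1"
    using smooth_Urysohn[OF K(1) \<Omega> K(2)] by metis
  have d\<eta>: "frechet_derivative \<eta> (at x) b = 0" if "x \<in> K" for x
    by (rule test_function_derivative_at_max[OF \<eta>(1)]) (use \<eta>(2,3) that in simp)
  note \<eta>\<phi> = test_functions_mult[OF \<eta>(1) test_functionsD(1)[OF \<phi>]]
  have "u x * frechet_derivative \<phi> (at x) b = u x * frechet_derivative (\<lambda>x. \<eta> x * \<phi> x) (at x) b" for x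
    using K(3)[of x] d\<eta>[of x] \<eta>(3)[of x]
    by (cases "x \<in> K") (auto simp: frechet_derivative_mult_test_functions[OF \<eta>(1) \<phi>])
  then have "(\<integral>x. u x * frechet_derivative \<phi> (at x) b \<partial>lebesgue) = - (\<integral>x. (G x \<bullet> b) * (\<eta> x * \<phi> x) \<partial>lebesgue)"
    using is_weak_gradientD(3)[OF G \<Omega> \<eta>\<phi> b] by (simp only:)
  also have "(\<integral>x. (G x \<bullet> b) * (\<eta> x * \<phi> x) \<partial>lebesgue) = (\<integral>x. ((if x \<in> K then G x else 0) \<bullet> b) * \<phi> x \<partial>lebesgue)"
  proof (rule integral_cong_AE)
    \<comment> \<open>On \<Omega> - K the function \<open>u\<close> is zero, so \<open>G\<close>
      vanishes there almost everywhere; off \<Omega> it is \<eta> that vanishes.\<close>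
    show "AE x in lebesgue. (G x \<bullet> b) * (\<eta> x * \<phi> x) = ((if x \<in> K then G x else 0) \<bullet> b) * \<phi> x"
      using weak_gradient_0_on_zero_set[OF \<Omega> G]
    proof eventually_elim
      case (elim x)
      show ?case
        using elim \<eta>(3)[of x] K(3)[of x] test_functions_support[OF \<eta>(1), of x] by auto
    qed
    show "(\<lambda>x. (G x \<bullet> b) * (\<eta> x * \<phi> x)) \<in> borel_measurable lebesgue"
      using integrable_locally_integrable_mult_test_function[OF locally_integrable_inner[OF is_weak_gradientD(2)[OF G]] \<eta>\<phi>]
      by (rule borel_measurable_integrable)
    show "(\<lambda>x. ((if x \<in> K then G x else 0) \<bullet> b) * \<phi> x) \<in> borel_measurable lebesgue"
      using integrable_locally_integrable_mult_test_function[OF locally_integrable_inner[OF lG] \<phi>]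
      by (rule borel_measurable_integrable)
  qed
  finally show "(\<integral>x. u x * frechet_derivative \<phi> (at x) b \<partial>lebesgue) =
      - (\<integral>x. ((if x \<in> K then G x else 0) \<bullet> b) * \<phi> x \<partial>lebesgue)" .
qed

lemma is_weak_gradient_weak_gradient:
  "is_weak_gradient \<Omega> u G \<Longrightarrow> is_weak_gradient \<Omega> u (weak_gradient \<Omega> u)"
  unfolding weak_gradient_def by (rule someI[of "is_weak_gradient \<Omega> u"])

lemma AE_weak_gradient_eq:
  assumes "open \<Omega>" "is_weak_gradient \<Omega> u G"
  shows "AE x in lebesgue_on \<Omega>. weak_gradient \<Omega> u x = G x"
  using is_weak_gradient_unique[OF assms(1) is_weak_gradient_weak_gradient[OF assms(2)] assms(2)] assms(1)
  by (simp add: AE_restrict_space_iff)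

section \<open>Modulars\<close>

text \<open>Pointwise bounds make factors such as \<open>2 powr P\<close> independent of the point.
  The strict inequality 1 < p enters as a separate almost everywhere assumption, together with
  strict convexity.\<close>

locale bounded_exponent =
  fixes p :: "'a::euclidean_space \<Rightarrow> real" and P :: real
  assumes p_measurable: "p \<in> borel_measurable lebesgue"
    and p_ge_1: "1 \<le> p x"
    and p_le: "p x \<le> P"
begin

lemma p_pos: "0 < p x"
  using p_ge_1[of x] by linarith

lemma P_ge_1: "1 \<le> P"
  using p_ge_1 p_le order_trans by blast

lemma p_measurable_on [measurable]: "p \<in> borel_measurable (lebesgue_on \<Omega>)"
  by (rule measurable_restrict_space1[OF p_measurable])

lemma norm_powr_measurable:
  fixes u :: "'a \<Rightarrow> 'b::euclidean_space"
  assumes [measurable]: "u \<in> borel_measurable (lebesgue_on \<Omega>)"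
  shows "(\<lambda>x. norm (u x) powr p x) \<in> borel_measurable (lebesgue_on \<Omega>)"
  by measurable

text \<open>The sum has norm at most 2 m times the larger of the two norms, where m = max 1 |c|. The
  power of a maximum is at most the sum of the powers, and as 2 m \<ge> 1 the exponent
  \<open>p x\<close> of this factor may be raised to \<open>P\<close>.\<close>

lemma norm_add_scaleR_powr_le:
  fixes a b :: "'b::real_normed_vector"
  shows "norm (a + c *\<^sub>R b) powr p x \<le> (2 * max 1 \<bar>c\<bar>) powr P * (norm a powr p x + norm b powr p x)"
proof -
  define m where "m = max 1 \<bar>c\<bar>"
  have m: "m \<ge> 1" "\<bar>c\<bar> \<le> m" by (auto simp: m_def)
  define s where "s = max (norm a) (norm b)"
  have s: "s \<ge> 0" "norm a \<le> s" "norm b \<le> s" by (auto simp: s_def le_max_iff_disj)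
  have "norm (a + c *\<^sub>R b) \<le> norm a + \<bar>c\<bar> * norm b"
    using norm_triangle_ineq[of a "c *\<^sub>R b"] by simp
  also have "\<dots> \<le> m * s + m * s"
    using m s mult_mono[of 1 m "norm a" s] by (intro add_mono mult_mono) auto
  finally have "norm (a + c *\<^sub>R b) powr p x \<le> (2 * m * s) powr p x"
    using p_pos[of x] by (intro powr_mono2) auto
  also have "\<dots> = (2 * m) powr p x * s powr p x"
    by (rule powr_mult)
  also have "\<dots> \<le> (2 * m) powr P * (norm a powr p x + norm b powr p x)"
  proof (rule mult_mono)
    show "(2 * m) powr p x \<le> (2 * m) powr P"
      using m p_le[of x] by (intro powr_mono) auto
    show "s powr p x \<le> norm a powr p x + norm b powr p x"
      by (cases "norm a \<le> norm b") (simp_all add: s_def)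
  qed auto
  finally show ?thesis by (simp add: m_def)
qed

lemma modular_add_scaleR_le:
  fixes u v :: "'a \<Rightarrow> 'b::euclidean_space"
  assumes [measurable]: "u \<in> borel_measurable (lebesgue_on \<Omega>)" "v \<in> borel_measurable (lebesgue_on \<Omega>)"
  shows "modular p \<Omega> (\<lambda>x. u x + c *\<^sub>R v x) \<le> ennreal ((2 * max 1 \<bar>c\<bar>) powr P) * (modular p \<Omega> u + modular p \<Omega> v)"
proof -
  note [measurable] = norm_powr_measurable[OF assms(1)] norm_powr_measurable[OF assms(2)]
  let ?C = "(2 * max 1 \<bar>c\<bar>) powr P"
  have "modular p \<Omega> (\<lambda>x. u x + c *\<^sub>R v x)
      \<le> (\<integral>\<^sup>+x. ennreal ?C * (ennreal (norm (u x) powr p x) + ennreal (norm (v x) powr p x)) \<partial>lebesgue_on \<Omega>)"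
    unfolding modular_def
  proof (rule nn_integral_mono)
    fix x
    have "ennreal (norm (u x + c *\<^sub>R v x) powr p x) \<le> ennreal (?C * (norm (u x) powr p x + norm (v x) powr p x))"
      by (rule ennreal_leI[OF norm_add_scaleR_powr_le])
    also have "\<dots> = ennreal ?C * (ennreal (norm (u x) powr p x) + ennreal (norm (v x) powr p x))"
      by (simp add: ennreal_mult)
    finally show "ennreal (norm (u x + c *\<^sub>R v x) powr p x) \<le> \<dots>" .
  qed
  also have "\<dots> = ennreal ?C * (modular p \<Omega> u + modular p \<Omega> v)"
    unfolding modular_def by (subst nn_integral_cmult) (simp_all add: nn_integral_add)
  finally show ?thesis .
qed

lemma modular_mono:
  assumes "AE x in lebesgue_on \<Omega>. norm (u x) \<le> norm (v x)"
  shows "modular p \<Omega> u \<le> modular p \<Omega> v"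
  unfolding modular_def
  by (rule nn_integral_mono_AE, use assms in eventually_elim)
    (auto intro!: ennreal_leI powr_mono2 less_imp_le[OF p_pos])

lemma modular_cong_AE:
  assumes "AE x in lebesgue_on \<Omega>. norm (u x) = norm (v x)"
  shows "modular p \<Omega> u = modular p \<Omega> v"
  unfolding modular_def by (rule nn_integral_cong_AE, use assms in eventually_elim) auto

text \<open>The assumption on \<open>l powr p x\<close> is left abstract because the sharp constant
  depends on the size of \<open>l\<close>: it is \<open>l\<close> itself for small \<open>l\<close>,
  and a power with exponent \<open>P\<close> for large \<open>l\<close>.\<close>

lemma modular_divide_le:
  fixes u :: "'a \<Rightarrow> 'b::euclidean_space"
  assumes u: "u \<in> borel_measurable (lebesgue_on \<Omega>)" and "0 < l"
    and "\<And>x. l powr p x \<le> C" "C \<ge> 0"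
  shows "modular p \<Omega> u \<le> ennreal C * modular p \<Omega> (\<lambda>x. u x /\<^sub>R l)"
proof -
  have [measurable]: "(\<lambda>x. norm (u x /\<^sub>R l) powr p x) \<in> borel_measurable (lebesgue_on \<Omega>)"
    using u by (intro norm_powr_measurable) measurable
  have "modular p \<Omega> u \<le> (\<integral>\<^sup>+x. ennreal C * ennreal (norm (u x /\<^sub>R l) powr p x) \<partial>lebesgue_on \<Omega>)"
    unfolding modular_def
  proof (rule nn_integral_mono)
    fix x
    have "norm (u x) = l * norm (u x /\<^sub>R l)"
      using \<open>0 < l\<close> by simp
    then have "norm (u x) powr p x = (l * norm (u x /\<^sub>R l)) powr p x"
      by (rule arg_cong)
    also have "\<dots> = l powr p x * norm (u x /\<^sub>R l) powr p x"
      by (rule powr_mult)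
    also have "\<dots> \<le> C * norm (u x /\<^sub>R l) powr p x"
      by (intro mult_right_mono assms) auto
    finally show "ennreal (norm (u x) powr p x) \<le> ennreal C * ennreal (norm (u x /\<^sub>R l) powr p x)"
      using assms(4) by (metis ennreal_leI ennreal_mult powr_ge_zero)
  qed
  also have "\<dots> = ennreal C * modular p \<Omega> (\<lambda>x. u x /\<^sub>R l)"
    unfolding modular_def by (rule nn_integral_cmult) measurable
  finally show ?thesis .
qed

lemma modular_finite_if_Luxemburg_finite:
  fixes u :: "'a \<Rightarrow> 'b::euclidean_space"
  assumes u: "u \<in> borel_measurable (lebesgue_on \<Omega>)" and "Luxemburg_norm p \<Omega> u < \<infinity>"
  shows "modular p \<Omega> u < \<infinity>"
proof -
  obtain l where l: "0 < l" "modular p \<Omega> (\<lambda>x. u x /\<^sub>R l) \<le> 1"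
    using assms(2) unfolding Luxemburg_norm_def Inf_less_iff by auto
  have "modular p \<Omega> u \<le> ennreal (max 1 l powr P) * modular p \<Omega> (\<lambda>x. u x /\<^sub>R l)"
  proof (rule modular_divide_le[OF u l(1)])
    fix x
    have "l powr p x \<le> max 1 l powr p x"
      using l p_pos[of x] by (intro powr_mono2) auto
    also have "\<dots> \<le> max 1 l powr P"
      using p_le by (intro powr_mono) auto
    finally show "l powr p x \<le> max 1 l powr P" .
  qed simp
  also have "\<dots> \<le> ennreal (max 1 l powr P) * 1"
    by (intro mult_left_mono l(2)) simp
  also have "\<dots> < \<infinity>" by simp
  finally show ?thesis .
qed

text \<open>For l \<le> 1 the factor \<open>l powr p x\<close> is at most \<open>l\<close>, since
  the exponent is at least 1.\<close>

lemma modular_le_if_Luxemburg_less: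
  fixes u :: "'a \<Rightarrow> 'b::euclidean_space"
  assumes u: "u \<in> borel_measurable (lebesgue_on \<Omega>)" and "Luxemburg_norm p \<Omega> u < ennreal e" "e \<le> 1"
  shows "modular p \<Omega> u \<le> ennreal e"
proof -
  obtain l where l: "0 < l" "modular p \<Omega> (\<lambda>x. u x /\<^sub>R l) \<le> 1" "ennreal l < ennreal e"
    using assms(2) unfolding Luxemburg_norm_def Inf_less_iff by auto
  then have "l < e" by (simp add: ennreal_less_iff)
  have "modular p \<Omega> u \<le> ennreal l * modular p \<Omega> (\<lambda>x. u x /\<^sub>R l)"
  proof (rule modular_divide_le[OF u l(1)])
    fix x
    have "l powr p x \<le> l powr 1"
      using l(1) \<open>l < e\<close> assms(3) p_ge_1 by (intro powr_mono') auto
    then show "l powr p x \<le> l" using l(1) by simp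
  qed (use l in simp)
  also have "\<dots> \<le> ennreal l * 1"
    by (intro mult_left_mono l(2)) simp
  also have "\<dots> \<le> ennreal e" using \<open>l < e\<close> by (simp add: ennreal_leI)
  finally show ?thesis .
qed

text \<open>The scaling estimate is applied to u / e with the factor 1 / e, which gives back
  \<open>u\<close>; then \<open>e\<close> itself qualifies in the infimum.\<close>

lemma Luxemburg_le_if_modular_le:
  fixes u :: "'a \<Rightarrow> 'b::euclidean_space"
  assumes u: "u \<in> borel_measurable (lebesgue_on \<Omega>)" and e: "0 < e"
    and le: "\<And>x. inverse e powr p x \<le> C" "C > 0" "modular p \<Omega> u \<le> ennreal (1 / C)"
  shows "Luxemburg_norm p \<Omega> u \<le> ennreal e"
proof -
  have "modular p \<Omega> (\<lambda>x. u x /\<^sub>R e) \<le> ennreal C * modular p \<Omega> (\<lambda>x. (u x /\<^sub>R e) /\<^sub>R inverse e)"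
    by (rule modular_divide_le) (use u e le(1,2) in \<open>auto intro: less_imp_le\<close>)
  also have "(\<lambda>x. (u x /\<^sub>R e) /\<^sub>R inverse e) = u"
    using e by simp
  also have "ennreal C * modular p \<Omega> u \<le> ennreal C * ennreal (1 / C)"
    by (intro mult_left_mono le(3)) simp
  also have "\<dots> = 1"
    using le(2) by (simp add: ennreal_mult[symmetric])
  finally show ?thesis
    unfolding Luxemburg_norm_def using e by (intro Inf_lower) auto
qed

lemma Lp_var_iff:
  fixes u :: "'a \<Rightarrow> 'b::euclidean_space"
  shows "u \<in> Lp_var p \<Omega> \<longleftrightarrow> u \<in> borel_measurable (lebesgue_on \<Omega>) \<and> modular p \<Omega> u < \<infinity>"
proof -
  have "Luxemburg_norm p \<Omega> u < \<infinity>" if u: "u \<in> borel_measurable (lebesgue_on \<Omega>)" and fin: "modular p \<Omega> u < \<infinity>"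
  proof -
    \<comment> \<open>For l \<ge> 1 the power of 1 / l with exponent \<open>p x\<close> is at most 1
      / l, so dividing \<open>u\<close> by \<open>l\<close> brings the modular down to at most
      1.\<close>
    define l where "l = max 1 (enn2real (modular p \<Omega> u))"
    have l: "l \<ge> 1" "modular p \<Omega> u \<le> ennreal l"
    proof -
      have "modular p \<Omega> u = ennreal (enn2real (modular p \<Omega> u))"
        using fin by (simp add: less_top)
      also have "\<dots> \<le> ennreal l"
        by (rule ennreal_leI) (simp add: l_def)
      finally show "modular p \<Omega> u \<le> ennreal l" .
    qed (simp add: l_def)
    have "Luxemburg_norm p \<Omega> u \<le> ennreal l"
    proof (rule Luxemburg_le_if_modular_le[OF u, where C = "1 / l"])
      fix x
      have "inverse l powr p x \<le> inverse l powr 1"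
        using l(1) p_ge_1 by (intro powr_mono') (auto simp: inverse_le_1_iff)
      then show "inverse l powr p x \<le> 1 / l" using l(1) by (simp add: inverse_eq_divide)
    qed (use l in auto)
    then show ?thesis by (rule le_less_trans) simp
  qed
  then show ?thesis
    using modular_finite_if_Luxemburg_finite[of u \<Omega>] by (auto simp: Lp_var_def)
qed

lemma Luxemburg_le_if_modular_le_powr:
  fixes u :: "'a \<Rightarrow> 'b::euclidean_space"
  assumes u: "u \<in> borel_measurable (lebesgue_on \<Omega>)" and e: "0 < e" "e \<le> 1"
    and le: "modular p \<Omega> u \<le> ennreal (e powr P)"
  shows "Luxemburg_norm p \<Omega> u \<le> ennreal e"
proof (rule Luxemburg_le_if_modular_le[OF u e(1), where C = "inverse e powr P"])
  show "inverse e powr p x \<le> inverse e powr P" for x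
    using e p_le by (intro powr_mono) (auto simp: one_le_inverse)
  show "modular p \<Omega> u \<le> ennreal (1 / inverse e powr P)"
    using le e by (simp add: powr_divide inverse_eq_divide)
qed (use e in simp)

section \<open>Sobolev spaces in terms of modulars\<close>

text \<open>It replaces the Sobolev norm: for bounded exponents both are finite together and small
  together, and the modular can be estimated under the integral sign.\<close>

definition Sobolev_modular :: "'a set \<Rightarrow> ('a \<Rightarrow> real) \<Rightarrow> ennreal"
  where "Sobolev_modular \<Omega> u = modular p \<Omega> u + modular p \<Omega> (weak_gradient \<Omega> u)"

lemma modular_weak_gradient:
  assumes "open \<Omega>" "is_weak_gradient \<Omega> u G"
  shows "modular p \<Omega> (weak_gradient \<Omega> u) = modular p \<Omega> G"
  by (rule modular_cong_AE, use AE_weak_gradient_eq[OF assms] in eventually_elim) simp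

lemma Sobolev_iff:
  assumes "open \<Omega>"
  shows "u \<in> Sobolev p \<Omega> \<longleftrightarrow> (\<exists>G. is_weak_gradient \<Omega> u G) \<and> Sobolev_modular \<Omega> u < \<infinity>"
proof -
  have "u \<in> borel_measurable (lebesgue_on \<Omega>)" "weak_gradient \<Omega> u \<in> borel_measurable (lebesgue_on \<Omega>)"
    if "is_weak_gradient \<Omega> u G" for G
    using is_weak_gradientD(1,2)[OF is_weak_gradient_weak_gradient[OF that]]
    by (simp_all add: locally_integrable_measurable[OF assms])
  then show ?thesis
    unfolding Sobolev_def Lp_var_iff Sobolev_modular_def by (auto simp: ennreal_add_less_top)
qed

lemma SobolevD:
  assumes "open \<Omega>" "u \<in> Sobolev p \<Omega>"
  shows "is_weak_gradient \<Omega> u (weak_gradient \<Omega> u)"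
    "u \<in> borel_measurable (lebesgue_on \<Omega>)" "weak_gradient \<Omega> u \<in> borel_measurable (lebesgue_on \<Omega>)"
    "modular p \<Omega> u < \<infinity>" "modular p \<Omega> (weak_gradient \<Omega> u) < \<infinity>"
  using assms is_weak_gradient_weak_gradient[of \<Omega> u] unfolding Sobolev_def Lp_var_iff by auto

lemma SobolevI:
  assumes "open \<Omega>" "is_weak_gradient \<Omega> u G" "modular p \<Omega> u < \<infinity>" "modular p \<Omega> G < \<infinity>"
  shows "u \<in> Sobolev p \<Omega>"
  unfolding Sobolev_iff[OF assms(1)] Sobolev_modular_def modular_weak_gradient[OF assms(1,2)]
  using assms(2-4) by (auto simp: ennreal_add_less_top)

lemma Sobolev_modular_eq:
  assumes "open \<Omega>" "is_weak_gradient \<Omega> u G"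
  shows "Sobolev_modular \<Omega> u = modular p \<Omega> u + modular p \<Omega> G"
  by (simp add: Sobolev_modular_def modular_weak_gradient[OF assms])

lemma Sobolev_modular_add_scaleR:
  assumes \<Omega>: "open \<Omega>" and u: "u \<in> Sobolev p \<Omega>" and v: "v \<in> Sobolev p \<Omega>"
  shows "(\<lambda>x. u x + c * v x) \<in> Sobolev p \<Omega>"
    and "Sobolev_modular \<Omega> (\<lambda>x. u x + c * v x)
      \<le> ennreal ((2 * max 1 \<bar>c\<bar>) powr P) * (Sobolev_modular \<Omega> u + Sobolev_modular \<Omega> v)"
proof -
  note U = SobolevD[OF \<Omega> u] and V = SobolevD[OF \<Omega> v]
  note W = is_weak_gradient_add_scaleR[OF \<Omega> U(1) V(1), of c]
  show le: "Sobolev_modular \<Omega> (\<lambda>x. u x + c * v x)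
      \<le> ennreal ((2 * max 1 \<bar>c\<bar>) powr P) * (Sobolev_modular \<Omega> u + Sobolev_modular \<Omega> v)"
  proof -
    let ?C = "ennreal ((2 * max 1 \<bar>c\<bar>) powr P)"
    have "Sobolev_modular \<Omega> (\<lambda>x. u x + c * v x)
        \<le> ?C * (modular p \<Omega> u + modular p \<Omega> v) + ?C * (modular p \<Omega> (weak_gradient \<Omega> u) + modular p \<Omega> (weak_gradient \<Omega> v))"
      unfolding Sobolev_modular_eq[OF \<Omega> W]
      using modular_add_scaleR_le[OF U(2) V(2), of c] modular_add_scaleR_le[OF U(3) V(3), of c]
      by (intro add_mono) simp_all
    also have "\<dots> = ?C * (Sobolev_modular \<Omega> u + Sobolev_modular \<Omega> v)"
      by (subst distrib_left[symmetric]) (simp add: Sobolev_modular_def ac_simps)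
    finally show ?thesis .
  qed
  have "ennreal ((2 * max 1 \<bar>c\<bar>) powr P) * (Sobolev_modular \<Omega> u + Sobolev_modular \<Omega> v) < \<infinity>"
    using U V by (simp add: Sobolev_modular_def ennreal_mult_less_top ennreal_add_less_top)
  with le have "Sobolev_modular \<Omega> (\<lambda>x. u x + c * v x) < \<infinity>" by (rule le_less_trans)
  then show "(\<lambda>x. u x + c * v x) \<in> Sobolev p \<Omega>"
    unfolding Sobolev_iff[OF \<Omega>] using W by blast
qed

lemma Sobolev_mono:
  assumes "u \<in> Sobolev p T" "open S" "open T" "S \<subseteq> T"
  shows "u \<in> Sobolev p S"
proof (rule SobolevI[OF assms(2)])
  note u = SobolevD[OF assms(3,1)]
  show "is_weak_gradient S u (weak_gradient T u)"
    by (rule is_weak_gradient_mono[OF u(1) assms(2,3,4)])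
  have "modular p S w \<le> modular p T w" for w :: "'a \<Rightarrow> 'b::real_normed_vector"
    unfolding modular_def using assms(2,3,4)
    by (auto simp: nn_integral_restrict_space indicator_def intro!: nn_integral_mono)
  from this[of u] this[of "weak_gradient T u"]
  show "modular p S u < \<infinity>" "modular p S (weak_gradient T u) < \<infinity>"
    using u(4,5) by (auto intro: le_less_trans)
qed

lemma Sobolev_pos_part:
  assumes \<Omega>: "open \<Omega>" and u: "u \<in> Sobolev p \<Omega>"
  shows "(\<lambda>x. max (u x) 0) \<in> Sobolev p \<Omega>"
proof (rule SobolevI[OF \<Omega> is_weak_gradient_pos_part[OF \<Omega> SobolevD(1)[OF \<Omega> u]]])
  have "modular p \<Omega> (\<lambda>x. max (u x) 0) \<le> modular p \<Omega> u"
    "modular p \<Omega> (\<lambda>x. if u x > 0 then weak_gradient \<Omega> u x else 0) \<le> modular p \<Omega> (weak_gradient \<Omega> u)"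
    by (auto intro!: modular_mono)
  then show "modular p \<Omega> (\<lambda>x. max (u x) 0) < \<infinity>"
    "modular p \<Omega> (\<lambda>x. if u x > 0 then weak_gradient \<Omega> u x else 0) < \<infinity>"
    using SobolevD(4,5)[OF \<Omega> u] by (auto intro: le_less_trans)
qed

text \<open>For d \<le> 1, a norm below d gives a modular of at most d, and a modular of at most d ^
  P gives a norm of at most d. Hence the closures with respect to either quantity agree.\<close>

lemma Sobolev0_iff:
  assumes \<Omega>: "open \<Omega>"
  shows "u \<in> Sobolev0 p \<Omega> \<longleftrightarrow> u \<in> Sobolev p \<Omega> \<and>
    (\<forall>e>0. \<exists>v\<in>Sobolev p UNIV. compact_support_in v \<Omega> \<and> Sobolev_modular \<Omega> (\<lambda>x. u x - v x) < ennreal e)"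
proof -
  have small1: "Sobolev_modular \<Omega> w < ennreal e"
    if w: "w \<in> Sobolev p \<Omega>" "Sobolev_norm p \<Omega> w < ennreal (min e 1 / 3)" and "e > 0" for w e
  proof -
    \<comment> \<open>The two summands, for the function and its gradient, are at most
      \<open>?d\<close> each and together stay strictly below e; the minimum ensures
      \<open>?d \<le> 1\<close>.\<close>
    let ?d = "min e 1 / 3"
    note W = SobolevD[OF \<Omega> w(1)]
    have "Luxemburg_norm p \<Omega> w < ennreal ?d" "Luxemburg_norm p \<Omega> (weak_gradient \<Omega> w) < ennreal ?d"
      using w(2) unfolding Sobolev_norm_def by (auto elim: le_less_trans[rotated])
    then have "modular p \<Omega> w \<le> ennreal ?d" "modular p \<Omega> (weak_gradient \<Omega> w) \<le> ennreal ?d"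
      using modular_le_if_Luxemburg_less[OF W(2)] modular_le_if_Luxemburg_less[OF W(3)] by simp_all
    then have "Sobolev_modular \<Omega> w \<le> ennreal (?d + ?d)"
      unfolding Sobolev_modular_def using \<open>e > 0\<close> by (subst ennreal_plus) (auto intro: add_mono)
    also have "\<dots> < ennreal e" using \<open>e > 0\<close> by (intro ennreal_lessI) auto
    finally show ?thesis .
  qed
  have small2: "Sobolev_norm p \<Omega> w < ennreal e"
    if w: "w \<in> Sobolev p \<Omega>" "Sobolev_modular \<Omega> w < ennreal ((min e 1 / 3) powr P)" and "e > 0" for w e
  proof -
    let ?d = "min e 1 / 3"
    note W = SobolevD[OF \<Omega> w(1)]
    have "modular p \<Omega> w \<le> Sobolev_modular \<Omega> w" "modular p \<Omega> (weak_gradient \<Omega> w) \<le> Sobolev_modular \<Omega> w"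
      by (simp_all add: Sobolev_modular_def)
    then have "modular p \<Omega> w \<le> ennreal (?d powr P)" "modular p \<Omega> (weak_gradient \<Omega> w) \<le> ennreal (?d powr P)"
      using w(2) by (meson less_imp_le order_trans)+
    then have "Luxemburg_norm p \<Omega> w \<le> ennreal ?d" "Luxemburg_norm p \<Omega> (weak_gradient \<Omega> w) \<le> ennreal ?d"
      using W(2,3) \<open>e > 0\<close> by (auto intro!: Luxemburg_le_if_modular_le_powr)
    then have "Sobolev_norm p \<Omega> w \<le> ennreal (?d + ?d)"
      unfolding Sobolev_norm_def using \<open>e > 0\<close> by (subst ennreal_plus) (auto intro: add_mono)
    also have "\<dots> < ennreal e" using \<open>e > 0\<close> by (intro ennreal_lessI) auto
    finally show ?thesis .
  qed
  have diff: "(\<lambda>x. u x - v x) \<in> Sobolev p \<Omega>" if "u \<in> Sobolev p \<Omega>" "v \<in> Sobolev p UNIV" for v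
    using Sobolev_modular_add_scaleR(1)[OF \<Omega> that(1) Sobolev_mono[OF that(2) \<Omega> open_UNIV subset_UNIV], of "-1"] by simp
  show ?thesis
  proof (intro iffI conjI allI impI; (elim conjE)?)
    assume u0: "u \<in> Sobolev0 p \<Omega>"
    then show u: "u \<in> Sobolev p \<Omega>" by (simp add: Sobolev0_def)
    fix e :: real assume e: "e > 0"
    then have "min e 1 / 3 > 0" by simp
    then obtain v where v: "v \<in> Sobolev p UNIV" "compact_support_in v \<Omega>"
        "Sobolev_norm p \<Omega> (\<lambda>x. u x - v x) < ennreal (min e 1 / 3)"
      using u0 unfolding Sobolev0_def by blast
    then show "\<exists>v\<in>Sobolev p UNIV. compact_support_in v \<Omega> \<and> Sobolev_modular \<Omega> (\<lambda>x. u x - v x) < ennreal e"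
      using small1[OF diff[OF u v(1)] v(3) e] by blast
  next
    assume u: "u \<in> Sobolev p \<Omega>" and *: "\<forall>e>0. \<exists>v\<in>Sobolev p UNIV. compact_support_in v \<Omega> \<and> Sobolev_modular \<Omega> (\<lambda>x. u x - v x) < ennreal e"
    have "\<exists>v\<in>Sobolev p UNIV. compact_support_in v \<Omega> \<and> Sobolev_norm p \<Omega> (\<lambda>x. u x - v x) < ennreal e"
      if e: "e > 0" for e
    proof -
      have "(min e 1 / 3) powr P > 0" using e by simp
      then obtain v where v: "v \<in> Sobolev p UNIV" "compact_support_in v \<Omega>"
          "Sobolev_modular \<Omega> (\<lambda>x. u x - v x) < ennreal ((min e 1 / 3) powr P)"
        using * by blast
      then show ?thesis using small2[OF diff[OF u v(1)] v(3) e] by blast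
    qed
    then show "u \<in> Sobolev0 p \<Omega>" using u by (simp add: Sobolev0_def)
  qed
qed

end

section \<open>Independence of the values outside the open set, and extension by zero\<close>

lemma is_weak_gradient_cong:
  assumes "\<And>x. x \<in> \<Omega> \<Longrightarrow> u x = v x"
  shows "is_weak_gradient \<Omega> u G \<longleftrightarrow> is_weak_gradient \<Omega> v G"
proof -
  have "(\<lambda>x. indicator K x *\<^sub>R u x) = (\<lambda>x. indicator K x *\<^sub>R v x)" if "K \<subseteq> \<Omega>" for K
    using that assms by (auto simp: indicator_def fun_eq_iff)
  then have "locally_integrable \<Omega> u \<longleftrightarrow> locally_integrable \<Omega> v"
    unfolding locally_integrable_iff by auto
  moreover have "(\<integral>x. u x * F x \<partial>lebesgue_on \<Omega>) = (\<integral>x. v x * F x \<partial>lebesgue_on \<Omega>)" for F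
    by (rule Bochner_Integration.integral_cong) (use assms in auto)
  ultimately show ?thesis unfolding is_weak_gradient_def by simp
qed

lemma weak_gradient_cong:
  assumes "\<And>x. x \<in> \<Omega> \<Longrightarrow> u x = v x"
  shows "weak_gradient \<Omega> u = weak_gradient \<Omega> v"
proof -
  have "is_weak_gradient \<Omega> u = is_weak_gradient \<Omega> v"
    using is_weak_gradient_cong[of \<Omega> u v] assms by (intro ext) blast
  then show ?thesis by (simp add: weak_gradient_def)
qed

lemma compact_support_inI:
  assumes "compact K" "K \<subseteq> \<Omega>" "\<And>x. x \<notin> K \<Longrightarrow> u x = 0"
  shows "compact_support_in u \<Omega>"
proof -
  have "closure {x. u x \<noteq> 0} \<subseteq> K"
    using assms by (intro closure_minimal) (auto intro: compact_imp_closed)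
  then show ?thesis
    using assms(1,2) unfolding compact_support_in_def
    by (auto simp: compact_eq_bounded_closed intro: bounded_subset)
qed

context bounded_exponent
begin

lemma modular_cong: "(\<And>x. x \<in> \<Omega> \<Longrightarrow> u x = v x) \<Longrightarrow> modular p \<Omega> u = modular p \<Omega> v"
  unfolding modular_def by (rule nn_integral_cong) auto

lemma Sobolev_modular_cong:
  assumes "\<And>x. x \<in> \<Omega> \<Longrightarrow> u x = v x"
  shows "Sobolev_modular \<Omega> u = Sobolev_modular \<Omega> v"
  using weak_gradient_cong[of \<Omega> u v] modular_cong[of \<Omega> u v] assms by (simp add: Sobolev_modular_def)

lemma Sobolev_cong:
  assumes "open \<Omega>" "\<And>x. x \<in> \<Omega> \<Longrightarrow> u x = v x"
  shows "u \<in> Sobolev p \<Omega> \<longleftrightarrow> v \<in> Sobolev p \<Omega>"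
  using is_weak_gradient_cong[of \<Omega> u v] Sobolev_modular_cong[of \<Omega> u v] assms(2)
  by (simp add: Sobolev_iff[OF assms(1)])

lemma Sobolev_modular_uminus:
  assumes "open \<Omega>" "u \<in> Sobolev p \<Omega>"
  shows "Sobolev_modular \<Omega> (\<lambda>x. - u x) = Sobolev_modular \<Omega> u"
proof -
  note u = SobolevD(1)[OF assms]
  \<comment> \<open>The negative is written as u - 2 u to fit the rule for linear
    combinations.\<close>
  have "is_weak_gradient \<Omega> (\<lambda>x. u x + (- 2) * u x) (\<lambda>x. weak_gradient \<Omega> u x + (- 2) *\<^sub>R weak_gradient \<Omega> u x)"
    by (rule is_weak_gradient_add_scaleR[OF assms(1) u u])
  then have "is_weak_gradient \<Omega> (\<lambda>x. - u x) (\<lambda>x. - weak_gradient \<Omega> u x)"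
    by (simp add: scaleR_2)
  then have "Sobolev_modular \<Omega> (\<lambda>x. - u x) = modular p \<Omega> (\<lambda>x. - u x) + modular p \<Omega> (\<lambda>x. - weak_gradient \<Omega> u x)"
    by (rule Sobolev_modular_eq[OF assms(1)])
  then show ?thesis by (simp add: modular_def Sobolev_modular_def)
qed

lemma Sobolev_extend_0:
  assumes \<Omega>: "open \<Omega>" and u: "u \<in> Sobolev p \<Omega>"
    and K: "compact K" "K \<subseteq> \<Omega>" "\<And>x. x \<notin> K \<Longrightarrow> u x = 0"
  shows "u \<in> Sobolev p UNIV"
proof (rule SobolevI[OF open_UNIV is_weak_gradient_extend_0[OF \<Omega> SobolevD(1)[OF \<Omega> u] K]])
  have le: "modular p UNIV w \<le> modular p \<Omega> w'"
    if "\<And>x. x \<notin> K \<Longrightarrow> w x = 0" "\<And>x. x \<in> K \<Longrightarrow> w x = w' x" for w w' :: "'a \<Rightarrow> 'b::real_normed_vector"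
  proof -
    have "ennreal (norm (w x) powr p x) \<le> ennreal (norm (w' x) powr p x) * indicator \<Omega> x" for x
      using that[of x] K(2) by (cases "x \<in> K") (auto simp: indicator_def)
    then show ?thesis
      unfolding modular_def lebesgue_on_UNIV_eq using \<Omega>
      by (simp add: nn_integral_restrict_space) (rule nn_integral_mono, simp)
  qed
  have "modular p UNIV u \<le> modular p \<Omega> u"
    by (rule le) (use K(3) in auto)
  moreover have "modular p UNIV (\<lambda>x. if x \<in> K then weak_gradient \<Omega> u x else 0) \<le> modular p \<Omega> (weak_gradient \<Omega> u)"
    by (rule le) auto
  ultimately show "modular p UNIV u < \<infinity>"
      "modular p UNIV (\<lambda>x. if x \<in> K then weak_gradient \<Omega> u x else 0) < \<infinity>"
    using SobolevD(4,5)[OF \<Omega> u] by (auto intro: le_less_trans)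
qed

text \<open>The modulars are summable, so the series of |d n x| ^ p(x) converges almost everywhere.
  Its terms tend to 0, and so do their roots of order p(x).\<close>

lemma AE_tendsto_0_if_modular_geometric:
  fixes d :: "nat \<Rightarrow> 'a \<Rightarrow> real"
  assumes d: "\<And>n. d n \<in> borel_measurable (lebesgue_on \<Omega>)"
    and le: "\<And>n. modular p \<Omega> (d n) \<le> ennreal ((1 / 2) ^ n)"
  shows "AE x in lebesgue_on \<Omega>. (\<lambda>n. d n x) \<longlonglongrightarrow> 0"
proof -
  note [measurable] = norm_powr_measurable[OF d, unfolded real_norm_def]
  have "(\<integral>\<^sup>+x. (\<Sum>n. ennreal (\<bar>d n x\<bar> powr p x)) \<partial>lebesgue_on \<Omega>) = (\<Sum>n. modular p \<Omega> (d n))"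
    unfolding modular_def real_norm_def by (rule nn_integral_suminf) measurable
  also have "\<dots> \<le> (\<Sum>n. ennreal ((1 / 2) ^ n))"
    by (intro suminf_le le) auto
  also have "\<dots> = ennreal (\<Sum>n. (1 / 2) ^ n)"
    by (intro suminf_ennreal2) (auto intro: summable_geometric)
  also have "\<dots> < \<infinity>" by simp
  finally have "(\<integral>\<^sup>+x. (\<Sum>n. ennreal (\<bar>d n x\<bar> powr p x)) \<partial>lebesgue_on \<Omega>) \<noteq> \<infinity>" by simp
  then have "AE x in lebesgue_on \<Omega>. (\<Sum>n. ennreal (\<bar>d n x\<bar> powr p x)) \<noteq> \<infinity>"
    by (intro nn_integral_PInf_AE) measurable
  then show ?thesis
  proof eventually_elim
    case (elim x)
    then have "summable (\<lambda>n. \<bar>d n x\<bar> powr p x)"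
      by (intro summable_suminf_not_top) auto
    then have "(\<lambda>n. \<bar>d n x\<bar> powr p x) \<longlonglongrightarrow> 0"
      by (rule summable_LIMSEQ_zero)
    then have "(\<lambda>n. (\<bar>d n x\<bar> powr p x) powr (1 / p x)) \<longlonglongrightarrow> 0"
      by (rule tendsto_zero_powrI[OF _ tendsto_const]) (use p_pos[of x] in auto)
    then show ?case
      using p_pos[of x] by (simp add: powr_powr tendsto_rabs_zero_iff)
  qed
qed

text \<open>Continuity of the positive part, along sequences which converge fast enough to converge
  almost everywhere. The gradient of \<open>z\<close> vanishes on \<open>{z = 0}\<close>, which is the only place where
  the indicator functions of \<open>{z\<^sub>n > 0}\<close> need not converge.\<close>

lemma tendsto_Sobolev_modular_pos_part:
  assumes \<Omega>: "open \<Omega>" and z: "z \<in> Sobolev p \<Omega>" and y: "\<And>n. y n \<in> Sobolev p \<Omega>"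
    and le: "\<And>n. Sobolev_modular \<Omega> (\<lambda>x. z x - y n x) \<le> ennreal ((1 / 2) ^ n)"
  shows "(\<lambda>n. Sobolev_modular \<Omega> (\<lambda>x. max (z x) 0 - max (y n x) 0)) \<longlonglongrightarrow> 0"
proof -
  define G where "G = weak_gradient \<Omega> z"
  define H where "H = (\<lambda>n. weak_gradient \<Omega> (y n))"
  note Z = SobolevD[OF \<Omega> z, folded G_def]
  have Y: "is_weak_gradient \<Omega> (y n) (H n)" "y n \<in> borel_measurable (lebesgue_on \<Omega>)"
      "H n \<in> borel_measurable (lebesgue_on \<Omega>)" for n
    using SobolevD[OF \<Omega> y[of n]] by (simp_all add: H_def)
  note [measurable] = Z(2,3) Y(2,3)
  have dm: "modular p \<Omega> (\<lambda>x. z x - y n x) \<le> ennreal ((1 / 2) ^ n)"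
    and dg: "modular p \<Omega> (\<lambda>x. G x - H n x) \<le> ennreal ((1 / 2) ^ n)" for n
  proof -
    have "is_weak_gradient \<Omega> (\<lambda>x. z x - y n x) (\<lambda>x. G x - H n x)"
      using is_weak_gradient_add_scaleR[OF \<Omega> Z(1) Y(1), of "-1" n] by simp
    from le[of n, unfolded Sobolev_modular_eq[OF \<Omega> this]]
    show "modular p \<Omega> (\<lambda>x. z x - y n x) \<le> ennreal ((1 / 2) ^ n)"
      "modular p \<Omega> (\<lambda>x. G x - H n x) \<le> ennreal ((1 / 2) ^ n)"
      by (auto elim: order_trans[rotated])
  qed
  have lim: "AE x in lebesgue_on \<Omega>. (\<lambda>n. z x - y n x) \<longlonglongrightarrow> 0"
    by (rule AE_tendsto_0_if_modular_geometric[OF _ dm]) measurable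
  have zero: "AE x in lebesgue_on \<Omega>. z x = 0 \<longrightarrow> G x = 0"
    using weak_gradient_0_on_zero_set[OF \<Omega> Z(1)] \<Omega> by (simp add: AE_restrict_space_iff)
  \<comment> \<open>The difference of the gradients of the positive parts is
    \<open>A n + R n\<close>. In \<open>A n\<close> the gradients differ on a common set, which the
    assumed rate controls; in \<open>R n\<close> the gradient \<open>G\<close> is fixed and only the
    sets differ, which dominated convergence controls.\<close>
  define R where "R = (\<lambda>n x. (if z x > 0 then G x else 0) - (if y n x > 0 then G x else 0))"
  define A where "A = (\<lambda>n x. if y n x > 0 then G x - H n x else 0)"
  have [measurable]: "R n \<in> borel_measurable (lebesgue_on \<Omega>)" "A n \<in> borel_measurable (lebesgue_on \<Omega>)" for n
    unfolding R_def A_def by measurable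
  have R_lim: "(\<lambda>n. modular p \<Omega> (R n)) \<longlonglongrightarrow> 0"
  proof -
    note [measurable] = norm_powr_measurable[OF Z(3)] norm_powr_measurable[of "R _" \<Omega>]
    have "(\<lambda>n. \<integral>\<^sup>+x. ennreal (norm (R n x) powr p x) \<partial>lebesgue_on \<Omega>) \<longlonglongrightarrow> (\<integral>\<^sup>+x. 0 \<partial>lebesgue_on \<Omega>)"
    proof (rule nn_integral_dominated_convergence[where w = "\<lambda>x. ennreal (norm (G x) powr p x)"])
      show "AE x in lebesgue_on \<Omega>. ennreal (norm (R n x) powr p x) \<le> ennreal (norm (G x) powr p x)" for n
      proof (intro AE_I2 ennreal_leI powr_mono2)
        fix x show "norm (R n x) \<le> norm (G x)" by (simp add: R_def)
      qed (use p_pos in \<open>auto intro: less_imp_le\<close>)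
      show "AE x in lebesgue_on \<Omega>. (\<lambda>n. ennreal (norm (R n x) powr p x)) \<longlonglongrightarrow> 0"
        using lim zero
      proof eventually_elim
        case (elim x)
        have "(\<lambda>n. z x - (z x - y n x)) \<longlonglongrightarrow> z x - 0"
          by (intro tendsto_diff tendsto_const elim)
        then have yz: "(\<lambda>n. y n x) \<longlonglongrightarrow> z x" by simp
        have "\<forall>\<^sub>F n in sequentially. R n x = 0"
        proof (cases "z x" "0::real" rule: linorder_cases)
          case less
          show ?thesis
            using order_tendstoD(2)[OF yz less] by eventually_elim (use less in \<open>simp add: R_def\<close>)
        next
          case greater
          show ?thesis
            using order_tendstoD(1)[OF yz greater] by eventually_elim (use greater in \<open>simp add: R_def\<close>)
        qed (use elim(2) in \<open>simp add: R_def\<close>)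
        then show ?case
          by (intro tendsto_eventually, eventually_elim) simp
      qed
      show "(\<integral>\<^sup>+x. ennreal (norm (G x) powr p x) \<partial>lebesgue_on \<Omega>) < \<infinity>"
        using Z(5) by (simp add: modular_def)
    qed measurable
    then show ?thesis by (simp add: modular_def)
  qed
  let ?K = "ennreal (2 powr P)"
  define e where "e = (\<lambda>n. ennreal ((1 / 2) ^ n))"
  have bound: "Sobolev_modular \<Omega> (\<lambda>x. max (z x) 0 - max (y n x) 0) \<le> e n + ?K * (e n + modular p \<Omega> (R n))" for n
  proof -
    have "is_weak_gradient \<Omega> (\<lambda>x. max (z x) 0 + (- 1) * max (y n x) 0)
        (\<lambda>x. (if z x > 0 then G x else 0) + (- 1) *\<^sub>R (if y n x > 0 then H n x else 0))"
      by (intro is_weak_gradient_add_scaleR is_weak_gradient_pos_part \<Omega> Z(1) Y(1))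
    also have "(\<lambda>x. (if z x > 0 then G x else 0) + (- 1) *\<^sub>R (if y n x > 0 then H n x else 0)) = (\<lambda>x. A n x + 1 *\<^sub>R R n x)"
      by (auto simp: A_def R_def)
    finally have g: "is_weak_gradient \<Omega> (\<lambda>x. max (z x) 0 - max (y n x) 0) (\<lambda>x. A n x + 1 *\<^sub>R R n x)"
      by simp
    have "modular p \<Omega> (\<lambda>x. max (z x) 0 - max (y n x) 0) \<le> modular p \<Omega> (\<lambda>x. z x - y n x)"
      by (rule modular_mono) auto
    also have "\<dots> \<le> e n" unfolding e_def by (rule dm)
    finally have 1: "modular p \<Omega> (\<lambda>x. max (z x) 0 - max (y n x) 0) \<le> e n" .
    have "modular p \<Omega> (A n) \<le> modular p \<Omega> (\<lambda>x. G x - H n x)"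
      by (rule modular_mono) (auto simp: A_def)
    also have "\<dots> \<le> e n" unfolding e_def by (rule dg)
    finally have A: "modular p \<Omega> (A n) \<le> e n" .
    have "modular p \<Omega> (\<lambda>x. A n x + 1 *\<^sub>R R n x) \<le> ?K * (modular p \<Omega> (A n) + modular p \<Omega> (R n))"
      using modular_add_scaleR_le[of "A n" \<Omega> "R n" 1] by simp
    also have "\<dots> \<le> ?K * (e n + modular p \<Omega> (R n))"
      by (intro mult_left_mono add_right_mono A) simp
    finally show ?thesis
      unfolding Sobolev_modular_eq[OF \<Omega> g] by (intro add_mono 1)
  qed
  have "(\<lambda>n. (1 / 2 :: real) ^ n) \<longlonglongrightarrow> 0" by (rule LIMSEQ_power_zero) simp
  then have "e \<longlonglongrightarrow> ennreal 0" unfolding e_def by (rule tendsto_ennrealI)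
  then have "(\<lambda>n. e n + ?K * (e n + modular p \<Omega> (R n))) \<longlonglongrightarrow> 0 + ?K * (0 + 0)"
    using R_lim by (intro tendsto_add ennreal_tendsto_cmult) auto
  then have b0: "(\<lambda>n. e n + ?K * (e n + modular p \<Omega> (R n))) \<longlonglongrightarrow> 0" by simp
  show ?thesis
    by (rule tendsto_sandwich[OF _ _ tendsto_const b0]) (auto intro!: always_eventually bound)
qed

section \<open>Zero boundary values\<close>

lemma Sobolev0_imp_Sobolev: "u \<in> Sobolev0 p \<Omega> \<Longrightarrow> u \<in> Sobolev p \<Omega>"
  by (simp add: Sobolev0_def)

lemma Sobolev_UNIV_imp_Sobolev: "open \<Omega> \<Longrightarrow> u \<in> Sobolev p UNIV \<Longrightarrow> u \<in> Sobolev p \<Omega>"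
  by (rule Sobolev_mono[of u UNIV]) simp_all

text \<open>The rate is prescribed because it is summable: the approximants converge almost
  everywhere without passing to a subsequence.\<close>

lemma Sobolev0_sequence:
  assumes "open \<Omega>" "u \<in> Sobolev0 p \<Omega>"
  obtains v :: "nat \<Rightarrow> 'a \<Rightarrow> real"
  where "\<And>n. v n \<in> Sobolev p UNIV" "\<And>n. compact_support_in (v n) \<Omega>"
    "\<And>n. Sobolev_modular \<Omega> (\<lambda>x. u x - v n x) \<le> ennreal ((1 / 2) ^ n)"
proof -
  have "\<forall>n. \<exists>v. v \<in> Sobolev p UNIV \<and> compact_support_in v \<Omega> \<and>
      Sobolev_modular \<Omega> (\<lambda>x. u x - v x) \<le> ennreal ((1 / 2) ^ n)"
  proof
    fix n
    have "(0::real) < (1 / 2) ^ n" by simp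
    then show "\<exists>v. v \<in> Sobolev p UNIV \<and> compact_support_in v \<Omega> \<and>
      Sobolev_modular \<Omega> (\<lambda>x. u x - v x) \<le> ennreal ((1 / 2) ^ n)"
      using assms(2) unfolding Sobolev0_iff[OF assms(1)] by (meson less_imp_le)
  qed
  then show thesis using that by metis
qed

lemma Sobolev0_limit:
  assumes "open \<Omega>" "u \<in> Sobolev p \<Omega>"
    and "\<And>n. v n \<in> Sobolev p UNIV" "\<And>n. compact_support_in (v n) \<Omega>"
    and lim: "(\<lambda>n. Sobolev_modular \<Omega> (\<lambda>x. u x - v n x)) \<longlonglongrightarrow> 0"
  shows "u \<in> Sobolev0 p \<Omega>"
  unfolding Sobolev0_iff[OF assms(1)]
proof (intro conjI allI impI assms(2))
  fix e :: real assume "e > 0"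
  then have "\<forall>\<^sub>F n in sequentially. Sobolev_modular \<Omega> (\<lambda>x. u x - v n x) < ennreal e"
    using lim by (intro order_tendstoD(2)[of _ "0::ennreal"]) auto
  from eventually_happens'[OF sequentially_bot this]
  show "\<exists>v\<in>Sobolev p UNIV. compact_support_in v \<Omega> \<and> Sobolev_modular \<Omega> (\<lambda>x. u x - v x) < ennreal e"
    using assms(3,4) by blast
qed

lemma Sobolev0_add_scaleR:
  assumes \<Omega>: "open \<Omega>" and u: "u \<in> Sobolev0 p \<Omega>" and v: "v \<in> Sobolev0 p \<Omega>"
  shows "(\<lambda>x. u x + c * v x) \<in> Sobolev0 p \<Omega>"
proof -
  note su = Sobolev0_imp_Sobolev[OF u] and sv = Sobolev0_imp_Sobolev[OF v]
  obtain a where a: "\<And>n. a n \<in> Sobolev p UNIV" "\<And>n. compact_support_in (a n) \<Omega>"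
      "\<And>n. Sobolev_modular \<Omega> (\<lambda>x. u x - a n x) \<le> ennreal ((1 / 2) ^ n)"
    using Sobolev0_sequence[OF \<Omega> u] by metis
  obtain b where b: "\<And>n. b n \<in> Sobolev p UNIV" "\<And>n. compact_support_in (b n) \<Omega>"
      "\<And>n. Sobolev_modular \<Omega> (\<lambda>x. v x - b n x) \<le> ennreal ((1 / 2) ^ n)"
    using Sobolev0_sequence[OF \<Omega> v] by metis
  show ?thesis
  proof (rule Sobolev0_limit[OF \<Omega> Sobolev_modular_add_scaleR(1)[OF \<Omega> su sv]
        Sobolev_modular_add_scaleR(1)[OF open_UNIV a(1) b(1)]])
    fix n
    show "compact_support_in (\<lambda>x. a n x + c * b n x) \<Omega>"
    proof (rule compact_support_inI)
      show "compact (closure {x. a n x \<noteq> 0} \<union> closure {x. b n x \<noteq> 0})"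
        "closure {x. a n x \<noteq> 0} \<union> closure {x. b n x \<noteq> 0} \<subseteq> \<Omega>"
        using a(2)[of n] b(2)[of n] by (auto simp: compact_support_in_def intro!: compact_Un)
      fix x assume "x \<notin> closure {x. a n x \<noteq> 0} \<union> closure {x. b n x \<noteq> 0}"
      then show "a n x + c * b n x = 0"
        using eq_0_off_closure[of x "a n"] eq_0_off_closure[of x "b n"] by simp
    qed
  next
    let ?K = "ennreal ((2 * max 1 \<bar>c\<bar>) powr P)"
    define e where "e = (\<lambda>n. ennreal ((1 / 2) ^ n))"
    have "(\<lambda>n. (1 / 2 :: real) ^ n) \<longlonglongrightarrow> 0" by (rule LIMSEQ_power_zero) simp
    then have "e \<longlonglongrightarrow> ennreal 0" unfolding e_def by (rule tendsto_ennrealI)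
    then have "(\<lambda>n. ?K * (e n + e n)) \<longlonglongrightarrow> ?K * (0 + 0)"
      by (intro tendsto_add ennreal_tendsto_cmult) auto
    then have b0: "(\<lambda>n. ?K * (e n + e n)) \<longlonglongrightarrow> 0" by simp
    have bound: "Sobolev_modular \<Omega> (\<lambda>x. u x + c * v x - (a n x + c * b n x)) \<le> ?K * (e n + e n)" for n
    proof -
      have ua: "(\<lambda>x. u x - a n x) \<in> Sobolev p \<Omega>"
        using Sobolev_modular_add_scaleR(1)[OF \<Omega> su Sobolev_UNIV_imp_Sobolev[OF \<Omega> a(1)], of "-1"] by simp
      have vb: "(\<lambda>x. v x - b n x) \<in> Sobolev p \<Omega>"
        using Sobolev_modular_add_scaleR(1)[OF \<Omega> sv Sobolev_UNIV_imp_Sobolev[OF \<Omega> b(1)], of "-1"] by simp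
      have "Sobolev_modular \<Omega> (\<lambda>x. (u x - a n x) + c * (v x - b n x)) \<le> ?K * (e n + e n)"
        by (rule order_trans[OF Sobolev_modular_add_scaleR(2)[OF \<Omega> ua vb]])
          (auto intro!: mult_left_mono add_mono a(3) b(3) simp: e_def)
      then show ?thesis by (simp add: algebra_simps)
    qed
    show "(\<lambda>n. Sobolev_modular \<Omega> (\<lambda>x. u x + c * v x - (a n x + c * b n x))) \<longlonglongrightarrow> 0"
      by (rule tendsto_sandwich[OF _ _ tendsto_const b0]) (auto intro!: always_eventually bound)
  qed
qed

text \<open>Taking positive parts keeps the approximants admissible, and the geometric rate makes
  this operation continuous along them.\<close>

lemma Sobolev0_pos_part:
  assumes \<Omega>: "open \<Omega>" and u: "u \<in> Sobolev0 p \<Omega>"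
  shows "(\<lambda>x. max (u x) 0) \<in> Sobolev0 p \<Omega>"
proof -
  note su = Sobolev0_imp_Sobolev[OF u]
  obtain a where a: "\<And>n. a n \<in> Sobolev p UNIV" "\<And>n. compact_support_in (a n) \<Omega>"
      "\<And>n. Sobolev_modular \<Omega> (\<lambda>x. u x - a n x) \<le> ennreal ((1 / 2) ^ n)"
    using Sobolev0_sequence[OF \<Omega> u] by metis
  show ?thesis
  proof (rule Sobolev0_limit[OF \<Omega> Sobolev_pos_part[OF \<Omega> su] Sobolev_pos_part[OF open_UNIV a(1)]])
    show "compact_support_in (\<lambda>x. max (a n x) 0) \<Omega>" for n
    proof (rule compact_support_inI)
      show "compact (closure {x. a n x \<noteq> 0})" "closure {x. a n x \<noteq> 0} \<subseteq> \<Omega>"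
        using a(2)[of n] by (auto simp: compact_support_in_def)
      show "max (a n x) 0 = 0" if "x \<notin> closure {x. a n x \<noteq> 0}" for x
        using eq_0_off_closure[OF that] by simp
    qed
    show "(\<lambda>n. Sobolev_modular \<Omega> (\<lambda>x. max (u x) 0 - max (a n x) 0)) \<longlonglongrightarrow> 0"
      by (rule tendsto_Sobolev_modular_pos_part[OF \<Omega> su Sobolev_UNIV_imp_Sobolev[OF \<Omega> a(1)] a(3)])
  qed
qed

text \<open>If \<open>v\<^sub>n\<close> approximates \<open>g\<close>, then \<open>min w v\<^sub>n\<close>, which has compact support because \<open>w \<ge> 0\<close>,
  approximates \<open>w\<close>.\<close>

lemma Sobolev0_dominated:
  assumes \<Omega>: "open \<Omega>" and w: "w \<in> Sobolev p \<Omega>" and g: "g \<in> Sobolev0 p \<Omega>"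
    and le: "\<And>x. x \<in> \<Omega> \<Longrightarrow> 0 \<le> w x" "\<And>x. x \<in> \<Omega> \<Longrightarrow> w x \<le> g x"
  shows "w \<in> Sobolev0 p \<Omega>"
proof -
  note sg = Sobolev0_imp_Sobolev[OF g]
  have diff: "(\<lambda>x. u x - v x) \<in> Sobolev p \<Omega>" if "u \<in> Sobolev p \<Omega>" "v \<in> Sobolev p \<Omega>" for u v
    using Sobolev_modular_add_scaleR(1)[OF \<Omega> that, of "-1"] by simp
  obtain v where v: "\<And>n. v n \<in> Sobolev p UNIV" "\<And>n. compact_support_in (v n) \<Omega>"
      "\<And>n. Sobolev_modular \<Omega> (\<lambda>x. g x - v n x) \<le> ennreal ((1 / 2) ^ n)"
    using Sobolev0_sequence[OF \<Omega> g] by metis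
  note sv = Sobolev_UNIV_imp_Sobolev[OF \<Omega> v(1)]
  \<comment> \<open>Since \<open>w \<le> g\<close>, the positive part of \<open>?z\<close> is zero
    on \<Omega>, and w minus the minimum of w and \<open>v n\<close> is the positive part of
    \<open>?y n\<close>. Continuity of the positive part thus says that these differences tend to
    0.\<close>
  let ?z = "\<lambda>x. w x - g x" and ?y = "\<lambda>n x. w x - v n x"
  have small: "Sobolev_modular \<Omega> (\<lambda>x. ?z x - ?y n x) \<le> ennreal ((1 / 2) ^ n)" for n
    using v(3)[of n] Sobolev_modular_uminus[OF \<Omega> diff[OF sg sv], of n] by simp
  have lim: "(\<lambda>n. Sobolev_modular \<Omega> (\<lambda>x. max (?z x) 0 - max (?y n x) 0)) \<longlonglongrightarrow> 0"
    by (rule tendsto_Sobolev_modular_pos_part[OF \<Omega> diff[OF w sg] diff[OF w sv] small])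
  \<comment> \<open>The sign of \<open>w\<close> is known on \<Omega> only, so the value 0 is
    imposed elsewhere; inside \<Omega>, where \<open>v n\<close> is zero, the minimum is 0 because
    of \<open>w \<ge> 0\<close>.\<close>
  define m where "m = (\<lambda>n x. if x \<in> \<Omega> then min (w x) (v n x) else 0)"
  let ?K = "\<lambda>n. closure {x. v n x \<noteq> 0}"
  have K: "compact (?K n)" "?K n \<subseteq> \<Omega>" for n
    using v(2)[of n] by (auto simp: compact_support_in_def)
  have m0: "m n x = 0" if "x \<notin> ?K n" for n x
    using eq_0_off_closure[OF that] le(1)[of x] by (simp add: m_def)
  have wm: "w x - m n x = max (?y n x) 0" if "x \<in> \<Omega>" for n x
    using that by (simp add: m_def min_def max_def)
  have pos: "(\<lambda>x. max (?y n x) 0) \<in> Sobolev p \<Omega>" for n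
    by (rule Sobolev_pos_part[OF \<Omega> diff[OF w sv]])
  have "m n \<in> Sobolev p \<Omega> \<longleftrightarrow> (\<lambda>x. w x - max (?y n x) 0) \<in> Sobolev p \<Omega>" for n
    by (rule Sobolev_cong[OF \<Omega>]) (use wm in \<open>simp add: algebra_simps\<close>)
  then have sm: "m n \<in> Sobolev p \<Omega>" for n
    using diff[OF w pos] by simp
  show ?thesis
  proof (rule Sobolev0_limit[OF \<Omega> w])
    show "m n \<in> Sobolev p UNIV" for n
      by (rule Sobolev_extend_0[OF \<Omega> sm K m0])
    show "compact_support_in (m n) \<Omega>" for n
      by (rule compact_support_inI[OF K m0])
    have "Sobolev_modular \<Omega> (\<lambda>x. max (?z x) 0 - max (?y n x) 0) = Sobolev_modular \<Omega> (\<lambda>x. - (max (?y n x) 0))" for n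
      by (rule Sobolev_modular_cong) (use le(2) in simp)
    also have "\<dots> n = Sobolev_modular \<Omega> (\<lambda>x. w x - m n x)" for n
      unfolding Sobolev_modular_uminus[OF \<Omega> pos] by (rule Sobolev_modular_cong) (use wm in simp)
    finally show "(\<lambda>n. Sobolev_modular \<Omega> (\<lambda>x. w x - m n x)) \<longlonglongrightarrow> 0"
      using lim by simp
  qed
qed

end

section \<open>Strict convexity of powers of the norm\<close>

lemma powr_midpoint_strict:
  fixes s t q :: real
  assumes "q > 1" "0 \<le> s" "s < t"
  shows "2 * ((s + t) / 2) powr q < s powr q + t powr q"
proof -
  define r where "r = (s + t) / 2"
  have r: "s < r" "r < t" "t - r = r - s" using assms by (auto simp: r_def field_simps)
  \<comment> \<open>The left endpoint may be 0, so continuity is used on the closed interval and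
    differentiability in its interior. Comparing the halves left and right of the midpoint then uses
    that x ^ (q - 1) is strictly increasing.\<close>
  have mvt: "\<exists>z. a < z \<and> z < b \<and> b powr q - a powr q = (b - a) * (q * z powr (q - 1))"
    if "0 \<le> a" "a < b" for a b
  proof -
    have "continuous_on {a..b} (\<lambda>x. x powr q)"
      using that assms by (intro continuous_on_powr' continuous_intros) auto
    moreover have d: "((\<lambda>x. x powr q) has_real_derivative q * x powr (q - 1)) (at x)" if "a < x" for x
      using that \<open>0 \<le> a\<close> by (intro has_real_derivative_powr) auto
    ultimately obtain l z where z: "a < z" "z < b" "((\<lambda>x. x powr q) has_real_derivative l) (at z)"
        "b powr q - a powr q = (b - a) * l"
      using MVT[OF \<open>a < b\<close>] by (metis real_differentiable_def)
    then show ?thesis using DERIV_unique[OF z(3) d[OF z(1)]] by auto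
  qed
  obtain z1 where z1: "s < z1" "z1 < r" "r powr q - s powr q = (r - s) * (q * z1 powr (q - 1))"
    using mvt[of s r] assms r by auto
  obtain z2 where z2: "r < z2" "z2 < t" "t powr q - r powr q = (t - r) * (q * z2 powr (q - 1))"
    using mvt[of r t] assms r by auto
  have "z1 powr (q - 1) < z2 powr (q - 1)"
    using z1 z2 assms by (intro powr_less_mono2) auto
  then have "(r - s) * (q * z1 powr (q - 1)) < (r - s) * (q * z2 powr (q - 1))"
    using r assms by simp
  then have "r powr q - s powr q < t powr q - r powr q"
    unfolding z1(3) z2(3) r(3) .
  then show ?thesis by (simp add: r_def)
qed

text \<open>Equality forces equal norms, by strict convexity of the scalar power. It then forces
  equality in the triangle inequality, so that in an inner product space the vectors point in the
  same direction and coincide.\<close>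

lemma norm_midpoint_powr:
  fixes a b :: "'b::real_inner"
  assumes q: "q > 1"
  shows "2 * norm ((1 / 2) *\<^sub>R (a + b)) powr q \<le> norm a powr q + norm b powr q"
    and "norm a powr q + norm b powr q \<le> 2 * norm ((1 / 2) *\<^sub>R (a + b)) powr q \<Longrightarrow> a = b"
proof -
  have "norm ((1 / 2) *\<^sub>R (a + b)) \<le> (norm a + norm b) / 2"
    using norm_triangle_ineq[of a b] by simp
  then have m: "2 * norm ((1 / 2) *\<^sub>R (a + b)) powr q \<le> 2 * ((norm a + norm b) / 2) powr q"
    using q by (intro mult_left_mono powr_mono2) auto
  have conv: "2 * ((norm a + norm b) / 2) powr q < norm a powr q + norm b powr q" if "norm a \<noteq> norm b"
    using powr_midpoint_strict[OF q, of "norm a" "norm b"] powr_midpoint_strict[OF q, of "norm b" "norm a"] that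
    by (cases "norm a < norm b") (simp_all add: add.commute)
  show "2 * norm ((1 / 2) *\<^sub>R (a + b)) powr q \<le> norm a powr q + norm b powr q"
    using m conv by (cases "norm a = norm b") auto
  assume le: "norm a powr q + norm b powr q \<le> 2 * norm ((1 / 2) *\<^sub>R (a + b)) powr q"
  then have eq: "norm a = norm b" using m conv by fastforce
  with le have "norm a powr q \<le> norm ((1 / 2) *\<^sub>R (a + b)) powr q" by simp
  then have "norm a \<le> norm ((1 / 2) *\<^sub>R (a + b))"
    using q powr_less_mono2[of q "norm ((1 / 2) *\<^sub>R (a + b))" "norm a"] by fastforce
  then have "norm (a + b) = norm a + norm b"
    using norm_triangle_ineq[of a b] eq by simp
  then have "norm a *\<^sub>R b = norm a *\<^sub>R a"
    using norm_triangle_eq[of a b] eq by simp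
  then show "a = b" using eq by auto
qed

context bounded_exponent
begin

text \<open>An elementary passage from the modular to L^1: values above \<delta> satisfy |a| = |a| ^
  (1 - p) |a| ^ p, and the first factor is at most \<delta> ^ (1 - P).\<close>

lemma norm_le_powr:
  assumes "0 < \<delta>" "\<delta> \<le> 1"
  shows "norm a \<le> \<delta> + \<delta> powr (1 - P) * norm a powr p x"
proof (cases "norm a \<le> \<delta>")
  case True
  then show ?thesis by (simp add: add_increasing2)
next
  case False
  then have a: "norm a > 0" using assms by linarith
  have "norm a = norm a powr (1 - p x) * norm a powr p x"
    using a by (simp add: powr_add[symmetric])
  also have "\<dots> \<le> \<delta> powr (1 - P) * norm a powr p x"
  proof (rule mult_right_mono)
    have "norm a powr (1 - p x) \<le> \<delta> powr (1 - p x)"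
      using False assms p_ge_1[of x] by (intro powr_mono2') auto
    also have "\<dots> \<le> \<delta> powr (1 - P)"
      using assms p_le[of x] by (intro powr_mono') auto
    finally show "norm a powr (1 - p x) \<le> \<delta> powr (1 - P)" .
  qed simp
  finally show ?thesis using assms(1) by linarith
qed

lemma nn_integral_norm_le_if_modular_le:
  fixes u :: "'a \<Rightarrow> 'b::euclidean_space"
  assumes \<Omega>: "open \<Omega>" "bounded \<Omega>" and u: "u \<in> borel_measurable (lebesgue_on \<Omega>)"
    and \<delta>: "0 < \<delta>" "\<delta> \<le> 1" and le: "modular p \<Omega> u \<le> ennreal (C * \<delta> powr P)" and "C \<ge> 0"
  shows "(\<integral>\<^sup>+x. ennreal (norm (u x)) \<partial>lebesgue_on \<Omega>) \<le> ennreal (\<delta> * (measure lebesgue \<Omega> + C))"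
proof -
  note [measurable] = norm_powr_measurable[OF u]
  have \<Omega>m: "\<Omega> \<in> lmeasurable" using \<Omega> by (intro bounded_set_imp_lmeasurable) auto
  have "(\<integral>\<^sup>+x. ennreal (norm (u x)) \<partial>lebesgue_on \<Omega>)
      \<le> (\<integral>\<^sup>+x. ennreal \<delta> + ennreal (\<delta> powr (1 - P)) * ennreal (norm (u x) powr p x) \<partial>lebesgue_on \<Omega>)"
  proof (rule nn_integral_mono)
    fix x
    have "ennreal (norm (u x)) \<le> ennreal (\<delta> + \<delta> powr (1 - P) * norm (u x) powr p x)"
      by (rule ennreal_leI[OF norm_le_powr[OF \<delta>]])
    then show "ennreal (norm (u x)) \<le> ennreal \<delta> + ennreal (\<delta> powr (1 - P)) * ennreal (norm (u x) powr p x)"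
      using \<delta> by (simp add: ennreal_mult)
  qed
  also have "\<dots> = ennreal \<delta> * emeasure lebesgue \<Omega> + ennreal (\<delta> powr (1 - P)) * modular p \<Omega> u"
    using \<Omega>(1) by (simp add: nn_integral_add nn_integral_cmult modular_def emeasure_restrict_space)
  also have "\<dots> \<le> ennreal \<delta> * ennreal (measure lebesgue \<Omega>) + ennreal (\<delta> powr (1 - P)) * ennreal (C * \<delta> powr P)"
    using \<Omega>m by (intro add_mono mult_left_mono le) (simp_all add: emeasure_eq_measure2)
  also have "\<dots> = ennreal (\<delta> * measure lebesgue \<Omega> + \<delta> powr (1 - P) * (C * \<delta> powr P))"
    using \<delta> \<open>C \<ge> 0\<close> by (simp add: ennreal_mult)
  \<comment> \<open>The assumed size of the modular is chosen so that both terms are proportional to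
    \<delta>.\<close>
  also have "\<delta> powr (1 - P) * (C * \<delta> powr P) = \<delta> * C"
    using \<delta> by (simp add: powr_diff)
  finally show ?thesis by (simp add: distrib_left)
qed

text \<open>The compactly supported approximants satisfy integration by parts on the whole space.
  Passing to the limit in L^1 shows that the extension of \<open>v\<close> by zero has weak
  derivative 0 on the whole space, across the boundary of \<Omega> too.\<close>

lemma Sobolev0_gradient_0_imp_0:
  assumes \<Omega>: "open \<Omega>" "bounded \<Omega>" and v: "v \<in> Sobolev0 p \<Omega>"
    and V0: "AE x in lebesgue_on \<Omega>. weak_gradient \<Omega> v x = 0"
  shows "AE x in lebesgue_on \<Omega>. v x = 0"
proof -
  note V = SobolevD[OF \<Omega>(1) Sobolev0_imp_Sobolev[OF v]]
  obtain a where a: "\<And>n. a n \<in> Sobolev p UNIV" "\<And>n. compact_support_in (a n) \<Omega>"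
      "\<And>n. Sobolev_modular \<Omega> (\<lambda>x. v x - a n x) \<le> ennreal ((1 / 2) ^ n)"
    using Sobolev0_sequence[OF \<Omega>(1) v] by metis
  define H where "H = (\<lambda>n. weak_gradient UNIV (a n))"
  have HU: "is_weak_gradient UNIV (a n) (H n)" for n
    using SobolevD(1)[OF open_UNIV a(1)] by (simp add: H_def)
  have HO: "is_weak_gradient \<Omega> (a n) (H n)" for n
    by (rule is_weak_gradient_mono[OF HU \<Omega>(1) open_UNIV subset_UNIV])
  have am: "a n \<in> borel_measurable (lebesgue_on \<Omega>)" and Hm: "H n \<in> borel_measurable (lebesgue_on \<Omega>)" for n
    using is_weak_gradientD(1,2)[OF HO] by (simp_all add: locally_integrable_measurable[OF \<Omega>(1)])
  have a0: "a n x = 0" if "x \<notin> \<Omega>" for n x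
    using a(2)[of n] eq_0_off_closure[of x "a n"] that by (auto simp: compact_support_in_def)
  \<comment> \<open>A weak gradient vanishes almost everywhere on the zero set of its function.
    Integrals of the norm of \<open>H n\<close> over \<Omega> and over the whole space therefore
    agree.\<close>
  have H0: "AE x in lebesgue. x \<notin> \<Omega> \<longrightarrow> H n x = 0" for n
    using weak_gradient_0_on_zero_set[OF open_UNIV HU[of n]] by eventually_elim (simp add: a0)
  define w where "w = (\<lambda>x. if x \<in> \<Omega> then v x else 0)"
  \<comment> \<open>Chosen such that (\<theta> ^ n) ^ P = 2 ^ (-n): a modular of size 2 ^ (-n)
    becomes an L^1 bound of order \<theta> ^ n.\<close>
  define \<theta> :: real where "\<theta> = (1 / 2) powr (1 / P)"
  have \<theta>: "0 < \<theta>" "\<theta> < 1"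
    using P_ge_1 powr_less_mono2[of "1 / P" "1 / 2" 1] by (simp_all add: \<theta>_def)
  have \<theta>P: "(\<theta> ^ n) powr P = (1 / 2) ^ n" for n
  proof -
    have "(\<theta> ^ n) powr P = (\<theta> powr real n) powr P"
      using \<theta>(1) by (simp add: powr_realpow)
    also have "\<dots> = (\<theta> powr P) powr real n"
      by (simp add: powr_powr mult.commute)
    also have "\<dots> = (\<theta> powr P) ^ n"
      using \<theta>(1) by (simp add: powr_realpow)
    also have "\<theta> powr P = 1 / 2"
      using P_ge_1 by (simp add: \<theta>_def powr_powr)
    finally show ?thesis .
  qed
  have \<theta>n: "0 < \<theta> ^ n" "\<theta> ^ n \<le> 1" for n
    using \<theta> by (auto intro: power_le_one)
  define m where "m = measure lebesgue \<Omega> + 1"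
  have va_modular: "modular p \<Omega> (\<lambda>x. v x - a n x) \<le> ennreal (1 * (\<theta> ^ n) powr P)"
    and H_modular: "modular p \<Omega> (H n) \<le> ennreal (1 * (\<theta> ^ n) powr P)" for n
  proof -
    have g: "is_weak_gradient \<Omega> (\<lambda>x. v x - a n x) (\<lambda>x. weak_gradient \<Omega> v x - H n x)"
      using is_weak_gradient_add_scaleR[OF \<Omega>(1) V(1) HO, of "-1" n] by simp
    have le: "modular p \<Omega> (\<lambda>x. v x - a n x) \<le> ennreal ((1 / 2) ^ n)"
      "modular p \<Omega> (\<lambda>x. weak_gradient \<Omega> v x - H n x) \<le> ennreal ((1 / 2) ^ n)"
      using a(3)[of n] unfolding Sobolev_modular_eq[OF \<Omega>(1) g] by (auto elim: order_trans[rotated])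
    show "modular p \<Omega> (\<lambda>x. v x - a n x) \<le> ennreal (1 * (\<theta> ^ n) powr P)"
      using le(1) by (simp only: \<theta>P mult_1)
    \<comment> \<open>As the gradient of \<open>v\<close> is zero, the gradients of the approximants
      are themselves the small errors.\<close>
    have "modular p \<Omega> (H n) = modular p \<Omega> (\<lambda>x. weak_gradient \<Omega> v x - H n x)"
      by (rule modular_cong_AE, use V0 in eventually_elim) simp
    then show "modular p \<Omega> (H n) \<le> ennreal (1 * (\<theta> ^ n) powr P)"
      using le(2) by (simp only: \<theta>P mult_1)
  qed
  have restrict: "(\<integral>\<^sup>+x. ennreal (norm (f x)) \<partial>lebesgue) = (\<integral>\<^sup>+x. ennreal (norm (g x)) \<partial>lebesgue_on \<Omega>)"
    if "AE x in lebesgue. x \<notin> \<Omega> \<longrightarrow> f x = 0" "\<And>x. x \<in> \<Omega> \<Longrightarrow> f x = g x" for f g :: "'a \<Rightarrow> 'b::real_normed_vector"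
  proof -
    have "(\<integral>\<^sup>+x. ennreal (norm (f x)) \<partial>lebesgue) = (\<integral>\<^sup>+x. ennreal (norm (g x)) * indicator \<Omega> x \<partial>lebesgue)"
      by (rule nn_integral_cong_AE, use that(1) in eventually_elim) (use that(2) in \<open>auto simp: indicator_def\<close>)
    then show ?thesis using \<Omega>(1) by (simp add: nn_integral_restrict_space)
  qed
  have wa_le: "(\<integral>\<^sup>+x. ennreal (norm (w x - a n x)) \<partial>lebesgue) \<le> ennreal (\<theta> ^ n * m)" for n
  proof -
    have "(\<integral>\<^sup>+x. ennreal (norm (w x - a n x)) \<partial>lebesgue) = (\<integral>\<^sup>+x. ennreal (norm (v x - a n x)) \<partial>lebesgue_on \<Omega>)"
      by (rule restrict) (auto simp: w_def a0)
    also have "\<dots> \<le> ennreal (\<theta> ^ n * m)"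
      unfolding m_def using V(2) am
      by (intro nn_integral_norm_le_if_modular_le[OF \<Omega> _ \<theta>n va_modular] borel_measurable_diff) auto
    finally show ?thesis .
  qed
  have H_le: "(\<integral>\<^sup>+x. ennreal (norm (H n x)) \<partial>lebesgue) \<le> ennreal (\<theta> ^ n * m)" for n
    using nn_integral_norm_le_if_modular_le[OF \<Omega> Hm \<theta>n H_modular, of n] restrict[OF H0, of n "H n"]
    by (simp add: m_def)
  have wm [measurable]: "w \<in> borel_measurable lebesgue"
  proof -
    have "(\<lambda>x. indicator \<Omega> x *\<^sub>R v x) \<in> borel_measurable lebesgue"
      using V(2) \<Omega>(1) by (simp add: borel_measurable_restrict_space_iff)
    also have "(\<lambda>x. indicator \<Omega> x *\<^sub>R v x) = w"
      by (auto simp: w_def indicator_def fun_eq_iff)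
    finally show ?thesis .
  qed
  have amU [measurable]: "a n \<in> borel_measurable lebesgue" and HmU [measurable]: "H n \<in> borel_measurable lebesgue" for n
    using is_weak_gradientD(1,2)[OF HU, of n] locally_integrable_measurable[OF open_UNIV]
    by (simp_all only: lebesgue_on_UNIV_eq)
  have wa_int: "integrable lebesgue (\<lambda>x. w x - a n x)" for n
    by (rule integrableI_bounded) (use le_less_trans[OF wa_le[of n]] in auto)
  have H_int: "integrable lebesgue (H n)" for n
    by (rule integrableI_bounded) (use le_less_trans[OF H_le[of n]] in auto)
  have wa_le': "(\<integral>x. norm (w x - a n x) \<partial>lebesgue) \<le> \<theta> ^ n * m"
    and H_le': "(\<integral>x. norm (H n x) \<partial>lebesgue) \<le> \<theta> ^ n * m" for n
  proof -
    have "\<theta> ^ n * m \<ge> 0" using \<theta>n[of n] by (simp add: m_def)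
    then show "(\<integral>x. norm (w x - a n x) \<partial>lebesgue) \<le> \<theta> ^ n * m" "(\<integral>x. norm (H n x) \<partial>lebesgue) \<le> \<theta> ^ n * m"
      using wa_le[of n] H_le[of n]
        nn_integral_eq_integral[OF integrable_norm[OF wa_int[of n]]] nn_integral_eq_integral[OF integrable_norm[OF H_int[of n]]]
      by (simp_all add: ennreal_le_iff)
  qed
  have a_int: "integrable lebesgue (a 0)"
  proof -
    let ?K = "closure {x. a 0 x \<noteq> 0}"
    have "integrable lebesgue (\<lambda>x. indicator ?K x *\<^sub>R a 0 x)"
      using is_weak_gradientD(1)[OF HU[of 0]] a(2)[of 0] unfolding locally_integrable_iff compact_support_in_def by blast
    also have "(\<lambda>x. indicator ?K x *\<^sub>R a 0 x) = a 0"
    proof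
      show "indicator ?K x *\<^sub>R a 0 x = a 0 x" for x
        using eq_0_off_closure[of x "a 0"] by (cases "x \<in> ?K") simp_all
    qed
    finally show ?thesis .
  qed
  have w_int: "integrable lebesgue w"
    using Bochner_Integration.integrable_add[OF wa_int[of 0] a_int] by simp
  \<comment> \<open>One direction is enough, since translations along a single line already move the
    bounded set off itself.\<close>
  obtain b :: 'a where b: "b \<in> Basis" using nonempty_Basis by blast
  have "(\<integral>x. w x * frechet_derivative \<phi> (at x) b \<partial>lebesgue) = 0" if \<phi>: "\<phi> \<in> test_functions UNIV" for \<phi>
  proof -
    note d\<phi> = test_functions_derivative[OF \<phi> b]
    obtain B where B: "B > 0" "\<And>x. \<bar>\<phi> x\<bar> \<le> B" using test_functions_bounded[OF \<phi>] by blast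
    obtain D where D: "D > 0" "\<And>x. \<bar>frechet_derivative \<phi> (at x) b\<bar> \<le> D"
      using test_functions_bounded[OF d\<phi>] by blast
    have "\<bar>\<integral>x. w x * frechet_derivative \<phi> (at x) b \<partial>lebesgue\<bar> \<le> (D + B) * m * \<theta> ^ n" for n
    proof -
      have i: "integrable lebesgue (\<lambda>x. a n x * frechet_derivative \<phi> (at x) b)"
        by (rule integrable_locally_integrable_mult_test_function[OF is_weak_gradientD(1)[OF HU] d\<phi>])
      have "(\<integral>x. w x * frechet_derivative \<phi> (at x) b \<partial>lebesgue)
          = (\<integral>x. (w x - a n x) * frechet_derivative \<phi> (at x) b + a n x * frechet_derivative \<phi> (at x) b \<partial>lebesgue)"
        by (simp add: left_diff_distrib)
      also have "\<dots> = (\<integral>x. (w x - a n x) * frechet_derivative \<phi> (at x) b \<partial>lebesgue) - (\<integral>x. (H n x \<bullet> b) * \<phi> x \<partial>lebesgue)"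
        using i integrable_mult_test_function[OF wa_int d\<phi>] is_weak_gradientD(3)[OF HU open_UNIV \<phi> b] by simp
      finally have "\<bar>\<integral>x. w x * frechet_derivative \<phi> (at x) b \<partial>lebesgue\<bar>
          \<le> \<bar>\<integral>x. (w x - a n x) * frechet_derivative \<phi> (at x) b \<partial>lebesgue\<bar> + \<bar>\<integral>x. (H n x \<bullet> b) * \<phi> x \<partial>lebesgue\<bar>"
        by linarith
      also have "\<bar>\<integral>x. (w x - a n x) * frechet_derivative \<phi> (at x) b \<partial>lebesgue\<bar> \<le> D * (\<integral>x. norm (w x - a n x) \<partial>lebesgue)"
      proof -
        have "\<bar>\<integral>x. (w x - a n x) * frechet_derivative \<phi> (at x) b \<partial>lebesgue\<bar>
            \<le> (\<integral>x. \<bar>(w x - a n x) * frechet_derivative \<phi> (at x) b\<bar> \<partial>lebesgue)"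
          by (rule integral_abs_bound)
        also have "\<dots> \<le> (\<integral>x. D * norm (w x - a n x) \<partial>lebesgue)"
        proof (rule integral_mono)
          show "\<bar>(w x - a n x) * frechet_derivative \<phi> (at x) b\<bar> \<le> D * norm (w x - a n x)" for x
            unfolding abs_mult real_norm_def by (subst mult.commute, rule mult_right_mono[OF D(2)]) simp
        qed (use wa_int in \<open>auto intro!: integrable_mult_test_function[OF _ d\<phi>] integrable_abs\<close>)
        finally show ?thesis by simp
      qed
      also have "\<dots> \<le> D * (\<theta> ^ n * m)" using D(1) by (intro mult_left_mono wa_le') auto
      also have "\<bar>\<integral>x. (H n x \<bullet> b) * \<phi> x \<partial>lebesgue\<bar> \<le> B * (\<integral>x. norm (H n x) \<partial>lebesgue)"
      proof -
        have "\<bar>\<integral>x. (H n x \<bullet> b) * \<phi> x \<partial>lebesgue\<bar> \<le> (\<integral>x. \<bar>(H n x \<bullet> b) * \<phi> x\<bar> \<partial>lebesgue)"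
          by (rule integral_abs_bound)
        also have "\<dots> \<le> (\<integral>x. B * norm (H n x) \<partial>lebesgue)"
        proof (rule integral_mono)
          show "\<bar>(H n x \<bullet> b) * \<phi> x\<bar> \<le> B * norm (H n x)" for x
            unfolding abs_mult using b B by (subst mult.commute, intro mult_mono) (auto simp: Basis_le_norm)
        qed (use H_int in \<open>auto intro!: integrable_mult_test_function[OF _ \<phi>] integrable_abs\<close>)
        finally show ?thesis by simp
      qed
      also have "\<dots> \<le> B * (\<theta> ^ n * m)" using B(1) by (intro mult_left_mono H_le') auto
      finally show ?thesis by (simp add: algebra_simps)
    qed
    moreover have "(\<lambda>n. (D + B) * m * \<theta> ^ n) \<longlonglongrightarrow> 0"
      using \<theta> by (intro tendsto_mult_right_zero LIMSEQ_power_zero) simp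
    ultimately have "\<bar>\<integral>x. w x * frechet_derivative \<phi> (at x) b \<partial>lebesgue\<bar> \<le> 0"
      by (intro LIMSEQ_le_const) auto
    then show ?thesis by simp
  qed
  then have "weak_partial b w (\<lambda>_. 0)"
    using w_int by (simp add: weak_partial_def)
  then have "AE x in lebesgue. w x = 0"
    by (rule weak_partial_0_imp_eq_0[OF _ b \<Omega>(2)]) (simp add: w_def)
  then have "AE x in lebesgue. x \<in> \<Omega> \<longrightarrow> v x = 0"
    by eventually_elim (simp add: w_def split: if_splits)
  then show ?thesis using \<Omega>(1) by (simp add: AE_restrict_space_iff)
qed

section \<open>The comparison principle\<close>

lemma modular_eq_integral:
  fixes u :: "'a \<Rightarrow> 'b::euclidean_space"
  assumes "u \<in> borel_measurable (lebesgue_on \<Omega>)" "modular p \<Omega> u < \<infinity>"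
  shows "integrable (lebesgue_on \<Omega>) (\<lambda>x. norm (u x) powr p x)"
    and "modular p \<Omega> u = ennreal (\<integral>x. norm (u x) powr p x \<partial>lebesgue_on \<Omega>)"
proof -
  show i: "integrable (lebesgue_on \<Omega>) (\<lambda>x. norm (u x) powr p x)"
    by (rule integrableI_bounded[OF norm_powr_measurable[OF assms(1)]]) (use assms(2) in \<open>simp add: modular_def\<close>)
  show "modular p \<Omega> u = ennreal (\<integral>x. norm (u x) powr p x \<partial>lebesgue_on \<Omega>)"
    unfolding modular_def by (rule nn_integral_eq_integral[OF i]) simp
qed

text \<open>Averaging the two gradients on \<open>{v > 0}\<close> cannot lower either energy, whereas strict
  convexity says that it lowers their sum unless the gradients agree there.\<close>

lemma gradient_0_by_averaging:
  assumes \<Omega>: "open \<Omega>" and p1: "AE x in lebesgue_on \<Omega>. 1 < p x"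
    and u1: "u1 \<in> Sobolev p \<Omega>" and u2: "u2 \<in> Sobolev p \<Omega>"
    and v: "v = (\<lambda>x. max (u1 x - u2 x) 0)"
    and le1: "Dirichlet_energy p \<Omega> u1 \<le> Dirichlet_energy p \<Omega> (\<lambda>x. u1 x + (- (1 / 2)) * v x)"
    and le2: "Dirichlet_energy p \<Omega> u2 \<le> Dirichlet_energy p \<Omega> (\<lambda>x. u2 x + 1 / 2 * v x)"
  shows "AE x in lebesgue_on \<Omega>. weak_gradient \<Omega> v x = 0"
proof -
  define G1 where "G1 = weak_gradient \<Omega> u1"
  define G2 where "G2 = weak_gradient \<Omega> u2"
  note U1 = SobolevD[OF \<Omega> u1, folded G1_def] and U2 = SobolevD[OF \<Omega> u2, folded G2_def]
  define V where "V = (\<lambda>x. if u1 x - u2 x > 0 then G1 x - G2 x else 0)"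
  define M1 where "M1 = (\<lambda>x. G1 x + (- (1 / 2)) *\<^sub>R V x)"
  define M2 where "M2 = (\<lambda>x. G2 x + (1 / 2) *\<^sub>R V x)"
  have "(\<lambda>x. u1 x - u2 x) \<in> Sobolev p \<Omega>"
    using Sobolev_modular_add_scaleR(1)[OF \<Omega> u1 u2, of "-1"] by simp
  then have sv: "v \<in> Sobolev p \<Omega>" unfolding v by (rule Sobolev_pos_part[OF \<Omega>])
  have "is_weak_gradient \<Omega> (\<lambda>x. u1 x - u2 x) (\<lambda>x. G1 x - G2 x)"
    using is_weak_gradient_add_scaleR[OF \<Omega> U1(1) U2(1), of "-1"] by simp
  from is_weak_gradient_pos_part[OF \<Omega> this] have V: "is_weak_gradient \<Omega> v V"
    by (simp add: v V_def)
  note M1 = is_weak_gradient_add_scaleR[OF \<Omega> U1(1) V, of "- (1 / 2)", folded M1_def]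
  note M2 = is_weak_gradient_add_scaleR[OF \<Omega> U2(1) V, of "1 / 2", folded M2_def]
  have m: "M1 \<in> borel_measurable (lebesgue_on \<Omega>)" "M2 \<in> borel_measurable (lebesgue_on \<Omega>)"
    using is_weak_gradientD(2)[OF M1] is_weak_gradientD(2)[OF M2] by (simp_all add: locally_integrable_measurable[OF \<Omega>])
  \<comment> \<open>Finite energies allow the modulars to be replaced by real integrals, which can
    be subtracted.\<close>
  have f: "modular p \<Omega> M1 < \<infinity>" "modular p \<Omega> M2 < \<infinity>"
    using SobolevD(5)[OF \<Omega> Sobolev_modular_add_scaleR(1)[OF \<Omega> u1 sv, of "- (1 / 2)"]]
      SobolevD(5)[OF \<Omega> Sobolev_modular_add_scaleR(1)[OF \<Omega> u2 sv, of "1 / 2"]]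
    by (simp_all only: modular_weak_gradient[OF \<Omega> M1] modular_weak_gradient[OF \<Omega> M2])
  note e1 = modular_eq_integral[OF U1(3,5)] and e2 = modular_eq_integral[OF U2(3,5)]
  note c1 = modular_eq_integral[OF m(1) f(1)] and c2 = modular_eq_integral[OF m(2) f(2)]
  define d where "d = (\<lambda>x. norm (G1 x) powr p x + norm (G2 x) powr p x - norm (M1 x) powr p x - norm (M2 x) powr p x)"
  have d_int: "integrable (lebesgue_on \<Omega>) d"
    unfolding d_def using e1(1) e2(1) c1(1) c2(1) by simp
  have avg: "M1 x = (1 / 2) *\<^sub>R (G1 x + G2 x)" "M2 x = (1 / 2) *\<^sub>R (G1 x + G2 x)" if "u1 x - u2 x > 0" for x
  proof -
    have "G1 x - (1 / 2) *\<^sub>R G1 x = (1 / 2) *\<^sub>R G1 x" "G2 x - (1 / 2) *\<^sub>R G2 x = (1 / 2) *\<^sub>R G2 x"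
      using scaleR_left_diff_distrib[of 1 "1 / 2" "G1 x"] scaleR_left_diff_distrib[of 1 "1 / 2" "G2 x"] by simp_all
    then show "M1 x = (1 / 2) *\<^sub>R (G1 x + G2 x)" "M2 x = (1 / 2) *\<^sub>R (G1 x + G2 x)"
      using that by (simp_all add: M1_def M2_def V_def algebra_simps)
  qed
  have off: "M1 x = G1 x" "M2 x = G2 x" if "\<not> u1 x - u2 x > 0" for x
    using that by (simp_all add: M1_def M2_def V_def)
  have d_nonneg: "AE x in lebesgue_on \<Omega>. 0 \<le> d x"
    using p1
  proof eventually_elim
    case (elim x)
    then show ?case
      using norm_midpoint_powr(1)[of "p x" "G1 x" "G2 x"] avg[of x] off[of x]
      by (cases "u1 x - u2 x > 0") (simp_all add: d_def)
  qed
  have "(\<integral>x. norm (G1 x) powr p x \<partial>lebesgue_on \<Omega>) \<le> (\<integral>x. norm (M1 x) powr p x \<partial>lebesgue_on \<Omega>)"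
    using le1 unfolding Dirichlet_energy_def modular_weak_gradient[OF \<Omega> M1] G1_def[symmetric] e1(2) c1(2)
    by (simp add: ennreal_le_iff)
  moreover have "(\<integral>x. norm (G2 x) powr p x \<partial>lebesgue_on \<Omega>) \<le> (\<integral>x. norm (M2 x) powr p x \<partial>lebesgue_on \<Omega>)"
    using le2 unfolding Dirichlet_energy_def modular_weak_gradient[OF \<Omega> M2] G2_def[symmetric] e2(2) c2(2)
    by (simp add: ennreal_le_iff)
  ultimately have "(\<integral>x. d x \<partial>lebesgue_on \<Omega>) \<le> 0"
    unfolding d_def using e1(1) e2(1) c1(1) c2(1) by simp
  then have "(\<integral>x. d x \<partial>lebesgue_on \<Omega>) = 0"
    using integral_nonneg_AE[OF d_nonneg] by simp
  then have "AE x in lebesgue_on \<Omega>. d x = 0"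
    using integral_nonneg_eq_0_iff_AE[OF d_int d_nonneg] by simp
  then show ?thesis
    using p1 AE_weak_gradient_eq[OF \<Omega> V]
  proof eventually_elim
    case (elim x)
    show ?case
    proof (cases "u1 x - u2 x > 0")
      case True
      then have "G1 x = G2 x"
        using norm_midpoint_powr(2)[of "p x" "G1 x" "G2 x"] elim avg[OF True] by (simp add: d_def)
      then show ?thesis using elim by (simp add: V_def)
    qed (use elim in \<open>simp add: V_def\<close>)
  qed
qed

lemma is_H_comparison:
  assumes \<Omega>: "open \<Omega>" "bounded \<Omega>" and p1: "AE x in lebesgue_on \<Omega>. 1 < p x"
    and f: "(\<lambda>x. max (f1 x - f2 x) 0) \<in> Sobolev0 p \<Omega>"
    and u1: "is_H p \<Omega> f1 u1" and u2: "is_H p \<Omega> f2 u2" and x: "x \<in> \<Omega>"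
  shows "u1 x \<le> u2 x"
proof -
  have U1: "continuous_on \<Omega> u1" "u1 \<in> Sobolev p \<Omega>" "(\<lambda>x. u1 x - f1 x) \<in> Sobolev0 p \<Omega>"
    and min1: "\<And>w. w \<in> Sobolev p \<Omega> \<Longrightarrow> (\<lambda>x. w x - f1 x) \<in> Sobolev0 p \<Omega> \<Longrightarrow>
      Dirichlet_energy p \<Omega> u1 \<le> Dirichlet_energy p \<Omega> w"
    using u1 unfolding is_H_def by blast+
  have U2: "continuous_on \<Omega> u2" "u2 \<in> Sobolev p \<Omega>" "(\<lambda>x. u2 x - f2 x) \<in> Sobolev0 p \<Omega>"
    and min2: "\<And>w. w \<in> Sobolev p \<Omega> \<Longrightarrow> (\<lambda>x. w x - f2 x) \<in> Sobolev0 p \<Omega> \<Longrightarrow>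
      Dirichlet_energy p \<Omega> u2 \<le> Dirichlet_energy p \<Omega> w"
    using u2 unfolding is_H_def by blast+
  note add = Sobolev0_add_scaleR[OF \<Omega>(1)]
  define v where "v = (\<lambda>x. max (u1 x - u2 x) 0)"
  have sv: "v \<in> Sobolev p \<Omega>"
    using Sobolev_pos_part[OF \<Omega>(1) Sobolev_modular_add_scaleR(1)[OF \<Omega>(1) U1(2) U2(2), of "-1"]]
    by (simp add: v_def)
  have v0: "v \<in> Sobolev0 p \<Omega>"
  proof (rule Sobolev0_dominated[OF \<Omega>(1) sv])
    \<comment> \<open>This sum is at least u1 - u2, because the positive part of f1 - f2 is at least
      f1 - f2. Its positive part therefore dominates \<open>v\<close>.\<close>
    have "(\<lambda>x. (u1 x - f1 x) + (- 1) * (u2 x - f2 x) + 1 * max (f1 x - f2 x) 0) \<in> Sobolev0 p \<Omega>"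
      by (intro add f U1(3) U2(3))
    then show "(\<lambda>x. max ((u1 x - f1 x) + (- 1) * (u2 x - f2 x) + 1 * max (f1 x - f2 x) 0) 0) \<in> Sobolev0 p \<Omega>"
      by (rule Sobolev0_pos_part[OF \<Omega>(1)])
  qed (auto simp: v_def)
  have e1: "Dirichlet_energy p \<Omega> u1 \<le> Dirichlet_energy p \<Omega> (\<lambda>x. u1 x + (- (1 / 2)) * v x)"
  proof (rule min1[OF Sobolev_modular_add_scaleR(1)[OF \<Omega>(1) U1(2) sv]])
    show "(\<lambda>x. u1 x + (- (1 / 2)) * v x - f1 x) \<in> Sobolev0 p \<Omega>"
      using add[OF U1(3) v0, of "- (1 / 2)"] by (simp add: algebra_simps)
  qed
  have e2: "Dirichlet_energy p \<Omega> u2 \<le> Dirichlet_energy p \<Omega> (\<lambda>x. u2 x + 1 / 2 * v x)"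
  proof (rule min2[OF Sobolev_modular_add_scaleR(1)[OF \<Omega>(1) U2(2) sv]])
    show "(\<lambda>x. u2 x + 1 / 2 * v x - f2 x) \<in> Sobolev0 p \<Omega>"
      using add[OF U2(3) v0, of "1 / 2"] by (simp add: algebra_simps)
  qed
  have "AE x in lebesgue_on \<Omega>. weak_gradient \<Omega> v x = 0"
    by (rule gradient_0_by_averaging[OF \<Omega>(1) p1 U1(2) U2(2) v_def e1 e2])
  then have "AE x in lebesgue_on \<Omega>. v x = 0"
    by (rule Sobolev0_gradient_0_imp_0[OF \<Omega> v0])
  then have ae: "AE x in lebesgue. x \<in> \<Omega> \<longrightarrow> v x = 0"
    using \<Omega>(1) by (simp add: AE_restrict_space_iff)
  \<comment> \<open>The set where the claim fails: open by continuity, and a null set because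
    \<open>v\<close> is positive on it.\<close>
  let ?S = "\<Omega> \<inter> (\<lambda>x. u1 x - u2 x) -` {0<..}"
  have "open ?S"
    by (intro continuous_open_preimage continuous_on_diff U1(1) U2(1) \<Omega>(1)) simp
  moreover have "?S \<in> null_sets lebesgue"
  proof -
    have "AE x in lebesgue. x \<notin> ?S"
      using ae by eventually_elim (auto simp: v_def)
    then show ?thesis using \<open>open ?S\<close> by (subst AE_iff_null_sets) auto
  qed
  ultimately have "?S = {}"
    using open_not_negligible[of ?S] by (auto simp: negligible_iff_null_sets)
  then have "x \<notin> ?S" by simp
  then show ?thesis using x by simp
qed

end

section \<open>Bounds for admissible exponents\<close>

lemma log_Hoelder_bounded:
  assumes "log_Hoelder p"
  obtains P where "\<And>x. p x \<le> P"
proof -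
  obtain L where L: "L > 0" "\<And>x y. \<bar>p x - p y\<bar> \<le> L / ln (exp 1 + 1 / dist x y)"
    using assms unfolding log_Hoelder_def by blast
  \<comment> \<open>\<open>undefined\<close> is an arbitrary base point. The argument of the
    logarithm is at least e, also at distance 0, where 1 / 0 = 0; so \<open>p\<close> varies by at
    most \<open>L\<close> over the whole space.\<close>
  have "p x \<le> p undefined + L" for x
  proof -
    have "1 \<le> ln (exp 1 + 1 / dist x undefined)"
      by (subst ln_ge_iff) (auto intro: add_pos_nonneg)
    then have "L / ln (exp 1 + 1 / dist x undefined) \<le> L / 1"
      using L(1) by (intro divide_left_mono) auto
    then show ?thesis using L(2)[of x undefined] by linarith
  qed
  then show thesis by (rule that)
qed

lemma AE_essinf_less:
  assumes "c < essinf M f"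
  shows "AE x in M. c < f x"
  using esssup_AE[of "\<lambda>x. - f x" M]
proof eventually_elim
  case (elim x)
  then have "essinf M f \<le> f x"
    by (simp add: essinf_def ereal_uminus_le_reorder)
  with assms show ?case by (rule less_le_trans)
qed

theorem lemma3p10:
  fixes p :: "'a::euclidean_space \<Rightarrow> real"
    and \<Omega> :: "'a set"
    and f1 f2 Hf1 Hf2 :: "'a \<Rightarrow> real"
  assumes "admissible_exponent p"
    and "bounded \<Omega>" and "\<Omega> \<noteq> {}" and "open \<Omega>"
    and "f1 \<in> Sobolev p \<Omega>" and "essentially_bounded_on \<Omega> f1"
    and "f2 \<in> Sobolev p \<Omega>" and "essentially_bounded_on \<Omega> f2"
    and "(\<lambda>x. max (f1 x - f2 x) 0) \<in> Sobolev0 p \<Omega>"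
    and "is_H p \<Omega> f1 Hf1" and "is_H p \<Omega> f2 Hf2"
  shows "\<forall>x\<in>\<Omega>. Hf1 x \<le> Hf2 x"
proof -
  have p: "p \<in> borel_measurable lebesgue" "\<And>x. 1 \<le> p x"
      "1 < essinf lebesgue (\<lambda>x. ereal (p x))" "log_Hoelder p"
    using assms(1) unfolding admissible_exponent_def by blast+
  obtain P where P: "\<And>x. p x \<le> P" using log_Hoelder_bounded[OF p(4)] by blast
  interpret bounded_exponent p P
    by (rule bounded_exponent.intro) (fact p P)+
  have "AE x in lebesgue. 1 < ereal (p x)"
    by (rule AE_essinf_less[OF p(3)])
  then have "AE x in lebesgue. x \<in> \<Omega> \<longrightarrow> 1 < p x"
    by eventually_elim simp
  then have "AE x in lebesgue_on \<Omega>. 1 < p x"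
    using assms(4) by (simp add: AE_restrict_space_iff)
  then show ?thesis
    using is_H_comparison[OF assms(4,2) _ assms(9-11)] by blast
qed

end
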